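(* Let $k$ be a field and let $Q$ be a connected finite quiver with vertex set $I$. Let $C$ be the adjacency matrix of the double $\bar Q$. (1) Let $J\subset I$ be a nonempty subset, and let $\gamma$ be a $k^\times$-valued function on the set of edges of $\bar Q$ which begin or end at $I\setminus J$. Then the modified partial preprojective algebra $\Pi^\gamma_{Q,J}(k)$ has Hilbert series $$h_{\Pi^\gamma_{Q,J}(k)}(t)=(1-Ct+D_Jt^2)^{-1},$$ where $D_J$ is the diagonal $I\times I$ matrix with $(D_J)_{ii}=0$ if $i\in J$ and $(D_J)_{ii}=1$ if $i\notin J$. In particular, $\Pi^\gamma_{Q,J}(k)$ is Koszul. (2) Suppose $Q$ is non-Dynkin, and let $\gamma$ be a $k^\times$-valued function on the set of edges of $\bar Q$. Then the modified preprojective algebra $\Pi^\gamma_Q(k)$ has Hilbert series $$h_{\Pi^\gamma_{Q}(k)}(t)=(1-Ct+t^2)^{-1}.$$ In particular, $\Pi^\gamma_Q(k)$ is Koszul.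
   Context: Quivers are finite; multiple edges and self-loops are allowed. The field $k$ is arbitrary (any characteristic). A connected quiver is non-Dynkin if its underlying graph is not a Dynkin diagram of type $A_n$, $D_n$, $E_6$, $E_7$, $E_8$. For an edge $a$ of $Q$, $h(a)$ and $t(a)$ denote its head and tail. The double $\bar Q$ has the same vertex set $I$ and is obtained from $Q$ by adding, for each edge $a$ from $i$ to $j$, a new edge $a^*$ from $j$ to $i$. Put $R=\bigoplus_{i\in I}k$, the algebra of $k$-valued functions on $I$. The path algebra $k\bar Q$ is the tensor algebra over $R$ of the $R$-bimodule spanned by the edges of $\bar Q$; paths are composed so that, for $a\in Q$, $aa^*$ is a closed path at $h(a)$ and $a^*a$ is a closed path at $t(a)$. The modified partial preprojective algebra $\Pi^\gamma_{Q,J}(k)$ is the quotient of $k\bar Q$ by (the two-sided ideal generated by) the relation $$\sum_{a\in Q,\ h(a)\in I\setminus J}\gamma_a\,aa^*-\sum_{a\in Q,\ t(a)\in I\setminus J}\gamma_{a^*}\,a^*a=0.$$ For $J=\emptyset$ it is called the modified preprojective algebra and denoted $\Pi^\gamma_Q(k)$. These algebras are $\mathbb Z_+$-graded by path length, with degree-zero part $R$. For a $\mathbb Z_+$-graded $R$-bimodule $W=\bigoplus_{d\ge 0}W[d]$ with finite-dimensional homogeneous components, write $W[d]=\bigoplus_{i,j\in I}W[d]_{i,j}$ for the decomposition induced by the bimodule structure. The Hilbert series $h_W(t)$ is the $I\times I$ matrix of power series with entries $h_W(t)_{i,j}=\sum_{d\ge0}\dim W[d]_{i,j}\,t^d$.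 The adjacency matrix $C$ of $\bar Q$ has entries $C_{i,j}=\dim V_{i,j}$, where $V$ is the $R$-bimodule spanned by the edges of $\bar Q$ (so a self-loop of $Q$ at $i$ contributes $2$ to $C_{i,i}$). Here $1$ is the identity matrix, $t^2$ in (2) is the corresponding scalar matrix, and inverses are taken in matrices over $\mathbb Z[[t]]$. A quadratic algebra $A$ (generated over $A[0]=R$ in degree $1$ with relations in degree $2$) is Koszul if $\mathrm{Ext}^i_A(R,R)$ (or dually $\mathrm{Tor}_i^A(R,R)$) is concentrated in internal degree $i$ for all $i$, where $R=A/A_{>0}$. *)

theory Defs
  imports
    "HOL-Algebra.Embedded_Algebras"
    "HOL-Algebra.QuotRing"
    "HOL-Algebra.Module"
    "HOL-Library.Poly_Mapping"
    "HOL-Computational_Algebra.Formal_Power_Series"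
    "Graph_Theory.Graph_Theory"
begin

section \<open>Quivers\<close>

text \<open>
  A finite quiver is a \<open>fin_digraph\<close>: loops and parallel arcs are allowed there.
  In the double, \<open>Inl a\<close> is the arc \<open>a\<close> itself and \<open>Inr a\<close> is the reversed arc \<open>a*\<close>.
\<close>

definition double :: "('v, 'e) pre_digraph \<Rightarrow> ('v, 'e + 'e) pre_digraph" where
  "double Q = \<lparr>verts = verts Q, arcs = arcs Q <+> arcs Q,
     tail = case_sum (tail Q) (head Q), head = case_sum (head Q) (tail Q)\<rparr>"

definition underlying_graph_is :: "('v, 'e) pre_digraph \<Rightarrow> nat \<Rightarrow> nat set set \<Rightarrow> bool" where
  "underlying_graph_is Q n Es \<longleftrightarrow>
     (\<exists>f. bij_betw f (verts Q) {..<n} \<and>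
          bij_betw (\<lambda>a. {f (tail Q a), f (head Q a)}) (arcs Q) Es)"

definition line_edges :: "nat \<Rightarrow> nat set set" where
  "line_edges n = {{i, Suc i} | i. Suc i < n}"

text \<open>
  The diagrams \<open>D n\<close> and \<open>E n\<close> consist of a line with vertices \<open>0, \<dots>, n - 2\<close> and one more
  vertex \<open>n - 1\<close>, which is joined to \<open>n - 3\<close> and to \<open>2\<close>, respectively.
\<close>

definition Dynkin :: "('v, 'e) pre_digraph \<Rightarrow> bool" where
  "Dynkin Q \<longleftrightarrow>
     (\<exists>n\<ge>1. underlying_graph_is Q n (line_edges n)) \<or>
     (\<exists>n\<ge>4. underlying_graph_is Q n (insert {n - 3, n - 1} (line_edges (n - 1)))) \<or>
     (\<exists>n\<in>{6, 7, 8}. underlying_graph_is Q n (insert {2, n - 1} (line_edges (n - 1))))"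


section \<open>Graded algebras over a sum of copies of a field\<close>

text \<open>
  A \<open>\<int>\<^sub>+\<close>-graded algebra \<open>A\<close> whose part of degree zero is \<open>R = \<Oplus>\<^sub>i k\<close>. The field \<open>vscalars\<close>
  is the image of \<open>k\<close> in \<open>A\<close>, the element \<open>videm i\<close> is the idempotent of \<open>R\<close> that
  belongs to the vertex \<open>i\<close>, and \<open>gr d\<close> is the part of degree \<open>d\<close>.
\<close>

record ('a, 'v) graded_ring = "'a ring" +
  vertices :: "'v set"
  vscalars :: "'a set"
  videm :: "'v \<Rightarrow> 'a"
  gr :: "nat \<Rightarrow> 'a set"

definition component :: "('a, 'v) graded_ring \<Rightarrow> nat \<Rightarrow> 'v \<Rightarrow> 'v \<Rightarrow> 'a set" where
  "component A d i j = {x \<in> gr A d. videm A i \<otimes>\<^bsub>A\<^esub> x = x \<and> x \<otimes>\<^bsub>A\<^esub> videm A j = x}"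

definition hilbert_series :: "('a, 'v) graded_ring \<Rightarrow> 'v \<Rightarrow> 'v \<Rightarrow> int fps" where
  "hilbert_series A i j = Abs_fps (\<lambda>d. int (ring.dim A (vscalars A) (component A d i j)))"

definition graded_quotient :: "('a, 'v) graded_ring \<Rightarrow> 'a set \<Rightarrow> ('a set, 'v) graded_ring" where
  "graded_quotient A L = ring.extend (A Quot L)
     (graded_ring.fields (vertices A) ((\<lambda>x. L +>\<^bsub>A\<^esub> x) ` vscalars A)
        (\<lambda>i. L +>\<^bsub>A\<^esub> videm A i) (\<lambda>d. (\<lambda>x. L +>\<^bsub>A\<^esub> x) ` gr A d))"


section \<open>Path algebras\<close>

text \<open>
  A path is a triple \<open>(u, p, v)\<close>, where \<open>p\<close> is the list of arcs in the order in which they are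
  traversed from \<open>u\<close> to \<open>v\<close>. A product \<open>xy\<close> of paths traverses \<open>y\<close> first, so
  \<open>e\<^sub>i (kG) e\<^sub>j\<close> is spanned by the paths from \<open>j\<close> to \<open>i\<close>.
\<close>

type_synonym ('v, 'e) path = "'v \<times> 'e list \<times> 'v"

definition paths :: "('v, 'e) pre_digraph \<Rightarrow> ('v, 'e) path set" where
  "paths G = {(u, p, v). pre_digraph.awalk G u p v}"

definition path_prod ::
  "('v, 'e) path \<Rightarrow> ('v, 'e) path \<Rightarrow> (('v, 'e) path \<Rightarrow>\<^sub>0 'k::field)" where
  "path_prod x y = (case x of (u, p, v) \<Rightarrow> case y of (u', p', v') \<Rightarrow>
     if v' = u then Poly_Mapping.single (u', p' @ p, v) 1 else 0)"

definition path_alg_mult ::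
  "(('v, 'e) path \<Rightarrow>\<^sub>0 'k::field) \<Rightarrow> (('v, 'e) path \<Rightarrow>\<^sub>0 'k) \<Rightarrow> (('v, 'e) path \<Rightarrow>\<^sub>0 'k)" where
  "path_alg_mult f g =
     (\<Sum>x\<in>Poly_Mapping.keys f. \<Sum>y\<in>Poly_Mapping.keys g.
        Poly_Mapping.map ((*) (Poly_Mapping.lookup f x * Poly_Mapping.lookup g y)) (path_prod x y))"

definition path_scalar :: "('v, 'e) pre_digraph \<Rightarrow> 'k::field \<Rightarrow> (('v, 'e) path \<Rightarrow>\<^sub>0 'k)" where
  "path_scalar G c = (\<Sum>v\<in>verts G. Poly_Mapping.single (v, [], v) c)"

definition path_algebra ::
  "('v, 'e) pre_digraph \<Rightarrow> (('v, 'e) path \<Rightarrow>\<^sub>0 'k::field, 'v) graded_ring" where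
  "path_algebra G =
     \<lparr>carrier = {f. Poly_Mapping.keys f \<subseteq> paths G},
      monoid.mult = path_alg_mult, one = path_scalar G 1,
      zero = 0, add = (+),
      vertices = verts G, vscalars = range (path_scalar G),
      videm = (\<lambda>v. Poly_Mapping.single (v, [], v) 1),
      gr = (\<lambda>d. {f. Poly_Mapping.keys f \<subseteq> {(u, p, v) \<in> paths G. length p = d}})\<rparr>"

text \<open>The quotient of the path algebra by the two-sided ideal generated by \<open>S\<close>.\<close>

definition path_algebra_mod ::
  "('v, 'e) pre_digraph \<Rightarrow> (('v, 'e) path \<Rightarrow>\<^sub>0 'k::field) set
     \<Rightarrow> ((('v, 'e) path \<Rightarrow>\<^sub>0 'k) set, 'v) graded_ring" where
  "path_algebra_mod G S = graded_quotient (path_algebra G) (Idl\<^bsub>path_algebra G\<^esub> S)"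


section \<open>Graded left modules and Koszul algebras\<close>

text \<open>
  The locale \<open>module\<close> requires a commutative ring. Here its record type is used for left
  modules over noncommutative rings; the fields \<open>mult\<close> and \<open>one\<close> of the record play no role.
\<close>

record ('a, 'm) graded_module = "('a, 'm) module" +
  mgr :: "nat \<Rightarrow> 'm set"

definition left_module_hom ::
  "('a, 'v) graded_ring \<Rightarrow> ('a, 'm) graded_module \<Rightarrow> ('a, 'n) graded_module \<Rightarrow> ('m \<Rightarrow> 'n) set" where
  "left_module_hom A M N = {f \<in> carrier M \<rightarrow> carrier N.
     (\<forall>x\<in>carrier M. \<forall>y\<in>carrier M. f (x \<oplus>\<^bsub>M\<^esub> y) = f x \<oplus>\<^bsub>N\<^esub> f y) \<and>
     (\<forall>a\<in>carrier A. \<forall>x\<in>carrier M. f (a \<odot>\<^bsub>M\<^esub> x) = a \<odot>\<^bsub>N\<^esub> f x)}"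

text \<open>Homomorphisms that lower the degree by \<open>j\<close>; parts of negative degree are zero.\<close>

definition graded_hom ::
  "('a, 'v) graded_ring \<Rightarrow> ('a, 'm) graded_module \<Rightarrow> ('a, 'n) graded_module \<Rightarrow> int
     \<Rightarrow> ('m \<Rightarrow> 'n) set" where
  "graded_hom A M N j = {f \<in> left_module_hom A M N.
     \<forall>d. f ` mgr M d \<subseteq> (if j \<le> int d then mgr N (nat (int d - j)) else {\<zero>\<^bsub>N\<^esub>})}"

definition augmentation_ideal :: "('a, 'v) graded_ring \<Rightarrow> 'a set" where
  "augmentation_ideal A = Idl\<^bsub>A\<^esub> (\<Union>d\<in>{1..}. gr A d)"

text \<open>The left module \<open>R = A / A\<^sub>>\<^sub>0\<close>.\<close>

definition residue_module :: "('a, 'v) graded_ring \<Rightarrow> ('a, 'a set) graded_module" where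
  "residue_module A = (let L = augmentation_ideal A in
     ring.extend (A Quot L)
       \<lparr>smult = (\<lambda>a r. (L +>\<^bsub>A\<^esub> a) \<otimes>\<^bsub>A Quot L\<^esub> r),
        mgr = (\<lambda>d. (\<lambda>x. L +>\<^bsub>A\<^esub> x) ` gr A d)\<rparr>)"

text \<open>
  The graded projective module \<open>\<Oplus>\<^sub>x\<^sub>\<in>\<^sub>X A e\<^sub>s\<^sub>(\<^sub>x\<^sub>)\<close>, in which the generator of the summand of \<open>x\<close> has
  degree \<open>w x\<close>. Its elements are the finitely supported families of elements of the summands.
  Since \<open>A\<close> has \<open>R\<close> as its part of degree zero, every graded projective left module that is
  bounded below is of this form. Countable index sets suffice to resolve \<open>R\<close>, because \<open>A\<close> has
  finite-dimensional homogeneous parts.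
\<close>

definition projective_module ::
  "('a, 'v) graded_ring \<Rightarrow> nat set \<Rightarrow> (nat \<Rightarrow> 'v) \<Rightarrow> (nat \<Rightarrow> nat)
     \<Rightarrow> ('a, nat \<Rightarrow> 'a) graded_module" where
  "projective_module A X s w = (let
       P = {f. finite {x. f x \<noteq> \<zero>\<^bsub>A\<^esub>} \<and>
               (\<forall>x\<in>X. f x \<in> carrier A \<and> f x \<otimes>\<^bsub>A\<^esub> videm A (s x) = f x) \<and>
               (\<forall>x. x \<notin> X \<longrightarrow> f x = \<zero>\<^bsub>A\<^esub>)}
     in \<lparr>carrier = P, monoid.mult = undefined, one = undefined,
         zero = (\<lambda>x. \<zero>\<^bsub>A\<^esub>), add = (\<lambda>f g x. f x \<oplus>\<^bsub>A\<^esub> g x),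
         smult = (\<lambda>a f x. a \<otimes>\<^bsub>A\<^esub> f x),
         mgr = (\<lambda>d. {f \<in> P. \<forall>x\<in>X. if w x \<le> d then f x \<in> gr A (d - w x) else f x = \<zero>\<^bsub>A\<^esub>})\<rparr>)"

text \<open>
  \<open>\<dots> \<longrightarrow> P 2 \<longrightarrow> P 1 \<longrightarrow> P 0 \<longrightarrow> R \<longrightarrow> 0\<close> is a graded projective resolution, with
  differentials \<open>\<delta> n\<close> from \<open>P (n + 1)\<close> to \<open>P n\<close>.
\<close>

definition projective_resolution ::
  "('a, 'v) graded_ring \<Rightarrow> (nat \<Rightarrow> ('a, nat \<Rightarrow> 'a) graded_module)
     \<Rightarrow> (nat \<Rightarrow> (nat \<Rightarrow> 'a) \<Rightarrow> (nat \<Rightarrow> 'a)) \<Rightarrow> ((nat \<Rightarrow> 'a) \<Rightarrow> 'a set) \<Rightarrow> bool" where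
  "projective_resolution A P \<delta> \<epsilon> \<longleftrightarrow>
     (\<forall>n. \<exists>X s w. s ` X \<subseteq> vertices A \<and> P n = projective_module A X s w) \<and>
     \<epsilon> \<in> graded_hom A (P 0) (residue_module A) 0 \<and>
     (\<forall>n. \<delta> n \<in> graded_hom A (P (Suc n)) (P n) 0) \<and>
     \<epsilon> ` carrier (P 0) = carrier (residue_module A) \<and>
     \<delta> 0 ` carrier (P 1) = {x \<in> carrier (P 0). \<epsilon> x = \<zero>\<^bsub>residue_module A\<^esub>} \<and>
     (\<forall>n. \<delta> (Suc n) ` carrier (P (Suc (Suc n))) =
            {x \<in> carrier (P (Suc n)). \<delta> n x = \<zero>\<^bsub>P n\<^esub>})"

text \<open>
  The complex \<open>Hom\<^sub>A(P, R)\<close> of a resolution \<open>P\<close> of \<open>R\<close>. Its cohomology is \<open>Ext\<^sub>A(R, R)\<close>; the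
  part of internal degree \<open>j\<close> comes from the homomorphisms that lower the degree by \<open>j\<close>.
\<close>

definition ext_cocycles ::
  "('a, 'v) graded_ring \<Rightarrow> (nat \<Rightarrow> ('a, nat \<Rightarrow> 'a) graded_module)
     \<Rightarrow> (nat \<Rightarrow> (nat \<Rightarrow> 'a) \<Rightarrow> (nat \<Rightarrow> 'a)) \<Rightarrow> nat \<Rightarrow> int \<Rightarrow> ((nat \<Rightarrow> 'a) \<Rightarrow> 'a set) set" where
  "ext_cocycles A P \<delta> i j = {\<phi> \<in> graded_hom A (P i) (residue_module A) j.
     \<forall>x\<in>carrier (P (Suc i)). \<phi> (\<delta> i x) = \<zero>\<^bsub>residue_module A\<^esub>}"

definition ext_coboundaries ::
  "('a, 'v) graded_ring \<Rightarrow> (nat \<Rightarrow> ('a, nat \<Rightarrow> 'a) graded_module)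
     \<Rightarrow> (nat \<Rightarrow> (nat \<Rightarrow> 'a) \<Rightarrow> (nat \<Rightarrow> 'a)) \<Rightarrow> nat \<Rightarrow> int \<Rightarrow> ((nat \<Rightarrow> 'a) \<Rightarrow> 'a set) set" where
  "ext_coboundaries A P \<delta> i j = {\<phi> \<in> graded_hom A (P i) (residue_module A) j.
     case i of
       0 \<Rightarrow> \<forall>x\<in>carrier (P 0). \<phi> x = \<zero>\<^bsub>residue_module A\<^esub>
     | Suc n \<Rightarrow> \<exists>\<psi>\<in>graded_hom A (P n) (residue_module A) j.
                  \<forall>x\<in>carrier (P (Suc n)). \<phi> x = \<psi> (\<delta> n x)}"

text \<open>
  \<open>Ext\<^sup>i\<^sub>A(R, R)\<close> is concentrated in internal degree \<open>i\<close> for all \<open>i\<close>. As \<open>Ext\<close> does not depend on the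
  resolution, it is computed here from some resolution; quantifying over all resolutions
  would hold vacuously if there were none.
\<close>

definition ext_diagonal :: "('a, 'v) graded_ring \<Rightarrow> bool" where
  "ext_diagonal A \<longleftrightarrow>
     (\<exists>P \<delta> \<epsilon>. projective_resolution A P \<delta> \<epsilon> \<and>
        (\<forall>i j. j \<noteq> int i \<longrightarrow> ext_cocycles A P \<delta> i j \<subseteq> ext_coboundaries A P \<delta> i j))"

text \<open>
  \<open>koszul_presentation G S\<close> means that \<open>kG/(S)\<close> is a Koszul algebra. The first conjunct says
  that the presentation is quadratic.
\<close>

definition koszul_presentation ::
  "('v, 'e) pre_digraph \<Rightarrow> (('v, 'e) path \<Rightarrow>\<^sub>0 'k::field) set \<Rightarrow> bool" where
  "koszul_presentation G S \<longleftrightarrow>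
     S \<subseteq> gr (path_algebra G) 2 \<and> ext_diagonal (path_algebra_mod G S)"


section \<open>Modified partial preprojective algebras\<close>

text \<open>
  As products traverse their right factor first, \<open>a a*\<close> is the arc list \<open>[Inr a, Inl a]\<close> at
  the head of \<open>a\<close>, and \<open>a* a\<close> is the arc list \<open>[Inl a, Inr a]\<close> at its tail.
\<close>

definition preproj_relation ::
  "('v, 'e) pre_digraph \<Rightarrow> 'v set \<Rightarrow> ('e + 'e \<Rightarrow> 'k::field) \<Rightarrow> (('v, 'e + 'e) path \<Rightarrow>\<^sub>0 'k)" where
  "preproj_relation Q J \<gamma> =
     (\<Sum>a\<in>{a \<in> arcs Q. head Q a \<in> verts Q - J}.
        Poly_Mapping.single (head Q a, [Inr a, Inl a], head Q a) (\<gamma> (Inl a))) -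
     (\<Sum>a\<in>{a \<in> arcs Q. tail Q a \<in> verts Q - J}.
        Poly_Mapping.single (tail Q a, [Inl a, Inr a], tail Q a) (\<gamma> (Inr a)))"

definition partial_preproj ::
  "('v, 'e) pre_digraph \<Rightarrow> 'v set \<Rightarrow> ('e + 'e \<Rightarrow> 'k::field)
     \<Rightarrow> ((('v, 'e + 'e) path \<Rightarrow>\<^sub>0 'k) set, 'v) graded_ring" where
  "partial_preproj Q J \<gamma> = path_algebra_mod (double Q) {preproj_relation Q J \<gamma>}"


section \<open>Matrices of power series\<close>

definition adjacency :: "('v, 'e) pre_digraph \<Rightarrow> 'v \<Rightarrow> 'v \<Rightarrow> int" where
  "adjacency G i j = int (card {b \<in> arcs G. head G b = i \<and> tail G b = j})"

definition id_matrix :: "'v \<Rightarrow> 'v \<Rightarrow> int" where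
  "id_matrix i j = (if i = j then 1 else 0)"

definition D_matrix :: "'v set \<Rightarrow> 'v \<Rightarrow> 'v \<Rightarrow> int" where
  "D_matrix J i j = (if i = j \<and> i \<notin> J then 1 else 0)"

text \<open>The matrix \<open>1 - C t + D t\<^sup>2\<close>.\<close>

definition quadratic_matrix ::
  "('v \<Rightarrow> 'v \<Rightarrow> int) \<Rightarrow> ('v \<Rightarrow> 'v \<Rightarrow> int) \<Rightarrow> 'v \<Rightarrow> 'v \<Rightarrow> int fps" where
  "quadratic_matrix C D i j =
     fps_const (id_matrix i j) - fps_const (C i j) * fps_X + fps_const (D i j) * fps_X ^ 2"

definition matrix_prod ::
  "'v set \<Rightarrow> ('v \<Rightarrow> 'v \<Rightarrow> int fps) \<Rightarrow> ('v \<Rightarrow> 'v \<Rightarrow> int fps) \<Rightarrow> 'v \<Rightarrow> 'v \<Rightarrow> int fps" where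
  "matrix_prod V M N i j = (\<Sum>l\<in>V. M i l * N l j)"

text \<open>\<open>N = M\<^sup>-\<^sup>1\<close> as \<open>V \<times> V\<close> matrices\<close>

definition is_inverse_matrix ::
  "'v set \<Rightarrow> ('v \<Rightarrow> 'v \<Rightarrow> int fps) \<Rightarrow> ('v \<Rightarrow> 'v \<Rightarrow> int fps) \<Rightarrow> bool" where
  "is_inverse_matrix V M N \<longleftrightarrow>
     (\<forall>i\<in>V. \<forall>j\<in>V. matrix_prod V M N i j = fps_const (id_matrix i j) \<and>
                   matrix_prod V N M i j = fps_const (id_matrix i j))"

end

theory Submission imports Defs
begin

text \<open>
  Right multiplication by arcs gives a complex of left modules over the algebra \<open>\<Pi>\<close>: from the sum of
  the \<open>\<Pi> e\<^sub>j\<close> with \<open>j \<notin> J\<close> to the sum of the \<open>\<Pi> e\<^sub>h\<close>, where \<open>h\<close> runs over the heads of the arcs of the double,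
  to the sum of all \<open>\<Pi> e\<^sub>j\<close>, to \<open>R\<close>. It is exact except perhaps at its left end, and both claims say
  that it is exact there as well: no nonzero \<open>x \<in> \<Pi> e\<^sub>j\<close> with \<open>j \<notin> J\<close> is killed from the right by all arcs.

  If \<open>J\<close> is nonempty, then even a single arc from a vertex nearer to \<open>J\<close> kills no such \<open>x\<close>, by induction on
  the distance to \<open>J\<close> and exactness in the middle. If \<open>J\<close> is empty, then exactness in the middle makes
  \<open>\<Pi>\<close> injective relative to finite-dimensional modules; so such an \<open>x\<close> of least degree bounds the
  degrees of \<open>\<Pi> e\<^sub>j\<close>, and \<open>\<Pi>\<close> is finite-dimensional. But for a non-Dynkin quiver there is a nonzero
  \<open>\<delta> \<ge> 0\<close> with \<open>C \<delta> \<ge> 2 \<delta>\<close>, and the dimensions of the graded parts, weighted by \<open>\<delta>\<close>, form a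
  convex increasing sequence.
\<close>

subsection \<open>Linear algebra on finitely supported functions\<close>

text \<open>All computations with \<open>\<Pi>\<close> take place in the path algebra, as
  congruences modulo \<open>rel_ideal\<close>: there the paths form a basis, and every path of
  positive length has exactly one first arc. Exactness in the middle comes from this alone. Removing
  the first arc from a relation inside a longer path leaves a relation, unless the relation opens
  the path; then a multiple of one component of the left differential remains.

  The left end is not decided by such a local argument. Dimensions are therefore counted in two
  strengths: \<open>h(n+2) \<ge> h(n+1) C - h(n)\<close> holds in every column outside
  \<open>J\<close>, with equality once nothing is killed. The inequality feeds the contradiction for
  empty \<open>J\<close>, the equality gives the Hilbert series.

  Injectivity is used in one concrete form: a map defined in degree \<open>s\<close> is extended to
  degree \<open>s - 1\<close> by solving \<open>g c = y c\<close> for all arcs \<open>c\<close> into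
  a vertex, and so on downwards.

  Koszulness follows from exactness because the generators of the \<open>i\<close>-th term of the
  complex have degree \<open>i\<close> and \<open>R\<close> has degree zero: off-diagonal
  homomorphisms vanish before cohomology is taken.\<close>

context vector_space
begin

lemma finite_basis_exists:
  assumes "subspace S" "S \<subseteq> span F" "finite F"
  obtains B where "B \<subseteq> S" "independent B" "finite B" "span B = S" "card B = dim S"
proof -
  obtain B where B: "B \<subseteq> S" "independent B" "S \<subseteq> span B"
    by (rule maximal_independent_subset)
  have "span B = S" using B span_minimal[OF B(1) assms(1)] by auto
  moreover have "finite B" using independent_span_bound[OF assms(3) B(2)] B(1) assms(2) by auto
  moreover have "card B = dim S" by (rule basis_card_eq_dim[OF B(1,3,2)])
  ultimately show ?thesis using that B by blast
qed

lemma complement_exists: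
  assumes S: "subspace S" "S \<subseteq> P" and P: "subspace P" "P \<subseteq> span F" "finite F"
  shows "\<exists>B. B \<subseteq> P \<and> independent B \<and> finite B \<and> span B \<inter> S = {0} \<and>
    (\<forall>x\<in>P. \<exists>s\<in>S. \<exists>b\<in>span B. x = s + b) \<and> card B + dim S = dim P"
proof -
  obtain A where A: "A \<subseteq> S" "independent A" "finite A" "span A = S" "card A = dim S"
    using finite_basis_exists[OF S(1) _ P(3)] S(2) P(2) by blast
  obtain C where C: "A \<subseteq> C" "C \<subseteq> P" "independent C" "P \<subseteq> span C"
    using maximal_independent_subset_extend[of A P] A(1,2) S(2) by blast
  have fin: "finite C" using independent_span_bound[OF P(3) C(3)] C(2) P(2) by auto
  have "card C = dim P" by (rule basis_card_eq_dim[OF C(2,4,3)])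
  then have card: "card (C - A) + dim S = dim P"
    using A(3,5) C(1) fin card_mono[OF fin C(1)] by (simp add: card_Diff_subset)
  have sum: "\<exists>s\<in>S. \<exists>b\<in>span (C - A). x = s + b" if "x \<in> P" for x
  proof -
    have "x \<in> span (A \<union> (C - A))" using that C(1,4) by (auto simp: Un_absorb1)
    then show ?thesis unfolding span_Un using A(4) by blast
  qed
  have "x = 0" if x: "x \<in> span (C - A)" "x \<in> S" for x
  proof -
    \<comment> \<open>A linear map that kills \<open>A\<close> and fixes \<open>C - A\<close> sends
      a vector in both spans to \<open>0\<close> and to itself.\<close>
    interpret vp: vector_space_pair scale scale by unfold_locales
    obtain f where f: "Vector_Spaces.linear scale scale f" "\<And>c. c \<in> C \<Longrightarrow> f c = (if c \<in> A then 0 else c)"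
      using vp.linear_independent_extend[OF C(3), of "\<lambda>c. if c \<in> A then 0 else c"] by blast
    have "f x = 0"
      by (rule vp.linear_eq_0_on_span[OF f(1), of A]) (use f(2) C(1) x(2) A(4) in auto)
    moreover have "f x = x"
      by (rule vp.linear_eq_on[OF f(1) linear_id x(1), simplified]) (use f(2) in auto)
    ultimately show ?thesis by simp
  qed
  then have "span (C - A) \<inter> S = {0}" using span_zero subspace_0[OF S(1)] by auto
  with C fin sum card independent_mono[OF C(3), of "C - A"] show ?thesis
    by (intro exI[of _ "C - A"]) auto
qed

lemma
  assumes S: "subspace S" and T: "subspace T" and F: "S \<subseteq> span F" "T \<subseteq> span F" "finite F"
  shows dim_sum_le: "dim {x + y | x y. x \<in> S \<and> y \<in> T} \<le> dim S + dim T"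
    and dim_direct_sum: "S \<inter> T \<subseteq> {0} \<Longrightarrow> dim {x + y | x y. x \<in> S \<and> y \<in> T} = dim S + dim T"
proof -
  obtain A where A: "A \<subseteq> S" "independent A" "finite A" "span A = S" "card A = dim S"
    using finite_basis_exists[OF S F(1,3)] .
  obtain B where B: "B \<subseteq> T" "independent B" "finite B" "span B = T" "card B = dim T"
    using finite_basis_exists[OF T F(2,3)] .
  have span: "span (A \<union> B) = {x + y | x y. x \<in> S \<and> y \<in> T}"
    by (simp add: span_Un A B)
  have "dim (span (A \<union> B)) \<le> card (A \<union> B)"
    using dim_le_card[of "span (A \<union> B)" "A \<union> B"] A(3) B(3) by simp
  then show "dim {x + y | x y. x \<in> S \<and> y \<in> T} \<le> dim S + dim T"
    using card_Un_le[of A B] A(5) B(5) unfolding span by linarith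
  assume disj: "S \<inter> T \<subseteq> {0}"
  have not0: "0 \<notin> A" "0 \<notin> B" using A(2) B(2) dependent_zero by auto
  have AB: "A \<inter> B = {}" using disj A(1) B(1) not0 by blast
  \<comment> \<open>Stated for arbitrary sets because it is applied twice, with the roles of
    \<open>A\<close> and \<open>B\<close> exchanged.\<close>
  have key: "a \<notin> span ((X - {a}) \<union> Y)"
    if "independent X" "a \<in> X" "span X \<inter> span Y \<subseteq> {0}" for a X Y
  proof
    assume "a \<in> span ((X - {a}) \<union> Y)"
    then obtain x y where xy: "a = x + y" "x \<in> span (X - {a})" "y \<in> span Y"
      unfolding span_Un by blast
    have "y = a - x" using xy(1) by simp
    moreover have "a - x \<in> span X"
      using xy(2) span_mono[of "X - {a}" X] by (intro span_diff[OF span_base[OF that(2)]]) auto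
    ultimately have "y = 0" using xy(3) that(3) by auto
    with xy that(1,2) show False by (auto simp: dependent_def)
  qed
  have "independent (A \<union> B)"
    unfolding dependent_def
  proof (intro notI, elim bexE)
    fix a assume a: "a \<in> A \<union> B" "a \<in> span (A \<union> B - {a})"
    show False
    proof (cases "a \<in> A")
      case True
      then have "A \<union> B - {a} = (A - {a}) \<union> B" using AB by auto
      with a key[OF A(2) True, of B] disj A(4) B(4) show False by auto
    next
      case False
      then have "a \<in> B" "A \<union> B - {a} = (B - {a}) \<union> A" using a by auto
      with a key[OF B(2), of a A] disj A(4) B(4) show False by auto
    qed
  qed
  then have "dim (span (A \<union> B)) = card (A \<union> B)"
    by (rule dim_span_eq_card_independent)
  with AB A(3,5) B(3,5) show "dim {x + y | x y. x \<in> S \<and> y \<in> T} = dim S + dim T"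
    unfolding span by (simp add: card_Un_disjoint)
qed

end

context vector_space_pair
begin

lemma dim_linear_image_inj:
  assumes "Vector_Spaces.linear s1 s2 f" "vs1.subspace S" "inj_on f S"
  shows "vs2.dim (f ` S) = vs1.dim S"
proof -
  obtain B where B: "B \<subseteq> S" "vs1.independent B" "S \<subseteq> vs1.span B"
    by (rule vs1.maximal_independent_subset)
  have span: "vs1.span B = S" using B vs1.span_minimal[OF B(1) assms(2)] by auto
  have "vs2.independent (f ` B)"
    by (rule linear_independent_injective_image[OF assms(1) B(2)]) (simp add: span assms(3))
  then have "card (f ` B) = vs2.dim (f ` S)"
    by (intro vs2.basis_card_eq_dim)
      (use B(1) span linear_span_image[OF assms(1), of B] in auto)
  moreover have "card (f ` B) = card B" using B(1) assms(3) by (meson card_image inj_on_subset)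
  ultimately show ?thesis using vs1.basis_card_eq_dim[OF B(1,3,2)] by simp
qed

lemma dim_linear_image_le:
  assumes "Vector_Spaces.linear s1 s2 f" "vs1.subspace S" "S \<subseteq> vs1.span F" "finite F"
  shows "vs2.dim (f ` S) \<le> vs1.dim S"
proof -
  obtain B where B: "B \<subseteq> S" "finite B" "vs1.span B = S" "card B = vs1.dim S"
    using vs1.finite_basis_exists[OF assms(2-4)] .
  have "vs2.dim (f ` S) \<le> card (f ` B)"
    by (rule vs2.dim_le_card) (use B linear_span_image[OF assms(1), of B] in auto)
  also have "\<dots> \<le> card B" using B(2) by (rule card_image_le)
  finally show ?thesis using B(4) by simp
qed

end

section \<open>Finitely supported functions: linear maps, coordinate subspaces and coordinate
  changes\<close>

abbreviation smul :: "'k::field \<Rightarrow> ('a \<Rightarrow>\<^sub>0 'k) \<Rightarrow> ('a \<Rightarrow>\<^sub>0 'k)" where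
  "smul c \<equiv> Poly_Mapping.map ((*) c)"

lemma lookup_smul [simp]: "Poly_Mapping.lookup (smul c f) x = c * Poly_Mapping.lookup f x"
  by (simp add: Poly_Mapping.map.rep_eq when_def)

interpretation pm: vector_space "smul :: 'k::field \<Rightarrow> ('a \<Rightarrow>\<^sub>0 'k) \<Rightarrow> _"
  by unfold_locales (auto intro!: poly_mapping_eqI simp: lookup_add algebra_simps)

interpretation pmp: vector_space_pair "smul :: 'k::field \<Rightarrow> ('a \<Rightarrow>\<^sub>0 'k) \<Rightarrow> _"
    "smul :: 'k::field \<Rightarrow> ('b \<Rightarrow>\<^sub>0 'k) \<Rightarrow> _"
  by unfold_locales

abbreviation pm_linear :: "(('a \<Rightarrow>\<^sub>0 'k::field) \<Rightarrow> ('b \<Rightarrow>\<^sub>0 'k)) \<Rightarrow> bool" where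
  "pm_linear \<equiv> Vector_Spaces.linear smul smul"

lemma pm_linearI:
  assumes "\<And>x y. f (x + y) = f x + f y" and "\<And>c x. f (smul c x) = smul c (f x)"
  shows "pm_linear f"
  using assms by (simp add: Vector_Spaces.linear_iff pm.vector_space_axioms)

lemma pm_linearD:
  assumes "pm_linear f"
  shows "f (x + y) = f x + f y" "f (smul c x) = smul c (f x)" "f 0 = 0" "f (- x) = - f x"
    "f (x - y) = f x - f y" "f (sum g A) = (\<Sum>a\<in>A. f (g a))"
  using assms
  by (auto simp: pmp.linear_add pmp.linear_scale pmp.linear_0 pmp.linear_neg pmp.linear_diff pmp.linear_sum)

lemma sum_single_keys:
  assumes "finite A" "Poly_Mapping.keys f \<subseteq> A"
  shows "f = (\<Sum>x\<in>A. Poly_Mapping.single x (Poly_Mapping.lookup f x))"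
  using assms
  by (auto intro!: poly_mapping_eqI simp: lookup_sum lookup_single when_def in_keys_iff)

lemma smul_single [simp]: "smul c (Poly_Mapping.single x a) = Poly_Mapping.single x (c * a)"
  by (auto intro!: poly_mapping_eqI simp: lookup_single when_def)

lemma pm_in_span:
  assumes "Poly_Mapping.keys f \<subseteq> A"
  shows "f \<in> pm.span ((\<lambda>x. Poly_Mapping.single x 1) ` A)"
proof -
  have "f = (\<Sum>x\<in>Poly_Mapping.keys f. smul (Poly_Mapping.lookup f x) (Poly_Mapping.single x 1))"
    by (subst sum_single_keys[of "Poly_Mapping.keys f" f]) auto
  also have "\<dots> \<in> pm.span ((\<lambda>x. Poly_Mapping.single x 1) ` A)"
    using assms by (intro pm.span_sum pm.span_scale pm.span_base) auto
  finally show ?thesis .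
qed

text \<open>Coordinate subspaces. The path algebra and its pieces by start, end and length all have
  this form, so linear maps on them can be checked on single paths.\<close>

definition supported :: "'a set \<Rightarrow> ('a \<Rightarrow>\<^sub>0 'k::field) set" where
  "supported T = {f. Poly_Mapping.keys f \<subseteq> T}"

lemma supported_iff: "f \<in> supported T \<longleftrightarrow> (\<forall>x. x \<notin> T \<longrightarrow> Poly_Mapping.lookup f x = 0)"
  by (auto simp: supported_def in_keys_iff)

lemma supported_subspace [simp]: "pm.subspace (supported T)"
  by (auto simp: pm.subspace_def supported_iff lookup_add)

lemma supported_mono: "S \<subseteq> T \<Longrightarrow> supported S \<subseteq> supported T"
  by (auto simp: supported_def)

lemma supported_closed [simp, intro]:
  shows "0 \<in> supported T"
    and "x \<in> supported T \<Longrightarrow> y \<in> supported T \<Longrightarrow> x + y \<in> supported T"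
    and "x \<in> supported T \<Longrightarrow> y \<in> supported T \<Longrightarrow> x - y \<in> supported T"
    and "x \<in> supported T \<Longrightarrow> - x \<in> supported T"
    and "x \<in> supported T \<Longrightarrow> smul c x \<in> supported T"
    and "(\<And>a. a \<in> A \<Longrightarrow> f a \<in> supported T) \<Longrightarrow> sum f A \<in> supported T"
    and "t \<in> T \<Longrightarrow> Poly_Mapping.single t k \<in> supported T"
  by (auto simp: supported_iff lookup_add lookup_minus lookup_sum lookup_single when_def)

lemma pm_linear_eq_on_supported:
  assumes "pm_linear f" "pm_linear g" "x \<in> supported T"
    "\<And>t. t \<in> T \<Longrightarrow> f (Poly_Mapping.single t 1) = g (Poly_Mapping.single t 1)"
  shows "f x = g x"
  using assms(1-2)
proof (rule pmp.linear_eq_on)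
  show "x \<in> pm.span ((\<lambda>x. Poly_Mapping.single x 1) ` T)"
    using assms(3) by (intro pm_in_span) (simp add: supported_def)
qed (use assms(4) in auto)

lemma pm_linear_in_subspace:
  assumes "pm_linear f" "pm.subspace S" "x \<in> supported T"
    "\<And>t. t \<in> T \<Longrightarrow> f (Poly_Mapping.single t 1) \<in> S"
  shows "f x \<in> S"
proof -
  have "x = (\<Sum>t\<in>Poly_Mapping.keys x. smul (Poly_Mapping.lookup x t) (Poly_Mapping.single t 1))"
    by (subst sum_single_keys[of "Poly_Mapping.keys x" x]) auto
  then have "f x = (\<Sum>t\<in>Poly_Mapping.keys x. smul (Poly_Mapping.lookup x t) (f (Poly_Mapping.single t 1)))"
    by (metis (no_types, lifting) pm_linearD(2,6)[OF assms(1)] sum.cong)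
  also have "\<dots> \<in> S"
    using assms by (intro pm.subspace_sum pm.subspace_scale) (auto simp: supported_def)
  finally show ?thesis .
qed

text \<open>Substitution against the direction of \<open>h\<close>. With \<open>h\<close> the
  identity it is a coordinate projection; with \<open>h\<close> prepending an arc it removes that
  arc. Injectivity of \<open>h\<close> on \<open>T\<close>, assumed in the lemmas, keeps the support
  finite.\<close>

definition pullback :: "('b \<Rightarrow> 'a) \<Rightarrow> 'b set \<Rightarrow> ('a \<Rightarrow>\<^sub>0 'k::field) \<Rightarrow> ('b \<Rightarrow>\<^sub>0 'k)" where
  "pullback h T f = Abs_poly_mapping (\<lambda>y. if y \<in> T then Poly_Mapping.lookup f (h y) else 0)"

lemma lookup_pullback:
  assumes "inj_on h T"
  shows "Poly_Mapping.lookup (pullback h T f) y = (if y \<in> T then Poly_Mapping.lookup f (h y) else 0)"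
proof -
  have "{y. (if y \<in> T then Poly_Mapping.lookup f (h y) else 0) \<noteq> 0} = h -` Poly_Mapping.keys f \<inter> T"
    by (auto simp: in_keys_iff)
  moreover have "finite (h -` Poly_Mapping.keys f \<inter> T)"
    using assms by (intro finite_vimage_IntI) auto
  ultimately show ?thesis
    unfolding pullback_def by (subst lookup_Abs_poly_mapping) auto
qed

lemma pullback_linear:
  assumes "inj_on h T"
  shows "pm_linear (pullback h T)"
  by (intro pm_linearI poly_mapping_eqI)
    (auto simp: lookup_pullback[OF assms] lookup_add)

definition restrict_pm :: "'a set \<Rightarrow> ('a \<Rightarrow>\<^sub>0 'k::field) \<Rightarrow> ('a \<Rightarrow>\<^sub>0 'k)" where
  "restrict_pm T = pullback (\<lambda>x. x) T"

lemma lookup_restrict_pm [simp]: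
  "Poly_Mapping.lookup (restrict_pm T f) y = (if y \<in> T then Poly_Mapping.lookup f y else 0)"
  by (simp add: restrict_pm_def lookup_pullback)

lemma restrict_pm_linear: "pm_linear (restrict_pm T)"
  by (simp add: restrict_pm_def pullback_linear)

lemma restrict_pm_id: "f \<in> supported T \<Longrightarrow> restrict_pm T f = f"
  by (auto intro!: poly_mapping_eqI simp: supported_iff)

lemma restrict_pm_eq_0: "f \<in> supported S \<Longrightarrow> S \<inter> T = {} \<Longrightarrow> restrict_pm T f = 0"
  by (intro poly_mapping_eqI) (auto simp: supported_iff disjoint_iff)

subsection \<open>The path algebra\<close>

text \<open>The product sums over the supports of its factors, which change under addition. Summing
  over a fixed larger set makes bilinearity visible.\<close>

lemma path_alg_mult_superset:
  assumes "finite A" "finite B" "Poly_Mapping.keys f \<subseteq> A" "Poly_Mapping.keys g \<subseteq> B"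
  shows "path_alg_mult f g = (\<Sum>x\<in>A. \<Sum>y\<in>B.
    smul (Poly_Mapping.lookup f x * Poly_Mapping.lookup g y) (path_prod x y))"
proof -
  have "path_alg_mult f g = (\<Sum>x\<in>Poly_Mapping.keys f. \<Sum>y\<in>B.
      smul (Poly_Mapping.lookup f x * Poly_Mapping.lookup g y) (path_prod x y))"
    unfolding path_alg_mult_def
    by (intro sum.cong sum.mono_neutral_left) (use assms in \<open>auto simp: in_keys_iff\<close>)
  also have "\<dots> = (\<Sum>x\<in>A. \<Sum>y\<in>B.
      smul (Poly_Mapping.lookup f x * Poly_Mapping.lookup g y) (path_prod x y))"
    by (intro sum.mono_neutral_left) (use assms in \<open>auto simp: in_keys_iff\<close>)
  finally show ?thesis .
qed

lemma path_alg_mult_linear_left: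
  fixes g :: "('v, 'e) path \<Rightarrow>\<^sub>0 'k::field"
  shows "pm_linear (\<lambda>f. path_alg_mult f g)"
proof (rule pm_linearI)
  fix f f' :: "('v, 'e) path \<Rightarrow>\<^sub>0 'k" and c
  let ?A = "Poly_Mapping.keys f \<union> Poly_Mapping.keys f'"
  have *: "path_alg_mult h g = (\<Sum>x\<in>?A. \<Sum>y\<in>Poly_Mapping.keys g.
    smul (Poly_Mapping.lookup h x * Poly_Mapping.lookup g y) (path_prod x y))"
    if "Poly_Mapping.keys h \<subseteq> ?A" for h
    using that by (intro path_alg_mult_superset) auto
  show "path_alg_mult (f + f') g = path_alg_mult f g + path_alg_mult f' g"
    by (subst (1 2 3) *) (auto simp: Poly_Mapping.keys_add lookup_add pm.scale_left_distrib
      distrib_right sum.distrib dest: subsetD[OF Poly_Mapping.keys_add])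
  show "path_alg_mult (smul c f) g = smul c (path_alg_mult f g)"
    by (subst (1 2) *) (auto simp: pm.scale_sum_right mult.assoc in_keys_iff)
qed

lemma path_alg_mult_linear_right:
  fixes f :: "('v, 'e) path \<Rightarrow>\<^sub>0 'k::field"
  shows "pm_linear (path_alg_mult f)"
proof (rule pm_linearI)
  fix g g' :: "('v, 'e) path \<Rightarrow>\<^sub>0 'k" and c
  let ?A = "Poly_Mapping.keys g \<union> Poly_Mapping.keys g'"
  have *: "path_alg_mult f h = (\<Sum>x\<in>Poly_Mapping.keys f. \<Sum>y\<in>?A.
    smul (Poly_Mapping.lookup f x * Poly_Mapping.lookup h y) (path_prod x y))"
    if "Poly_Mapping.keys h \<subseteq> ?A" for h
    using that by (intro path_alg_mult_superset) auto
  show "path_alg_mult f (g + g') = path_alg_mult f g + path_alg_mult f g'"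
    by (subst (1 2 3) *) (auto simp: lookup_add pm.scale_left_distrib
      distrib_left sum.distrib dest: subsetD[OF Poly_Mapping.keys_add])
  show "path_alg_mult f (smul c g) = smul c (path_alg_mult f g)"
    by (subst (1 2) *) (auto simp: pm.scale_sum_right ac_simps in_keys_iff)
qed

lemmas path_alg_mult_left = pm_linearD[OF path_alg_mult_linear_left]
lemmas path_alg_mult_right = pm_linearD[OF path_alg_mult_linear_right]

lemma path_alg_mult_single:
  "path_alg_mult (Poly_Mapping.single x a) (Poly_Mapping.single y b) = smul (a * b) (path_prod x y)"
  by (subst path_alg_mult_superset[of "{x}" "{y}"]) (auto split: if_splits)

lemma path_alg_mult_single_paths:
  "path_alg_mult (Poly_Mapping.single (u, p, v) a) (Poly_Mapping.single (u', p', v') b) =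
    (if v' = u then Poly_Mapping.single (u', p' @ p, v) (a * b) else 0)"
  by (simp add: path_alg_mult_single path_prod_def)

lemma pm_linear_ext:
  assumes "pm_linear f" "pm_linear g" "\<And>t. f (Poly_Mapping.single t 1) = g (Poly_Mapping.single t 1)"
  shows "f x = g x"
  by (rule pm_linear_eq_on_supported[OF assms(1,2), of x UNIV]) (use assms in \<open>auto simp: supported_def\<close>)

lemma pm_linear_compose: "pm_linear f \<Longrightarrow> pm_linear g \<Longrightarrow> pm_linear (\<lambda>x. f (g x))"
  by (rule pm_linearI) (auto simp: pm_linearD)

text \<open>Both sides are linear in each factor, so the factors are reduced to single paths one at
  a time, the last one first.\<close>

lemma path_alg_mult_assoc: "path_alg_mult (path_alg_mult f g) h = path_alg_mult f (path_alg_mult g h)"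
proof -
  note lin = path_alg_mult_linear_left path_alg_mult_linear_right
    pm_linear_compose[OF path_alg_mult_linear_left] pm_linear_compose[OF path_alg_mult_linear_right]
  have 1: "path_alg_mult (path_alg_mult (Poly_Mapping.single x 1) (Poly_Mapping.single y 1)) (Poly_Mapping.single z 1)
     = path_alg_mult (Poly_Mapping.single x (1::'c)) (path_alg_mult (Poly_Mapping.single y 1) (Poly_Mapping.single z 1))"
     (is "?l x y z = ?r x y z") for x y z :: "('a, 'b) path"
    by (cases x; cases y; cases z)
      (auto simp: path_alg_mult_single_paths path_alg_mult_left(3) path_alg_mult_right(3))
  have 2: "path_alg_mult (path_alg_mult (Poly_Mapping.single x 1) (Poly_Mapping.single y 1)) h
     = path_alg_mult (Poly_Mapping.single x (1::'c)) (path_alg_mult (Poly_Mapping.single y 1) h)"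
    for x y :: "('a, 'b) path"
    by (rule pm_linear_ext[where x = h and f = "path_alg_mult (path_alg_mult (Poly_Mapping.single x 1) (Poly_Mapping.single y 1))"
        and g = "\<lambda>h. path_alg_mult (Poly_Mapping.single x 1) (path_alg_mult (Poly_Mapping.single y 1) h)", OF lin(2) lin(4)[OF lin(2)] 1])
  have 3: "path_alg_mult (path_alg_mult (Poly_Mapping.single x 1) g) h
     = path_alg_mult (Poly_Mapping.single x (1::'c)) (path_alg_mult g h)"
    for x :: "('a, 'b) path"
    by (rule pm_linear_ext[where x = g and f = "\<lambda>g. path_alg_mult (path_alg_mult (Poly_Mapping.single x 1) g) h"
        and g = "\<lambda>g. path_alg_mult (Poly_Mapping.single x 1) (path_alg_mult g h)",
        OF lin(3)[OF lin(2)] lin(4)[OF lin(1)] 2])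
  show ?thesis
    by (rule pm_linear_ext[where x = f and f = "\<lambda>f. path_alg_mult (path_alg_mult f g) h"
        and g = "\<lambda>f. path_alg_mult f (path_alg_mult g h)", OF lin(3)[OF lin(1)] lin(1) 3])
qed

lemma path_algebra_simps [simp]:
  "carrier (path_algebra G) = supported (paths G)"
  "monoid.mult (path_algebra G) = path_alg_mult"
  "one (path_algebra G) = path_scalar G 1"
  "zero (path_algebra G) = 0"
  "add (path_algebra G) = (+)"
  "vertices (path_algebra G) = verts G"
  "vscalars (path_algebra G) = range (path_scalar G)"
  "videm (path_algebra G) v = Poly_Mapping.single (v, [], v) 1"
  "gr (path_algebra G) d = supported {(u, p, v) \<in> paths G. length p = d}"
  by (simp_all add: path_algebra_def supported_def)

text \<open>Products traverse the right factor first, so a left idempotent selects the end of a path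
  and a right idempotent its start.\<close>

lemma idem_mult: "path_alg_mult (Poly_Mapping.single (v, [], v) 1) x = restrict_pm {(u, p, w). w = v} x"
  by (rule pm_linear_ext[where x = x, OF path_alg_mult_linear_right restrict_pm_linear])
    (auto simp: path_alg_mult_single_paths lookup_single when_def intro!: poly_mapping_eqI)

lemma mult_idem: "path_alg_mult x (Poly_Mapping.single (v, [], v) 1) = restrict_pm {(u, p, w). u = v} x"
  by (rule pm_linear_ext[where x = x, OF path_alg_mult_linear_left restrict_pm_linear])
    (auto simp: path_alg_mult_single_paths lookup_single when_def intro!: poly_mapping_eqI)

context fin_digraph
begin

lemma paths_iff [simp]: "(u, p, v) \<in> paths G \<longleftrightarrow> awalk u p v"
  by (simp add: paths_def)

lemma path_scalar_mult:
  assumes "x \<in> supported (paths G)"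
  shows "path_alg_mult (path_scalar G c) x = smul c x"
proof (rule poly_mapping_eqI)
  fix k :: "('a, 'b) path"
  obtain u p w where k: "k = (u, p, w)" by (cases k)
  have *: "Poly_Mapping.single (v, [], v) c = smul c (Poly_Mapping.single (v, [], v) 1)" for v :: 'a
    by simp
  have "Poly_Mapping.lookup (path_alg_mult (path_scalar G c) x) k =
      (\<Sum>v\<in>verts G. if w = v then c * Poly_Mapping.lookup x k else 0)"
    unfolding path_scalar_def *
    by (simp only: path_alg_mult_left lookup_sum lookup_smul idem_mult lookup_restrict_pm k)
      (intro sum.cong, auto)
  also have "\<dots> = Poly_Mapping.lookup (smul c x) k"
  proof (cases "w \<in> verts G")
    case False
    then have "k \<notin> paths G" using k awalk_last_in_verts by auto
    with assms have "Poly_Mapping.lookup x k = 0" unfolding supported_iff by blast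
    then show ?thesis by simp
  qed simp
  finally show "Poly_Mapping.lookup (path_alg_mult (path_scalar G c) x) k = Poly_Mapping.lookup (smul c x) k" .
qed

lemma mult_path_scalar:
  assumes "x \<in> supported (paths G)"
  shows "path_alg_mult x (path_scalar G c) = smul c x"
proof (rule poly_mapping_eqI)
  fix k :: "('a, 'b) path"
  obtain u p w where k: "k = (u, p, w)" by (cases k)
  have *: "Poly_Mapping.single (v, [], v) c = smul c (Poly_Mapping.single (v, [], v) 1)" for v :: 'a
    by simp
  have "Poly_Mapping.lookup (path_alg_mult x (path_scalar G c)) k =
      (\<Sum>v\<in>verts G. if u = v then c * Poly_Mapping.lookup x k else 0)"
    unfolding path_scalar_def *
    by (simp only: path_alg_mult_right lookup_sum lookup_smul mult_idem lookup_restrict_pm k)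
      (intro sum.cong, auto)
  also have "\<dots> = Poly_Mapping.lookup (smul c x) k"
  proof (cases "u \<in> verts G")
    case False
    then have "k \<notin> paths G" using k by auto
    with assms have "Poly_Mapping.lookup x k = 0" unfolding supported_iff by blast
    then show ?thesis by simp
  qed simp
  finally show "Poly_Mapping.lookup (path_alg_mult x (path_scalar G c)) k = Poly_Mapping.lookup (smul c x) k" .
qed

lemma path_alg_mult_supported:
  assumes "x \<in> supported (paths G)" "y \<in> supported (paths G)"
  shows "path_alg_mult x y \<in> supported (paths G)"
proof -
  have 1: "path_alg_mult (Poly_Mapping.single s 1) y \<in> supported (paths G)" if "s \<in> paths G" for s
    using assms(2)
  proof (rule pm_linear_in_subspace[OF path_alg_mult_linear_right supported_subspace])
    fix t assume "t \<in> paths G"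
    with that show "path_alg_mult (Poly_Mapping.single s 1) (Poly_Mapping.single t 1) \<in> supported (paths G)"
      by (cases s; cases t) (auto simp: path_alg_mult_single_paths)
  qed
  show ?thesis
    by (rule pm_linear_in_subspace[OF path_alg_mult_linear_left supported_subspace assms(1) 1])
qed

lemma path_scalar_supported: "path_scalar G c \<in> supported (paths G)"
  by (auto simp: path_scalar_def awalk_def)

lemma ring_path_algebra: "ring (path_algebra G :: (('a, 'b) path \<Rightarrow>\<^sub>0 'k::field, 'a) graded_ring)"
proof (rule ringI)
  show "abelian_group (path_algebra G :: (('a, 'b) path \<Rightarrow>\<^sub>0 'k::field, 'a) graded_ring)"
  proof (rule abelian_groupI)
    fix x assume "x \<in> carrier (path_algebra G :: (('a, 'b) path \<Rightarrow>\<^sub>0 'k::field, 'a) graded_ring)"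
    then show "\<exists>y\<in>carrier (path_algebra G). y \<oplus>\<^bsub>path_algebra G\<^esub> x = \<zero>\<^bsub>path_algebra G\<^esub>"
      by (intro bexI[of _ "- x"]) auto
  qed (auto simp: ac_simps)
  show "Group.monoid (path_algebra G :: (('a, 'b) path \<Rightarrow>\<^sub>0 'k::field, 'a) graded_ring)"
    by (rule Group.monoidI)
      (auto simp: path_alg_mult_supported path_scalar_supported path_alg_mult_assoc
        path_scalar_mult mult_path_scalar pm.scale_one)
qed (simp_all add: path_alg_mult_left path_alg_mult_right)

end

subsection \<open>The ideal of relations\<close>

lemma path_pm_eqI:
  assumes "\<And>u p v. Poly_Mapping.lookup f (u, p, v) = Poly_Mapping.lookup g (u, p, v)"
  shows "f = g"
  using assms by (intro poly_mapping_eqI) auto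

text \<open>The double quiver without reference to its origin: \<open>star\<close> reverses arcs,
  and \<open>\<eta>\<close> merges \<open>\<gamma>\<close> with the two signs of the relation. The
  relation at a vertex \<open>j\<close> outside \<open>J\<close> then says that the sum of
  \<open>\<eta> c\<close> times \<open>c c*\<close> over the arcs \<open>c\<close> into
  \<open>j\<close> is zero.\<close>

locale preprojective_datum = fin_digraph G
  for G :: "('v, 'b) pre_digraph" +
  fixes star :: "'b \<Rightarrow> 'b" and \<eta> :: "'b \<Rightarrow> 'k::field" and J :: "'v set"
  assumes star_arc [simp]: "c \<in> arcs G \<Longrightarrow> star c \<in> arcs G"
    and star_star [simp]: "c \<in> arcs G \<Longrightarrow> star (star c) = c"
    and head_star [simp]: "c \<in> arcs G \<Longrightarrow> head G (star c) = tail G c"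
    and tail_star [simp]: "c \<in> arcs G \<Longrightarrow> tail G (star c) = head G c"
    and eta_nonzero: "c \<in> arcs G \<Longrightarrow> head G c \<notin> J \<Longrightarrow> \<eta> c \<noteq> 0"
begin

notation path_alg_mult (infixl "\<cdot>" 70)

abbreviation kG :: "(('v, 'b) path \<Rightarrow>\<^sub>0 'k) set" where
  "kG \<equiv> supported (paths G)"

text \<open>The projective left module \<open>kG e_j\<close>.\<close>

definition starting :: "'v \<Rightarrow> (('v, 'b) path \<Rightarrow>\<^sub>0 'k) set" where
  "starting j = supported {(u, p, v) \<in> paths G. u = j}"

definition arc_elem :: "'b \<Rightarrow> ('v, 'b) path \<Rightarrow>\<^sub>0 'k" where
  "arc_elem c = Poly_Mapping.single (tail G c, [c], head G c) 1"

text \<open>The relation at \<open>j\<close> inside a path: \<open>p\<close> is traversed before it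
  and \<open>q\<close> after it, so this is the product of \<open>q\<close>, the relation and
  \<open>p\<close> in this order.\<close>

definition rel_at :: "'v \<Rightarrow> 'b list \<Rightarrow> 'v \<Rightarrow> 'b list \<Rightarrow> 'v \<Rightarrow> ('v, 'b) path \<Rightarrow>\<^sub>0 'k" where
  "rel_at u p j q v = (\<Sum>c\<in>{c \<in> arcs G. head G c = j}. Poly_Mapping.single (u, p @ [star c, c] @ q, v) (\<eta> c))"

text \<open>A linear span rather than a generated ideal, so that induction ends at a single relation
  inside a path. \<open>genideal_relation_sum\<close> identifies it with the ideal generated by the
  relation.\<close>

definition rel_ideal :: "(('v, 'b) path \<Rightarrow>\<^sub>0 'k) set" where
  "rel_ideal = pm.span {rel_at u p j q v | u p j q v. awalk u p j \<and> awalk j q v \<and> j \<in> verts G - J}"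

lemma rel_at_in_ideal:
  "awalk u p j \<Longrightarrow> awalk j q v \<Longrightarrow> j \<notin> J \<Longrightarrow> rel_at u p j q v \<in> rel_ideal"
  unfolding rel_ideal_def by (rule pm.span_base) (unfold mem_Collect_eq, rule exI[of _ u], rule exI[of _ p], auto)

lemma rel_ideal_subspace [simp]: "pm.subspace rel_ideal"
  by (simp add: rel_ideal_def)

lemmas rel_ideal_closed [intro] =
  pm.subspace_0[OF rel_ideal_subspace] pm.subspace_add[OF rel_ideal_subspace]
  pm.subspace_diff[OF rel_ideal_subspace] pm.subspace_neg[OF rel_ideal_subspace]
  pm.subspace_scale[OF rel_ideal_subspace] pm.subspace_sum[OF rel_ideal_subspace]

lemma rel_ideal_diffD: "x - y \<in> rel_ideal \<Longrightarrow> x \<in> rel_ideal \<longleftrightarrow> y \<in> rel_ideal"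
  by (metis add_diff_cancel_left' diff_add_cancel rel_ideal_closed(2,3))

lemma rel_ideal_induct [consumes 1, case_names subspace rel]:
  assumes "x \<in> rel_ideal" "pm.subspace {x. P x}"
    "\<And>u p j q v. awalk u p j \<Longrightarrow> awalk j q v \<Longrightarrow> j \<in> verts G \<Longrightarrow> j \<notin> J \<Longrightarrow> P (rel_at u p j q v)"
  shows "P x"
  by (rule pm.span_induct_alt[of x "{rel_at u p j q v | u p j q v. awalk u p j \<and> awalk j q v \<and> j \<in> verts G - J}"])
    (use assms in \<open>auto simp: rel_ideal_def pm.subspace_def\<close>)

lemma linear_maps_rel_ideal:
  assumes "x \<in> rel_ideal" "pm_linear f"
    "\<And>u p j q v. awalk u p j \<Longrightarrow> awalk j q v \<Longrightarrow> j \<in> verts G \<Longrightarrow> j \<notin> J \<Longrightarrow> f (rel_at u p j q v) \<in> rel_ideal"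
  shows "f x \<in> rel_ideal"
  using assms(1)
proof (induction rule: rel_ideal_induct)
  case subspace
  show ?case by (auto simp: pm.subspace_def pm_linearD[OF assms(2)])
qed (rule assms(3))

lemma rel_ideal_supported: "rel_ideal \<subseteq> kG"
  unfolding rel_ideal_def
  by (intro pm.span_minimal supported_subspace) (auto simp: rel_at_def awalk_Cons_iff)

lemma mult_rel_at:
  "Poly_Mapping.single (u', p', v') 1 \<cdot> rel_at u p j q v = (if v = u' then rel_at u p j (q @ p') v' else 0)"
  by (auto simp: rel_at_def path_alg_mult_right path_alg_mult_single_paths)

lemma rel_at_mult:
  "rel_at u p j q v \<cdot> Poly_Mapping.single (u', p', v') 1 = (if v' = u then rel_at u' (p' @ p) j q v else 0)"
  by (auto simp: rel_at_def path_alg_mult_left path_alg_mult_single_paths)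

lemma rel_ideal_left:
  assumes "x \<in> kG" "y \<in> rel_ideal"
  shows "x \<cdot> y \<in> rel_ideal"
proof -
  have "Poly_Mapping.single t 1 \<cdot> y \<in> rel_ideal" if "t \<in> paths G" for t
    by (rule linear_maps_rel_ideal[OF assms(2) path_alg_mult_linear_right])
      (use that in \<open>cases t, auto simp: mult_rel_at intro!: rel_at_in_ideal\<close>)
  then show ?thesis
    by (intro pm_linear_in_subspace[OF path_alg_mult_linear_left _ assms(1)]) auto
qed

lemma rel_ideal_right:
  assumes "x \<in> kG" "y \<in> rel_ideal"
  shows "y \<cdot> x \<in> rel_ideal"
proof -
  have "y \<cdot> Poly_Mapping.single t 1 \<in> rel_ideal" if "t \<in> paths G" for t
    by (rule linear_maps_rel_ideal[OF assms(2) path_alg_mult_linear_left])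
      (use that in \<open>cases t, auto simp: rel_at_mult intro!: rel_at_in_ideal\<close>)
  then show ?thesis
    by (intro pm_linear_in_subspace[OF path_alg_mult_linear_right _ assms(1)]) auto
qed

text \<open>The ideal is homogeneous: all terms of a relation inside a path share start, end and
  length.\<close>

lemma restrict_rel_ideal:
  assumes "x \<in> rel_ideal"
  shows "restrict_pm {(u, p, v). \<Phi> u (length p) v} x \<in> rel_ideal"
proof (rule linear_maps_rel_ideal[OF assms restrict_pm_linear])
  fix u p j q v assume *: "awalk u p j" "awalk j q v" "j \<in> verts G" "j \<notin> J"
  have "restrict_pm {(u, p, v). \<Phi> u (length p) v} (rel_at u p j q v) =
      (if \<Phi> u (length p + 2 + length q) v then rel_at u p j q v else 0)"
    by (intro poly_mapping_eqI) (auto simp: rel_at_def lookup_sum lookup_single when_def intro!: sum.neutral)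
  with * show "restrict_pm {(u, p, v). \<Phi> u (length p) v} (rel_at u p j q v) \<in> rel_ideal"
    by (auto intro: rel_at_in_ideal)
qed

lemma restrict_starting_rel_ideal:
  assumes "x \<in> rel_ideal"
  shows "restrict_pm {(u, p, v). u = j} x \<in> rel_ideal"
  using restrict_rel_ideal[OF assms, of "\<lambda>u n v. u = j"] by simp

lemma starting_subspace [simp]: "pm.subspace (starting j)"
  by (simp add: starting_def)

lemma starting_kG: "x \<in> starting j \<Longrightarrow> x \<in> kG"
  unfolding starting_def by (rule subsetD[OF supported_mono]) auto

lemma starting_restrict: "x \<in> starting j \<Longrightarrow> restrict_pm {(u, p, v). u = j} x = x"
  unfolding starting_def by (rule restrict_pm_id) (auto simp: supported_iff)

lemma arc_elem_kG [simp]: "c \<in> arcs G \<Longrightarrow> arc_elem c \<in> kG"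
  by (auto simp: arc_elem_def arc_implies_awalk intro!: supported_closed)

lemma mult_arc_single:
  "Poly_Mapping.single (u, p, v) a \<cdot> arc_elem c = (if head G c = u then Poly_Mapping.single (tail G c, c # p, v) a else 0)"
  by (simp add: arc_elem_def path_alg_mult_single_paths)

text \<open>\<open>strip c x\<close> is the coefficient \<open>y c\<close> in the expansion \<open>x = \<Sum>\<^sub>c y c \<cdot> c\<close> of a combination
  of paths of positive length.\<close>

definition strip :: "'b \<Rightarrow> (('v, 'b) path \<Rightarrow>\<^sub>0 'k) \<Rightarrow> (('v, 'b) path \<Rightarrow>\<^sub>0 'k)" where
  "strip c = pullback (\<lambda>(u, p, v). (tail G c, c # p, v)) {(u, p, v). u = head G c}"

lemma strip_inj: "inj_on (\<lambda>(u, p, v). (tail G c, c # p, v)) {(u, p, v). u = head G c}"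
  by (auto simp: inj_on_def)

lemma strip_linear: "pm_linear (strip c)"
  unfolding strip_def by (rule pullback_linear[OF strip_inj])

lemmas strip_simps = pm_linearD[OF strip_linear]

lemma lookup_strip: "Poly_Mapping.lookup (strip c x) (u, p, v) =
    (if u = head G c then Poly_Mapping.lookup x (tail G c, c # p, v) else 0)"
  by (simp add: strip_def lookup_pullback[OF strip_inj])

lemma strip_single_Nil [simp]: "strip c (Poly_Mapping.single (u, [], v) a) = 0"
  by (rule path_pm_eqI) (auto simp: lookup_strip lookup_single)

lemma strip_single_Cons: "strip c (Poly_Mapping.single (u, c' # p, v) a) =
    (if c = c' \<and> u = tail G c then Poly_Mapping.single (head G c, p, v) a else 0)"
  by (rule path_pm_eqI) (auto simp: lookup_strip lookup_single when_def)

text \<open>Together with \<open>strip_expansion\<close> this makes the expansion along first arcs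
  unique: stripping \<open>c\<close> undoes multiplication by \<open>c\<close> on paths from its
  head and kills multiples of the other arcs.\<close>

lemma strip_mult_arc:
  "strip c (x \<cdot> arc_elem c') = (if c = c' then restrict_pm {(u, p, v). u = head G c} x else 0)"
proof -
  have "pm_linear (\<lambda>x. if c = c' then restrict_pm {(u, p, v). u = head G c} x else 0)"
    by (auto intro!: pm_linearI simp: pm_linearD[OF restrict_pm_linear])
  then show ?thesis
    by (rule pm_linear_ext[where x = x, OF pm_linear_compose[OF strip_linear path_alg_mult_linear_left]])
      (auto simp: mult_arc_single strip_single_Cons strip_simps lookup_single when_def intro!: poly_mapping_eqI)
qed

lemma strip_starting:
  assumes "x \<in> kG" "c \<in> arcs G"
  shows "strip c x \<in> starting (head G c)"
  using assms by (auto simp: starting_def supported_iff lookup_strip awalk_Cons_iff)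

lemma strip_expansion:
  assumes "x \<in> supported {(u, p, v) \<in> paths G. p \<noteq> []}"
  shows "x = (\<Sum>c\<in>arcs G. strip c x \<cdot> arc_elem c)"
proof -
  have lin: "pm_linear (\<lambda>x. \<Sum>c\<in>arcs G. strip c x \<cdot> arc_elem c)"
    by (intro pm_linearI) (auto simp: strip_simps path_alg_mult_left sum.distrib pm.scale_sum_right)
  have id: "pm_linear (\<lambda>x. x)" by (intro pm_linearI) auto
  have "(\<Sum>c\<in>arcs G. strip c x \<cdot> arc_elem c) = x"
  proof (rule pm_linear_eq_on_supported[OF lin id assms])
    fix t assume "t \<in> {(u, p, v) \<in> paths G. p \<noteq> []}"
    then obtain u c' p v where t: "t = (u, c' # p, v)" "awalk u (c' # p) v"
      by (cases t; cases "fst (snd t)") auto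
    then have "(\<Sum>c\<in>arcs G. strip c (Poly_Mapping.single t (1::'k)) \<cdot> arc_elem c) =
        (\<Sum>c\<in>arcs G. if c = c' then Poly_Mapping.single t 1 else 0)"
      by (intro sum.cong) (auto simp: strip_single_Cons mult_arc_single awalk_Cons_iff path_alg_mult_left(3))
    then show "(\<Sum>c\<in>arcs G. strip c (Poly_Mapping.single t (1::'k)) \<cdot> arc_elem c) = Poly_Mapping.single t 1"
      using t by (auto simp: awalk_Cons_iff)
  qed
  then show ?thesis by simp
qed

text \<open>A relation that opens the path begins with some \<open>star c'\<close>. Stripping
  \<open>c\<close> leaves only the term with \<open>c' = star c\<close>; this is where the left
  differential of the complex enters.\<close>

lemma strip_rel_at_Nil:
  assumes "c \<in> arcs G"
  shows "strip c (rel_at j [] j q v) =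
    (if tail G c = j then smul (\<eta> (star c)) (Poly_Mapping.single (j, q, v) 1 \<cdot> arc_elem (star c)) else 0)"
proof -
  have *: "c = star c' \<longleftrightarrow> c' = star c" if "c' \<in> arcs G" for c'
    using assms that star_star by metis
  have "strip c (rel_at j [] j q v) = (\<Sum>c'\<in>{c \<in> arcs G. head G c = j}.
      strip c (Poly_Mapping.single (j, star c' # c' # q, v) (\<eta> c')))"
    by (simp add: rel_at_def strip_simps)
  also have "\<dots> = (\<Sum>c'\<in>{c \<in> arcs G. head G c = j}.
      if c' = star c then Poly_Mapping.single (head G c, star c # q, v) (\<eta> (star c)) else 0)"
    using assms by (intro sum.cong) (auto simp: * strip_single_Cons)
  also have "\<dots> = (if tail G c = j then Poly_Mapping.single (head G c, star c # q, v) (\<eta> (star c)) else 0)"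
    using assms by (subst sum.delta) auto
  finally show ?thesis
    using assms by (auto simp: mult_arc_single)
qed

lemma strip_rel_at_Cons:
  assumes "awalk u (c' # p) j"
  shows "strip c (rel_at u (c' # p) j q v) = (if c = c' then rel_at (head G c) p j q v else 0)"
  using assms unfolding rel_at_def by (auto simp: strip_simps strip_single_Cons awalk_Cons_iff)

text \<open>This is exactness in the middle of the Koszul complex.\<close>

lemma strip_rel_ideal:
  assumes "x \<in> rel_ideal"
  shows "\<exists>g. (\<forall>j. g j \<in> starting j \<and> (j \<in> J \<longrightarrow> g j = 0)) \<and>
    (\<forall>c\<in>arcs G. strip c x - smul (\<eta> (star c)) (g (tail G c) \<cdot> arc_elem (star c)) \<in> rel_ideal)"
  using assms
proof (induction rule: rel_ideal_induct)
  case subspace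
  show ?case
    unfolding pm.subspace_def mem_Collect_eq
  proof (intro conjI allI ballI impI, goal_cases)
    case 1
    show ?case
      by (intro exI[of _ "\<lambda>_. 0"]) (auto simp: strip_simps path_alg_mult_left starting_def)
  next
    case (2 x y)
    then obtain g h where
      g: "\<forall>j. g j \<in> starting j \<and> (j \<in> J \<longrightarrow> g j = 0)"
        "\<forall>c\<in>arcs G. strip c x - smul (\<eta> (star c)) (g (tail G c) \<cdot> arc_elem (star c)) \<in> rel_ideal" and
      h: "\<forall>j. h j \<in> starting j \<and> (j \<in> J \<longrightarrow> h j = 0)"
        "\<forall>c\<in>arcs G. strip c y - smul (\<eta> (star c)) (h (tail G c) \<cdot> arc_elem (star c)) \<in> rel_ideal"
      by auto
    have "strip c (x + y) - smul (\<eta> (star c)) ((g (tail G c) + h (tail G c)) \<cdot> arc_elem (star c)) \<in> rel_ideal"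
      if "c \<in> arcs G" for c
      using rel_ideal_closed(2)[OF g(2)[rule_format, OF that] h(2)[rule_format, OF that]]
      by (simp add: strip_simps path_alg_mult_left pm.scale_right_distrib algebra_simps)
    with g(1) h(1) show ?case
      by (intro exI[of _ "\<lambda>j. g j + h j"]) (auto simp: starting_def)
  next
    case (3 a x)
    then obtain g where
      g: "\<forall>j. g j \<in> starting j \<and> (j \<in> J \<longrightarrow> g j = 0)"
        "\<forall>c\<in>arcs G. strip c x - smul (\<eta> (star c)) (g (tail G c) \<cdot> arc_elem (star c)) \<in> rel_ideal"
      by auto
    have "strip c (smul a x) - smul (\<eta> (star c)) (smul a (g (tail G c)) \<cdot> arc_elem (star c)) \<in> rel_ideal"
      if "c \<in> arcs G" for c
      using rel_ideal_closed(5)[OF g(2)[rule_format, OF that], of a]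
      by (simp add: strip_simps path_alg_mult_left pm.scale_right_diff_distrib mult.commute)
    with g(1) show ?case
      by (intro exI[of _ "\<lambda>j. smul a (g j)"]) (auto simp: starting_def)
  qed
next
  case (rel u p j q v)
  show ?case
  proof (cases p)
    case Nil
    with rel have "u = j" by auto
    \<comment> \<open>The relation opens the path, so the path \<open>q\<close> after it is the
      coefficient at \<open>j\<close>; at the other vertices the coefficient is zero.\<close>
    with Nil rel show ?thesis
      by (intro exI[of _ "\<lambda>i. if i = j then Poly_Mapping.single (j, q, v) 1 else 0"])
        (auto simp: strip_rel_at_Nil path_alg_mult_left starting_def)
  next
    case (Cons c' p')
    with rel show ?thesis
      by (intro exI[of _ "\<lambda>_. 0"])
        (auto simp: strip_rel_at_Cons path_alg_mult_left starting_def awalk_Cons_iff intro!: rel_at_in_ideal)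
  qed
qed

text \<open>The coefficients \<open>y c\<close> are recovered by stripping the sum, because
  \<open>y c\<close> starts where \<open>c\<close> ends. The claim is then
  \<open>strip_rel_ideal\<close> at the single vertex \<open>j\<close>.\<close>

lemma exact_middle:
  assumes "\<And>c. c \<in> arcs G \<Longrightarrow> tail G c = j \<Longrightarrow> y c \<in> starting (head G c)"
    and "(\<Sum>c\<in>{c \<in> arcs G. tail G c = j}. y c \<cdot> arc_elem c) \<in> rel_ideal"
  shows "\<exists>g\<in>starting j. (j \<in> J \<longrightarrow> g = 0) \<and>
    (\<forall>c\<in>arcs G. tail G c = j \<longrightarrow> y c - smul (\<eta> (star c)) (g \<cdot> arc_elem (star c)) \<in> rel_ideal)"
proof -
  let ?x = "\<Sum>c\<in>{c \<in> arcs G. tail G c = j}. y c \<cdot> arc_elem c"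
  have strip: "strip c ?x = y c" if "c \<in> arcs G" "tail G c = j" for c
  proof -
    have "strip c ?x = (\<Sum>c'\<in>{c \<in> arcs G. tail G c = j}. if c = c' then y c else 0)"
      unfolding strip_simps using that assms(1)
      by (intro sum.cong) (auto simp: strip_mult_arc starting_restrict)
    with that show ?thesis by simp
  qed
  obtain g where g: "\<forall>j. g j \<in> starting j \<and> (j \<in> J \<longrightarrow> g j = 0)"
    "\<forall>c\<in>arcs G. strip c ?x - smul (\<eta> (star c)) (g (tail G c) \<cdot> arc_elem (star c)) \<in> rel_ideal"
    using strip_rel_ideal[OF assms(2)] by blast
  have "y c - smul (\<eta> (star c)) (g j \<cdot> arc_elem (star c)) \<in> rel_ideal" if "c \<in> arcs G" "tail G c = j" for c
    using g(2)[rule_format, OF that(1)] unfolding strip[OF that] that(2) .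
  with g(1) show ?thesis
    by (intro bexI[of _ "g j"]) auto
qed

end

subsection \<open>The socle\<close>

definition linear_ext :: "('a \<Rightarrow> ('b \<Rightarrow>\<^sub>0 'k)) \<Rightarrow> ('a \<Rightarrow>\<^sub>0 'k::field) \<Rightarrow> ('b \<Rightarrow>\<^sub>0 'k)" where
  "linear_ext g x = (\<Sum>t\<in>Poly_Mapping.keys x. smul (Poly_Mapping.lookup x t) (g t))"

lemma linear_ext_superset:
  assumes "finite A" "Poly_Mapping.keys x \<subseteq> A"
  shows "linear_ext g x = (\<Sum>t\<in>A. smul (Poly_Mapping.lookup x t) (g t))"
  unfolding linear_ext_def
  by (intro sum.mono_neutral_left) (use assms in \<open>auto simp: in_keys_iff\<close>)

lemma linear_ext_linear:
  fixes g :: "'a \<Rightarrow> ('b \<Rightarrow>\<^sub>0 'k::field)"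
  shows "pm_linear (linear_ext g)"
proof (rule pm_linearI)
  fix x y :: "'a \<Rightarrow>\<^sub>0 'k" and c :: 'k
  let ?A = "Poly_Mapping.keys x \<union> Poly_Mapping.keys y"
  show "linear_ext g (x + y) = linear_ext g x + linear_ext g y"
    by (subst (1 2 3) linear_ext_superset[of ?A])
      (auto simp: lookup_add pm.scale_left_distrib sum.distrib dest: subsetD[OF Poly_Mapping.keys_add])
  show "linear_ext g (smul c x) = smul c (linear_ext g x)"
    by (subst (1 2) linear_ext_superset[of ?A]) (auto simp: pm.scale_sum_right in_keys_iff)
qed

lemma linear_ext_single [simp]: "linear_ext g (Poly_Mapping.single t 1) = g t"
  by (simp add: linear_ext_def)

text \<open>A linear functional that is zero on \<open>W\<close> and one at \<open>z\<close>,
  multiplied by \<open>y\<close>. It provides the first map in the descent through the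
  degrees.\<close>

lemma separating_map:
  assumes "pm.subspace W" "z \<notin> W"
  shows "\<exists>f. pm_linear f \<and> f z = y \<and> (\<forall>x\<in>W. f x = 0) \<and> (\<forall>x. f x \<in> pm.span {y})"
proof -
  obtain B where B: "B \<subseteq> W" "pm.independent B" "W \<subseteq> pm.span B"
    by (rule pm.maximal_independent_subset)
  have span: "pm.span B = W"
    using B pm.span_minimal[OF B(1) assms(1)] by auto
  then have "pm.independent (insert z B)"
    using B(2) assms(2) by (intro pm.independent_insertI) auto
  then obtain f where f: "pm_linear f" "\<forall>x\<in>insert z B. f x = (if x = z then y else 0)"
    "range f = pm.span ((\<lambda>x. if x = z then y else 0) ` insert z B)"
    using pmp.linear_independent_extend_subspace[of "insert z B" "\<lambda>x. if x = z then y else 0"] by blast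
  have "z \<notin> B" using B(1) assms(2) by auto
  have "f x = 0" if "x \<in> W" for x
  proof (rule pmp.linear_eq_0_on_span[OF f(1)])
    show "x \<in> pm.span B" using that span by simp
  qed (use f(2) \<open>z \<notin> B\<close> in auto)
  moreover have "pm.span ((\<lambda>x. if x = z then y else 0) ` insert z B) \<subseteq> pm.span {y}"
    by (intro pm.span_minimal) (auto intro: pm.span_base pm.span_zero)
  ultimately show ?thesis
    using f by (intro exI[of _ f]) auto
qed

context preprojective_datum
begin

text \<open>Vanishing in \<open>\<Pi>\<close> is membership in \<open>rel_ideal\<close>, so this is
  injectivity of the leftmost differential. Both the Hilbert series and Koszulness are derived from
  it.\<close>

definition socle_free :: bool where
  "socle_free \<longleftrightarrow> (\<forall>j\<in>verts G - J. \<forall>g\<in>starting j.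
     (\<forall>c\<in>arcs G. head G c = j \<longrightarrow> g \<cdot> arc_elem c \<in> rel_ideal) \<longrightarrow> g \<in> rel_ideal)"

text \<open>Exactness in the middle for a family with at most one nonzero member. The coefficient
  \<open>g\<close> found at the tail of \<open>b\<close> is killed by the reversals of all other
  arcs leaving that vertex; this is how an annihilation moves on to a neighbouring vertex.\<close>

lemma single_exact_middle:
  assumes "b \<in> arcs G" "y \<in> starting (head G b)" "y \<cdot> arc_elem b \<in> rel_ideal"
  shows "\<exists>g\<in>starting (tail G b). (tail G b \<in> J \<longrightarrow> g = 0) \<and>
    y - smul (\<eta> (star b)) (g \<cdot> arc_elem (star b)) \<in> rel_ideal \<and>
    (\<forall>c\<in>arcs G. tail G c = tail G b \<and> c \<noteq> b \<longrightarrow> smul (\<eta> (star c)) (g \<cdot> arc_elem (star c)) \<in> rel_ideal)"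
proof -
  let ?y = "\<lambda>c. if c = b then y else 0"
  have "(\<Sum>c\<in>{c \<in> arcs G. tail G c = tail G b}. ?y c \<cdot> arc_elem c) =
      (\<Sum>c\<in>{c \<in> arcs G. tail G c = tail G b}. if c = b then y \<cdot> arc_elem b else 0)"
    by (intro sum.cong) (auto simp: path_alg_mult_left)
  also have "\<dots> = y \<cdot> arc_elem b"
    using assms(1) by (subst sum.delta) auto
  finally have "(\<Sum>c\<in>{c \<in> arcs G. tail G c = tail G b}. ?y c \<cdot> arc_elem c) \<in> rel_ideal"
    using assms(3) by simp
  then obtain g where g: "g \<in> starting (tail G b)" "tail G b \<in> J \<longrightarrow> g = 0"
    "\<forall>c\<in>arcs G. tail G c = tail G b \<longrightarrow> ?y c - smul (\<eta> (star c)) (g \<cdot> arc_elem (star c)) \<in> rel_ideal"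
    using exact_middle[of "tail G b" ?y] assms(2) pm.subspace_0[OF starting_subspace] by (smt (verit))
  show ?thesis
  proof (intro bexI[of _ g] conjI ballI impI g(1) g(2)[rule_format])
    show "y - smul (\<eta> (star b)) (g \<cdot> arc_elem (star b)) \<in> rel_ideal"
      using g(3)[rule_format, OF assms(1)] by simp
    fix c assume c: "c \<in> arcs G" "tail G c = tail G b \<and> c \<noteq> b"
    show "smul (\<eta> (star c)) (g \<cdot> arc_elem (star c)) \<in> rel_ideal"
      using g(3)[rule_format, OF c(1)] c rel_ideal_closed(4) by fastforce
  qed
qed

lemma scale_in_ideal_iff: "a \<noteq> 0 \<Longrightarrow> smul a x \<in> rel_ideal \<longleftrightarrow> x \<in> rel_ideal"
  using rel_ideal_closed(5)[of x a] rel_ideal_closed(5)[of "smul a x" "inverse a"] by auto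

lemma distance_function:
  assumes conn: "\<And>S. S \<subseteq> verts G \<Longrightarrow> S \<noteq> {} \<Longrightarrow>
      (\<And>c. c \<in> arcs G \<Longrightarrow> head G c \<in> S \<Longrightarrow> tail G c \<in> S) \<Longrightarrow> S = verts G"
    and J: "J \<subseteq> verts G" "J \<noteq> {}"
  shows "\<exists>r :: 'v \<Rightarrow> nat. \<forall>j\<in>verts G - J. \<exists>c\<in>arcs G. head G c = j \<and> r (tail G c) < r j"
proof -
  \<comment> \<open>\<open>N n\<close> consists of the vertices at distance at most \<open>n\<close>
    from \<open>J\<close>, so \<open>r\<close> below is the distance to \<open>J\<close>.\<close>
  define N where "N n = ((\<lambda>S. S \<union> head G ` {c \<in> arcs G. tail G c \<in> S}) ^^ n) J" for n
  have N_Suc: "N (Suc n) = N n \<union> head G ` {c \<in> arcs G. tail G c \<in> N n}" for n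
    by (simp add: N_def)
  have sub: "N n \<subseteq> verts G" for n
    by (induction n) (use J in \<open>auto simp: N_Suc, auto simp: N_def\<close>)
  have "(\<Union>n. N n) = verts G"
  proof (rule conn)
    show "(\<Union>n. N n) \<noteq> {}" using J(2) by (auto simp: N_def intro!: exI[of _ 0])
    fix c assume c: "c \<in> arcs G" "head G c \<in> (\<Union>n. N n)"
    then obtain n where "head G c \<in> N n" by auto
    then have "tail G c \<in> N (Suc n)"
      using c(1) by (auto simp: N_Suc intro!: image_eqI[of _ _ "star c"])
    then show "tail G c \<in> (\<Union>n. N n)" by blast
  qed (use sub in auto)
  then have ex: "\<exists>n. j \<in> N n" if "j \<in> verts G" for j using that by auto
  define r where "r j = (LEAST n. j \<in> N n)" for j
  have "\<exists>c\<in>arcs G. head G c = j \<and> r (tail G c) < r j" if j: "j \<in> verts G - J" for j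
  proof -
    have rj: "j \<in> N (r j)"
      unfolding r_def using ex j by (metis DiffD1 LeastI)
    have "r j \<noteq> 0" using rj j by (cases "r j") (auto simp: N_def)
    then obtain n where n: "r j = Suc n" by (cases "r j") auto
    have "j \<notin> N n" using not_less_Least[of n "\<lambda>n. j \<in> N n"] n by (simp add: r_def)
    with rj n obtain c where c: "c \<in> arcs G" "head G c = j" "tail G c \<in> N n"
      by (auto simp: N_Suc)
    have "r (tail G c) \<le> n" unfolding r_def by (rule Least_le) (rule c(3))
    with c n show ?thesis by auto
  qed
  then show ?thesis by blast
qed

lemma socle_free_nonempty:
  assumes conn: "\<And>S. S \<subseteq> verts G \<Longrightarrow> S \<noteq> {} \<Longrightarrow>
      (\<And>c. c \<in> arcs G \<Longrightarrow> head G c \<in> S \<Longrightarrow> tail G c \<in> S) \<Longrightarrow> S = verts G"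
    and J: "J \<subseteq> verts G" "J \<noteq> {}"
  shows socle_free
proof -
  obtain r :: "'v \<Rightarrow> nat" where r: "\<And>j. j \<in> verts G - J \<Longrightarrow> \<exists>c\<in>arcs G. head G c = j \<and> r (tail G c) < r j"
    using distance_function[OF assms] by blast
  have main: "g \<in> rel_ideal" if "b \<in> arcs G" "head G b \<notin> J" "r (tail G b) < r (head G b)"
    "g \<in> starting (head G b)" "g \<cdot> arc_elem b \<in> rel_ideal" for b g
    using that
  proof (induction "r (head G b)" arbitrary: b g rule: less_induct)
    case less
    obtain h where h: "h \<in> starting (tail G b)" "tail G b \<in> J \<longrightarrow> h = 0"
      "g - smul (\<eta> (star b)) (h \<cdot> arc_elem (star b)) \<in> rel_ideal"
      "\<forall>c\<in>arcs G. tail G c = tail G b \<and> c \<noteq> b \<longrightarrow> smul (\<eta> (star c)) (h \<cdot> arc_elem (star c)) \<in> rel_ideal"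
      using single_exact_middle[OF less.prems(1,4,5)] by blast
    have "h \<in> rel_ideal"
    proof (cases "tail G b \<in> J")
      case True
      with h(2) show ?thesis by auto
    next
      case False
      then obtain b' where b': "b' \<in> arcs G" "head G b' = tail G b" "r (tail G b') < r (tail G b)"
        using r[of "tail G b"] less.prems(1) by auto
      \<comment> \<open>\<open>b'\<close> comes from a vertex still nearer to \<open>J\<close>,
        while \<open>b\<close> leads away from \<open>J\<close>. So \<open>star b'\<close> is one of
        the other arcs leaving the tail of \<open>b\<close>, and \<open>h\<close> is killed by
        \<open>b'\<close>.\<close>
      have "star b' \<noteq> b"
        using b' less.prems(3) head_star[OF b'(1)] by auto
      with h(4)[rule_format, of "star b'"] b' have "smul (\<eta> b') (h \<cdot> arc_elem b') \<in> rel_ideal"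
        by auto
      then have "h \<cdot> arc_elem b' \<in> rel_ideal"
        using eta_nonzero[of b'] b' False by (simp add: scale_in_ideal_iff)
      moreover have "r (head G b') < r (head G b)" "head G b' \<notin> J" "r (tail G b') < r (head G b')"
        "h \<in> starting (head G b')"
        using less.prems(3) b'(2,3) h(1) False by simp_all
      ultimately show ?thesis
        using less.hyps[of b' h] b'(1) by blast
    qed
    then have "h \<cdot> arc_elem (star b) \<in> rel_ideal"
      using less.prems(1) by (intro rel_ideal_right) auto
    then have "smul (\<eta> (star b)) (h \<cdot> arc_elem (star b)) \<in> rel_ideal"
      by blast
    then show ?case using rel_ideal_diffD[OF h(3)] by blast
  qed
  show ?thesis
    unfolding socle_free_def
  proof (intro ballI impI)
    fix j g assume *: "j \<in> verts G - J" "g \<in> starting j"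
      "\<forall>c\<in>arcs G. head G c = j \<longrightarrow> g \<cdot> arc_elem c \<in> rel_ideal"
    obtain b where "b \<in> arcs G" "head G b = j" "r (tail G b) < r j" using r[OF *(1)] by blast
    with * main[of b g] show "g \<in> rel_ideal" by simp
  qed
qed

section \<open>Graded pieces and the descent of maps through the degrees\<close>

definition hom_part :: "nat \<Rightarrow> 'v \<Rightarrow> (('v, 'b) path \<Rightarrow>\<^sub>0 'k) set" where
  "hom_part n j = supported {(u, p, v) \<in> paths G. u = j \<and> length p = n}"

lemma hom_part_subspace [simp]: "pm.subspace (hom_part n j)"
  by (simp add: hom_part_def)

lemma hom_part_starting: "x \<in> hom_part n j \<Longrightarrow> x \<in> starting j"
  unfolding hom_part_def starting_def by (rule subsetD[OF supported_mono]) auto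

lemma hom_part_zero [simp]: "0 \<in> hom_part n j"
  by (simp add: hom_part_def)

lemma hom_part_mult_arc:
  assumes "x \<in> hom_part n (head G c)" "c \<in> arcs G"
  shows "x \<cdot> arc_elem c \<in> hom_part (Suc n) (tail G c)"
  by (rule pm_linear_in_subspace[OF path_alg_mult_linear_left _ assms(1)[unfolded hom_part_def]])
    (use assms(2) in \<open>auto simp: mult_arc_single hom_part_def awalk_Cons_iff\<close>)

abbreviation deg_proj :: "nat \<Rightarrow> (('v, 'b) path \<Rightarrow>\<^sub>0 'k) \<Rightarrow> (('v, 'b) path \<Rightarrow>\<^sub>0 'k)" where
  "deg_proj n \<equiv> restrict_pm {(u, p, v). length p = n}"

lemma lookup_mult_arc:
  "Poly_Mapping.lookup (x \<cdot> arc_elem c) (u, p, v) =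
    (case p of [] \<Rightarrow> 0 | c' # q \<Rightarrow>
      if c' = c \<and> u = tail G c then Poly_Mapping.lookup x (head G c, q, v) else 0)"
proof -
  let ?T = "{(u, p, v). p \<noteq> [] \<and> hd p = c \<and> u = tail G c}"
  have inj: "inj_on (\<lambda>(u, p, v). (head G c, tl p, v)) ?T"
    by (auto simp: inj_on_def intro: list.expand)
  have "x \<cdot> arc_elem c = pullback (\<lambda>(u, p, v). (head G c, tl p, v)) ?T x"
  proof (rule pm_linear_ext[where x = x, OF path_alg_mult_linear_left pullback_linear[OF inj]])
    fix t :: "('v, 'b) path"
    obtain u p v where t: "t = (u, p, v)" by (cases t)
    show "Poly_Mapping.single t 1 \<cdot> arc_elem c =
        pullback (\<lambda>(u, p, v). (head G c, tl p, v)) ?T (Poly_Mapping.single t 1)"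
    proof (rule path_pm_eqI)
      fix u' p' v'
      show "Poly_Mapping.lookup (Poly_Mapping.single t 1 \<cdot> arc_elem c) (u', p', v') =
          Poly_Mapping.lookup (pullback (\<lambda>(u, p, v). (head G c, tl p, v)) ?T (Poly_Mapping.single t 1)) (u', p', v')"
        unfolding t mult_arc_single lookup_pullback[OF inj]
        by (cases p') (auto simp: lookup_single when_def)
    qed
  qed
  then show ?thesis
    by (simp add: lookup_pullback[OF inj] split: list.split)
qed

lemma deg_proj_mult_arc: "deg_proj (Suc n) (x \<cdot> arc_elem c) = deg_proj n x \<cdot> arc_elem c"
  by (rule path_pm_eqI) (simp add: lookup_mult_arc split: list.split)

lemma deg_proj_0_mult_arc: "deg_proj 0 (x \<cdot> arc_elem c) = 0"
  by (rule path_pm_eqI) (simp add: lookup_mult_arc)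

lemma restrict_pm_Int: "x \<in> supported S \<Longrightarrow> restrict_pm T x \<in> supported (S \<inter> T)"
  by (auto simp: supported_iff)

lemma deg_proj_starting: "x \<in> starting j \<Longrightarrow> deg_proj n x \<in> hom_part n j"
  unfolding starting_def hom_part_def
  by (rule subsetD[OF supported_mono restrict_pm_Int]) auto

lemma deg_proj_hom_part: "x \<in> hom_part n j \<Longrightarrow> deg_proj n x = x"
  unfolding hom_part_def by (rule restrict_pm_id) (auto simp: supported_iff)

lemma deg_proj_rel_ideal: "x \<in> rel_ideal \<Longrightarrow> deg_proj n x \<in> rel_ideal"
  using restrict_rel_ideal[of x "\<lambda>u l v. l = n"] by simp

lemma deg_proj_sum:
  assumes "finite N" "\<And>u p v. (u, p, v) \<in> Poly_Mapping.keys x \<Longrightarrow> length p \<in> N"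
  shows "x = (\<Sum>n\<in>N. deg_proj n x)"
proof (rule path_pm_eqI)
  fix u p v
  show "Poly_Mapping.lookup x (u, p, v) = Poly_Mapping.lookup (\<Sum>n\<in>N. deg_proj n x) (u, p, v)"
    using assms(1) assms(2)[of u p v]
    by (cases "Poly_Mapping.lookup x (u, p, v) = 0") (simp_all add: lookup_sum in_keys_iff)
qed

text \<open>Only the component of \<open>g\<close> in degree \<open>n - 1\<close> matters. For
  \<open>n = 0\<close> there is none, since a product with an arc has no trivial paths; the
  \<open>y c\<close> then lie in the ideal themselves.\<close>

lemma exact_middle_deg:
  assumes "\<And>c. c \<in> arcs G \<Longrightarrow> tail G c = j \<Longrightarrow> y c \<in> hom_part n (head G c)"
    and "(\<Sum>c\<in>{c \<in> arcs G. tail G c = j}. y c \<cdot> arc_elem c) \<in> rel_ideal"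
  shows "\<exists>g. (case n of 0 \<Rightarrow> g = 0 | Suc m \<Rightarrow> g \<in> hom_part m j) \<and> (j \<in> J \<longrightarrow> g = 0) \<and>
    (\<forall>c\<in>arcs G. tail G c = j \<longrightarrow> y c - smul (\<eta> (star c)) (g \<cdot> arc_elem (star c)) \<in> rel_ideal)"
proof -
  obtain g where g: "g \<in> starting j" "j \<in> J \<longrightarrow> g = 0"
    "\<forall>c\<in>arcs G. tail G c = j \<longrightarrow> y c - smul (\<eta> (star c)) (g \<cdot> arc_elem (star c)) \<in> rel_ideal"
  proof -
    have "y c \<in> starting (head G c)" if "c \<in> arcs G" "tail G c = j" for c
      by (rule hom_part_starting) (rule assms(1)[OF that])
    from exact_middle[of j y, OF this assms(2)] that show ?thesis by blast
  qed
  have proj: "y c - smul (\<eta> (star c)) (deg_proj n (g \<cdot> arc_elem (star c))) \<in> rel_ideal"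
    if "c \<in> arcs G" "tail G c = j" for c
    using deg_proj_rel_ideal[OF g(3)[rule_format, OF that], of n] deg_proj_hom_part[OF assms(1)[OF that]]
    by (simp add: pm_linearD[OF restrict_pm_linear])
  show ?thesis
  proof (cases n)
    case 0
    have "y c \<in> rel_ideal" if "c \<in> arcs G" "tail G c = j" for c
      using proj[OF that] unfolding 0 deg_proj_0_mult_arc by simp
    with 0 show ?thesis
      by (intro exI[of _ 0]) (auto simp: path_alg_mult_left)
  next
    case (Suc m)
    with proj g(1,2) show ?thesis
      by (intro exI[of _ "deg_proj m g"])
        (auto simp: deg_proj_mult_arc deg_proj_starting pm_linearD[OF restrict_pm_linear])
  qed
qed

lemma hom_part_expand:
  assumes "x \<in> hom_part (Suc n) j" "pm_linear f" "pm.subspace S"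
    "\<And>c u. c \<in> arcs G \<Longrightarrow> tail G c = j \<Longrightarrow> u \<in> hom_part n (head G c) \<Longrightarrow> f (u \<cdot> arc_elem c) \<in> S"
  shows "f x \<in> S"
proof (rule pm_linear_in_subspace[OF assms(2,3) assms(1)[unfolded hom_part_def]])
  fix t assume "t \<in> {(u, p, v) \<in> paths G. u = j \<and> length p = Suc n}"
  then obtain c p v where t: "t = (j, c # p, v)" "awalk j (c # p) v" "length p = n"
    by (cases t; cases "fst (snd t)") auto
  then have "c \<in> arcs G" "tail G c = j" "awalk (head G c) p v"
    by (auto simp: awalk_Cons_iff)
  moreover from this t have "Poly_Mapping.single t 1 = Poly_Mapping.single (head G c, p, v) 1 \<cdot> arc_elem c"
    by (simp add: mult_arc_single)
  ultimately show "f (Poly_Mapping.single t 1) \<in> S"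
    using assms(4)[of c "Poly_Mapping.single (head G c, p, v) 1"] t by (simp add: hom_part_def)
qed

lemma mult_rel_at_expand:
  assumes "u \<in> starting j"
  shows "(\<Sum>c\<in>{c \<in> arcs G. head G c = j}. smul (\<eta> c) (u \<cdot> arc_elem c \<cdot> arc_elem (star c))) = u \<cdot> rel_at j [] j [] j"
proof -
  have "smul (\<eta> c) (u \<cdot> arc_elem c \<cdot> arc_elem (star c)) =
      u \<cdot> Poly_Mapping.single (j, [] @ [star c, c] @ [], j) (\<eta> c)"
    if "c \<in> arcs G" "head G c = j" for c
  proof -
    have "Poly_Mapping.single (j, [] @ [star c, c] @ [], j) (\<eta> c) = smul (\<eta> c) (arc_elem c \<cdot> arc_elem (star c))"
      using that by (simp add: arc_elem_def path_alg_mult_single_paths)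
    then show ?thesis
      by (simp add: path_alg_mult_right path_alg_mult_assoc)
  qed
  then show ?thesis
    by (simp add: rel_at_def path_alg_mult_right)
qed

text \<open>Injectivity in the form used here: prescribed products \<open>y c\<close> with the arcs
  into \<open>j\<close> come from one element \<open>g\<close> as soon as they satisfy the relation
  at \<open>j\<close>. It is exactness in the middle with all arcs reversed; since \<open>J\<close>
  is empty, every \<open>\<eta> c\<close> can be divided out.\<close>

lemma exact_middle_star:
  assumes "J = {}" "\<And>c. c \<in> arcs G \<Longrightarrow> head G c = j \<Longrightarrow> y c \<in> hom_part n (tail G c)"
    and "(\<Sum>c\<in>{c \<in> arcs G. head G c = j}. smul (\<eta> c) (y c \<cdot> arc_elem (star c))) \<in> rel_ideal"
  shows "\<exists>g. (case n of 0 \<Rightarrow> g = 0 | Suc m \<Rightarrow> g \<in> hom_part m j) \<and>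
    (\<forall>c\<in>arcs G. head G c = j \<longrightarrow> y c - g \<cdot> arc_elem c \<in> rel_ideal)"
proof -
  let ?z = "\<lambda>c. smul (\<eta> (star c)) (y (star c))"
  have "(\<Sum>c\<in>{c \<in> arcs G. tail G c = j}. ?z c \<cdot> arc_elem c) =
      (\<Sum>c\<in>{c \<in> arcs G. head G c = j}. smul (\<eta> c) (y c \<cdot> arc_elem (star c)))"
    by (rule sum.reindex_bij_witness[of _ star star]) (auto simp: path_alg_mult_left)
  then have "(\<Sum>c\<in>{c \<in> arcs G. tail G c = j}. ?z c \<cdot> arc_elem c) \<in> rel_ideal"
    using assms(3) by simp
  moreover have "?z c \<in> hom_part n (head G c)" if "c \<in> arcs G" "tail G c = j" for c
    using assms(2)[of "star c"] that by (intro pm.subspace_scale) auto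
  ultimately obtain g where g: "case n of 0 \<Rightarrow> g = 0 | Suc m \<Rightarrow> g \<in> hom_part m j"
    "\<forall>c\<in>arcs G. tail G c = j \<longrightarrow> ?z c - smul (\<eta> (star c)) (g \<cdot> arc_elem (star c)) \<in> rel_ideal"
    using exact_middle_deg[of j ?z n] by blast
  have "y c - g \<cdot> arc_elem c \<in> rel_ideal" if c: "c \<in> arcs G" "head G c = j" for c
  proof -
    have "smul (\<eta> c) (y c - g \<cdot> arc_elem c) \<in> rel_ideal"
      using g(2)[rule_format, of "star c"] c by (simp add: pm.scale_right_diff_distrib)
    then show ?thesis
      using scale_in_ideal_iff[of "\<eta> c"] eta_nonzero[OF c(1)] assms(1) by blast
  qed
  with g(1) show ?thesis by blast
qed

text \<open>
  The last condition, vacuous for \<open>s = 0\<close>, is what extends \<open>\<phi>\<close> compatibly to paths of length \<open>s - 1\<close>.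
\<close>

definition degree_lowering :: "nat \<Rightarrow> nat \<Rightarrow> ((('v, 'b) path \<Rightarrow>\<^sub>0 'k) \<Rightarrow> (('v, 'b) path \<Rightarrow>\<^sub>0 'k)) \<Rightarrow> bool" where
  "degree_lowering d s \<phi> \<longleftrightarrow> pm_linear \<phi> \<and>
     (\<forall>p. \<forall>u\<in>hom_part s p. \<phi> u \<in> hom_part (s - d) p) \<and>
     (\<forall>p. \<forall>u\<in>hom_part s p. u \<in> rel_ideal \<longrightarrow> \<phi> u \<in> rel_ideal) \<and>
     (\<exists>p. \<exists>u\<in>hom_part s p. \<phi> u \<notin> rel_ideal) \<and>
     (\<forall>n p. \<forall>u\<in>hom_part n p. s = Suc n \<longrightarrow>
        (\<Sum>c\<in>{c \<in> arcs G. head G c = p}. smul (\<eta> c) (\<phi> (u \<cdot> arc_elem c) \<cdot> arc_elem (star c))) \<in> rel_ideal)"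

text \<open>The value of \<open>\<psi>\<close> at \<open>u\<close> has to solve
  \<open>\<psi> u c = \<phi> (u c)\<close> for all arcs \<open>c\<close> into the start of
  \<open>u\<close>, and the last condition on \<open>\<phi>\<close> makes this solvable. The
  solution respects the ideal because no element of degree \<open>n - d\<close> outside the ideal is
  killed by all arcs.\<close>

lemma degree_lowering_step:
  assumes J: "J = {}" and \<phi>: "degree_lowering d (Suc n) \<phi>" and d: "d \<le> n"
    and min: "\<And>j x. x \<in> hom_part (n - d) j \<Longrightarrow>
      (\<And>c. c \<in> arcs G \<Longrightarrow> head G c = j \<Longrightarrow> x \<cdot> arc_elem c \<in> rel_ideal) \<Longrightarrow> x \<in> rel_ideal"
  shows "\<exists>\<psi>. degree_lowering d n \<psi>"
proof -
  have lin: "pm_linear \<phi>"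
    and deg: "\<And>p u. u \<in> hom_part (Suc n) p \<Longrightarrow> \<phi> u \<in> hom_part (Suc (n - d)) p"
    and ideal: "\<And>p u. u \<in> hom_part (Suc n) p \<Longrightarrow> u \<in> rel_ideal \<Longrightarrow> \<phi> u \<in> rel_ideal"
    and nonzero: "\<exists>p. \<exists>u\<in>hom_part (Suc n) p. \<phi> u \<notin> rel_ideal"
    and extends: "\<And>p u. u \<in> hom_part n p \<Longrightarrow>
      (\<Sum>c\<in>{c \<in> arcs G. head G c = p}. smul (\<eta> c) (\<phi> (u \<cdot> arc_elem c) \<cdot> arc_elem (star c))) \<in> rel_ideal"
    using \<phi> d unfolding degree_lowering_def by (auto simp: Suc_diff_le)
  have ex: "\<exists>g. g \<in> hom_part (n - d) p \<and>
      (\<forall>c\<in>arcs G. head G c = p \<longrightarrow> \<phi> (u \<cdot> arc_elem c) - g \<cdot> arc_elem c \<in> rel_ideal)"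
    if u: "u \<in> hom_part n p" for u p
  proof -
    have "\<phi> (u \<cdot> arc_elem c) \<in> hom_part (Suc (n - d)) (tail G c)" if "c \<in> arcs G" "head G c = p" for c
      using u that by (intro deg hom_part_mult_arc) auto
    from exact_middle_star[OF J this extends[OF u]] show ?thesis by auto
  qed
  \<comment> \<open>Solutions are chosen on single paths only and then extended linearly, which
    makes \<open>\<psi>\<close> linear.\<close>
  define g where "g t = (SOME g. g \<in> hom_part (n - d) (fst t) \<and>
      (\<forall>c\<in>arcs G. head G c = fst t \<longrightarrow>
        \<phi> (Poly_Mapping.single t 1 \<cdot> arc_elem c) - g \<cdot> arc_elem c \<in> rel_ideal))" for t
  have g: "g t \<in> hom_part (n - d) (fst t) \<and> (\<forall>c\<in>arcs G. head G c = fst t \<longrightarrow>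
        \<phi> (Poly_Mapping.single t 1 \<cdot> arc_elem c) - g t \<cdot> arc_elem c \<in> rel_ideal)"
    if "t \<in> {(u, q, v) \<in> paths G. u = p \<and> length q = n}" for t p
  proof -
    have "Poly_Mapping.single t 1 \<in> hom_part n (fst t)"
      using that by (auto simp: hom_part_def)
    from someI_ex[OF ex[OF this]] show ?thesis unfolding g_def .
  qed
  define \<psi> where "\<psi> = linear_ext g"
  have lin': "pm_linear \<psi>" unfolding \<psi>_def by (rule linear_ext_linear)
  have deg': "\<psi> u \<in> hom_part (n - d) p" if "u \<in> hom_part n p" for u p
  proof (rule pm_linear_in_subspace[OF lin' hom_part_subspace that[unfolded hom_part_def]])
    fix t assume t: "t \<in> {(u, q, v) \<in> paths G. u = p \<and> length q = n}"
    then have "fst t = p" by auto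
    with g[OF t] show "\<psi> (Poly_Mapping.single t 1) \<in> hom_part (n - d) p"
      by (simp add: \<psi>_def)
  qed
  have compat: "\<phi> (u \<cdot> arc_elem c) - \<psi> u \<cdot> arc_elem c \<in> rel_ideal"
    if "u \<in> hom_part n p" "c \<in> arcs G" "head G c = p" for u p c
  proof (rule pm_linear_in_subspace[OF _ rel_ideal_subspace that(1)[unfolded hom_part_def],
        where f = "\<lambda>u. \<phi> (u \<cdot> arc_elem c) - \<psi> u \<cdot> arc_elem c"])
    show "pm_linear (\<lambda>u. \<phi> (u \<cdot> arc_elem c) - \<psi> u \<cdot> arc_elem c)"
      by (rule pm_linearI)
        (simp_all add: pm_linearD[OF lin] pm_linearD[OF lin'] path_alg_mult_left pm.scale_right_diff_distrib)
    fix t assume t: "t \<in> {(u, q, v) \<in> paths G. u = p \<and> length q = n}"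
    then have "fst t = p" by auto
    with g[OF t] that show "\<phi> (Poly_Mapping.single t 1 \<cdot> arc_elem c) - \<psi> (Poly_Mapping.single t 1) \<cdot> arc_elem c \<in> rel_ideal"
      by (simp add: \<psi>_def)
  qed
  have ideal': "\<psi> u \<in> rel_ideal" if u: "u \<in> hom_part n p" "u \<in> rel_ideal" for u p
  proof (rule min[OF deg'[OF u(1)]])
    fix c assume c: "c \<in> arcs G" "head G c = p"
    have "u \<cdot> arc_elem c \<in> hom_part (Suc n) (tail G c)" "u \<cdot> arc_elem c \<in> rel_ideal"
      using u c by (auto intro: hom_part_mult_arc rel_ideal_right)
    then have "\<phi> (u \<cdot> arc_elem c) \<in> rel_ideal" by (rule ideal)
    then show "\<psi> u \<cdot> arc_elem c \<in> rel_ideal"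
      using rel_ideal_diffD[OF compat[OF u(1) c]] by blast
  qed
  \<comment> \<open>If \<open>\<psi>\<close> vanished modulo the ideal, so would
    \<open>\<phi>\<close> on all products \<open>w c\<close>, and these span degree
    \<open>n + 1\<close>.\<close>
  have nonzero': "\<exists>p. \<exists>u\<in>hom_part n p. \<psi> u \<notin> rel_ideal"
  proof (rule ccontr)
    assume "\<not> ?thesis"
    then have all: "\<psi> u \<in> rel_ideal" if "u \<in> hom_part n p" for u p using that by blast
    obtain p u where u: "u \<in> hom_part (Suc n) p" "\<phi> u \<notin> rel_ideal" using nonzero by blast
    have "\<phi> u \<in> rel_ideal"
    proof (rule hom_part_expand[OF u(1) lin rel_ideal_subspace])
      fix c w assume c: "c \<in> arcs G" "tail G c = p" "w \<in> hom_part n (head G c)"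
      then have "\<psi> w \<cdot> arc_elem c \<in> rel_ideal"
        using all by (intro rel_ideal_right) auto
      then show "\<phi> (w \<cdot> arc_elem c) \<in> rel_ideal"
        using rel_ideal_diffD[OF compat[OF c(3,1) refl]] by blast
    qed
    with u(2) show False by simp
  qed
  have extends': "(\<Sum>c\<in>{c \<in> arcs G. head G c = p}. smul (\<eta> c) (\<psi> (u \<cdot> arc_elem c) \<cdot> arc_elem (star c))) \<in> rel_ideal"
    if u: "u \<in> hom_part m p" "n = Suc m" for m p u
  proof -
    let ?C = "{c \<in> arcs G. head G c = p}"
    have "(\<Sum>c\<in>?C. smul (\<eta> c) (\<phi> (u \<cdot> arc_elem c \<cdot> arc_elem (star c)))) =
        \<phi> (\<Sum>c\<in>?C. smul (\<eta> c) (u \<cdot> arc_elem c \<cdot> arc_elem (star c)))"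
      by (simp add: pm_linearD[OF lin])
    also have "\<dots> = \<phi> (u \<cdot> rel_at p [] p [] p)"
      using mult_rel_at_expand[OF hom_part_starting[OF u(1)]] by simp
    also have "\<dots> \<in> rel_ideal"
    proof (cases "p \<in> verts G")
      case True
      have in_deg: "u \<cdot> arc_elem c \<cdot> arc_elem (star c) \<in> hom_part (Suc n) p" if "c \<in> ?C" for c
        using hom_part_mult_arc[OF _ star_arc, of "u \<cdot> arc_elem c" n c] hom_part_mult_arc[of u m c] that u by auto
      have "(\<Sum>c\<in>?C. smul (\<eta> c) (u \<cdot> arc_elem c \<cdot> arc_elem (star c))) \<in> hom_part (Suc n) p"
        by (intro pm.subspace_sum pm.subspace_scale in_deg) auto
      then have "u \<cdot> rel_at p [] p [] p \<in> hom_part (Suc n) p"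
        using mult_rel_at_expand[OF hom_part_starting[OF u(1)]] by simp
      moreover have "u \<cdot> rel_at p [] p [] p \<in> rel_ideal"
        using True J u(1) by (intro rel_ideal_left rel_at_in_ideal)
          (auto intro: starting_kG hom_part_starting simp: awalk_Nil_iff)
      ultimately show ?thesis by (rule ideal)
    next
      case False
      then have "?C = {}" by auto
      then have "rel_at p [] p [] p = 0"
        unfolding rel_at_def by (simp only: sum.empty)
      then show ?thesis by (simp add: path_alg_mult_right pm_linearD[OF lin] rel_ideal_closed)
    qed
    finally have 1: "(\<Sum>c\<in>?C. smul (\<eta> c) (\<phi> (u \<cdot> arc_elem c \<cdot> arc_elem (star c)))) \<in> rel_ideal" .
    have "(\<Sum>c\<in>?C. smul (\<eta> c) (\<phi> (u \<cdot> arc_elem c \<cdot> arc_elem (star c)) - \<psi> (u \<cdot> arc_elem c) \<cdot> arc_elem (star c))) \<in> rel_ideal"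
    proof (intro pm.subspace_sum pm.subspace_scale rel_ideal_subspace)
      fix c assume c: "c \<in> ?C"
      show "\<phi> (u \<cdot> arc_elem c \<cdot> arc_elem (star c)) - \<psi> (u \<cdot> arc_elem c) \<cdot> arc_elem (star c) \<in> rel_ideal"
        by (rule compat[of _ "tail G c"]) (use hom_part_mult_arc[of u m c] c u in auto)
    qed
    then have "(\<Sum>c\<in>?C. smul (\<eta> c) (\<phi> (u \<cdot> arc_elem c \<cdot> arc_elem (star c)))) -
        (\<Sum>c\<in>?C. smul (\<eta> c) (\<psi> (u \<cdot> arc_elem c) \<cdot> arc_elem (star c))) \<in> rel_ideal"
      by (simp add: pm.scale_right_diff_distrib sum_subtractf)
    from rel_ideal_diffD[OF this] 1 show ?thesis by blast
  qed
  show ?thesis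
    unfolding degree_lowering_def
    by (intro exI[of _ \<psi>] conjI allI ballI impI lin' deg' ideal' nonzero' extends')
qed

text \<open>The first map sends \<open>z\<close> to the socle element \<open>y\<close>. Its values
  are multiples of \<open>y\<close>, which all arcs into \<open>j\<close> kill modulo the ideal;
  this gives the condition for extending it downwards.\<close>

lemma degree_lowering_start:
  assumes y: "y \<in> hom_part m j" "y \<notin> rel_ideal"
      "\<And>c. c \<in> arcs G \<Longrightarrow> head G c = j \<Longrightarrow> y \<cdot> arc_elem c \<in> rel_ideal"
    and z: "z \<in> hom_part e j" "z \<notin> rel_ideal" and "m \<le> e"
  shows "\<exists>\<phi>. degree_lowering (e - m) e \<phi>"
proof -
  \<comment> \<open>\<open>W\<close> contains the ideal and every path that does not start at
    \<open>j\<close>, so \<open>\<phi>\<close> lives on \<open>\<Pi> e_j\<close> only.\<close>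
  define W where "W = {x. restrict_pm {(u, p, v). u = j} x \<in> rel_ideal}"
  have "pm.subspace W"
    by (auto simp: W_def pm.subspace_def pm_linearD[OF restrict_pm_linear] rel_ideal_closed)
  moreover have "z \<notin> W"
    using z by (simp add: W_def starting_restrict[OF hom_part_starting])
  ultimately obtain \<phi> where \<phi>: "pm_linear \<phi>" "\<phi> z = y" "\<forall>x\<in>W. \<phi> x = 0" "\<forall>x. \<phi> x \<in> pm.span {y}"
    using separating_map by blast
  have other: "\<phi> u = 0" if "u \<in> hom_part n p" "p \<noteq> j" for u n p
  proof -
    have "restrict_pm {(u, p, v). u = j} u = 0"
      using that unfolding hom_part_def by (intro restrict_pm_eq_0) auto
    then show ?thesis using \<phi>(3) by (auto simp: W_def rel_ideal_closed)
  qed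
  have deg: "\<phi> u \<in> hom_part m p" if "u \<in> hom_part n p" for u n p
  proof (cases "p = j")
    case True
    have "pm.span {y} \<subseteq> hom_part m j"
      using y(1) by (intro pm.span_minimal) auto
    with True \<phi>(4) show ?thesis by auto
  qed (use other[OF that] in simp)
  have ext: "\<phi> (u \<cdot> arc_elem c) \<cdot> arc_elem (star c) \<in> rel_ideal" if "c \<in> arcs G" "u \<in> hom_part n (head G c)" for u c n
  proof (cases "tail G c = j")
    case True
    obtain a where "\<phi> (u \<cdot> arc_elem c) = smul a y"
      using \<phi>(4) pm.span_singleton[of y] by auto
    with True that y(3)[of "star c"] show ?thesis
      by (auto simp: path_alg_mult_left)
  next
    case False
    then show ?thesis
      using other[OF hom_part_mult_arc[OF that(2,1)]] by (simp add: path_alg_mult_left rel_ideal_closed)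
  qed
  have id: "\<phi> u = 0" if "u \<in> rel_ideal" for u
    using \<phi>(3) restrict_starting_rel_ideal[OF that] by (simp add: W_def)
  show ?thesis
    unfolding degree_lowering_def
  proof (intro exI[of _ \<phi>] conjI allI ballI impI \<phi>(1))
    show "\<phi> u \<in> hom_part (e - (e - m)) p" if "u \<in> hom_part e p" for u p
      using deg[OF that] \<open>m \<le> e\<close> by simp
    show "\<phi> u \<in> rel_ideal" if "u \<in> rel_ideal" for u
      using id[OF that] by (simp add: rel_ideal_closed)
    show "\<exists>p. \<exists>u\<in>hom_part e p. \<phi> u \<notin> rel_ideal"
      using z(1) \<phi>(2) y(2) by metis
    show "(\<Sum>c\<in>{c \<in> arcs G. head G c = p}. smul (\<eta> c) (\<phi> (u \<cdot> arc_elem c) \<cdot> arc_elem (star c))) \<in> rel_ideal"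
      if "u \<in> hom_part n p" for u n p
      by (intro pm.subspace_sum pm.subspace_scale rel_ideal_subspace) (use ext that in auto)
  qed
qed

text \<open>The values have degree zero, so the next extension would have values in degree
  \<open>-1\<close>. The criterion \<open>exact_middle_star\<close> then returns
  \<open>g = 0\<close>, and \<open>\<phi>\<close> vanishes modulo the ideal on all products with
  arcs.\<close>

lemma not_degree_lowering_0:
  assumes J: "J = {}" and "n > 0" "degree_lowering n n \<phi>"
  shows False
proof -
  obtain m where m: "n = Suc m" using assms(2) by (cases n) auto
  have lin: "pm_linear \<phi>"
    and deg: "\<And>p u. u \<in> hom_part n p \<Longrightarrow> \<phi> u \<in> hom_part 0 p"
    and nonzero: "\<exists>p. \<exists>u\<in>hom_part (Suc m) p. \<phi> u \<notin> rel_ideal"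
    and extends: "\<And>p u. u \<in> hom_part m p \<Longrightarrow>
      (\<Sum>c\<in>{c \<in> arcs G. head G c = p}. smul (\<eta> c) (\<phi> (u \<cdot> arc_elem c) \<cdot> arc_elem (star c))) \<in> rel_ideal"
    using assms(3) m unfolding degree_lowering_def by auto
  obtain p u where u: "u \<in> hom_part (Suc m) p" "\<phi> u \<notin> rel_ideal" using nonzero by blast
  have "\<phi> u \<in> rel_ideal"
  proof (rule hom_part_expand[OF u(1) lin rel_ideal_subspace])
    fix c w assume c: "c \<in> arcs G" "tail G c = p" "w \<in> hom_part m (head G c)"
    have "\<phi> (w \<cdot> arc_elem b) \<in> hom_part 0 (tail G b)" if "b \<in> arcs G" "head G b = head G c" for b
      using hom_part_mult_arc[of w m b] that c m by (intro deg) auto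
    from exact_middle_star[OF J this extends[OF c(3)]]
    show "\<phi> (w \<cdot> arc_elem c) \<in> rel_ideal"
      using c(1) by (auto simp: path_alg_mult_left)
  qed
  with u(2) show False by simp
qed

text \<open>
  A socle element \<open>y\<close> of least degree \<open>m\<close> kills everything beyond degree \<open>m\<close>: otherwise the map
  sending an element of degree \<open>e > m\<close> to \<open>y\<close> extends step by step to all lower degrees, where it
  takes values in negative degree.
\<close>

lemma socle_bounds_degree:
  assumes J: "J = {}" and y: "y \<in> hom_part m j" "y \<notin> rel_ideal"
      "\<And>c. c \<in> arcs G \<Longrightarrow> head G c = j \<Longrightarrow> y \<cdot> arc_elem c \<in> rel_ideal"
    and min: "\<And>n j x. n < m \<Longrightarrow> x \<in> hom_part n j \<Longrightarrow>
      (\<And>c. c \<in> arcs G \<Longrightarrow> head G c = j \<Longrightarrow> x \<cdot> arc_elem c \<in> rel_ideal) \<Longrightarrow> x \<in> rel_ideal"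
    and "m < e"
  shows "hom_part e j \<subseteq> rel_ideal"
proof (rule ccontr)
  assume "\<not> ?thesis"
  then obtain z where z: "z \<in> hom_part e j" "z \<notin> rel_ideal" by blast
  let ?d = "e - m"
  \<comment> \<open>The values on degree \<open>?d + i\<close> have degree \<open>i\<close>. The
    descent therefore runs from \<open>i = m\<close> to \<open>i = 0\<close>, and each step uses the
    absence of socle elements in a degree below \<open>m\<close>.\<close>
  have "\<exists>\<phi>. degree_lowering ?d (?d + i) \<phi>" if "i \<le> m" for i
    using that
  proof (induction i rule: inc_induct)
    case base
    show ?case using degree_lowering_start[OF y z] \<open>m < e\<close> by simp
  next
    case (step i)
    then obtain \<phi> where "degree_lowering ?d (Suc (?d + i)) \<phi>" by auto
    then show ?case
      by (rule degree_lowering_step[OF J]) (use min[of i] step(2) in auto)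
  qed
  from this[of 0] obtain \<phi> where "degree_lowering ?d ?d \<phi>" by auto
  with not_degree_lowering_0[OF J, of ?d \<phi>] \<open>m < e\<close> show False by simp
qed

text \<open>A socle element of least degree bounds the degrees of \<open>\<Pi> e_j\<close> at its
  own vertex, and the bound spreads to neighbours. Let \<open>b\<close> go from a bounded vertex
  \<open>i\<close> to \<open>l\<close>. For \<open>x\<close> in \<open>\<Pi> e_l\<close> of high
  degree, \<open>x b\<close> lies in \<open>\<Pi> e_i\<close> and vanishes; by exactness in the
  middle \<open>x\<close> is a multiple of some \<open>h b*\<close> with \<open>h\<close> in
  \<open>\<Pi> e_i\<close>, and \<open>h\<close> vanishes as well.\<close>

lemma socle_finite:
  assumes J: "J = {}" and nsf: "\<not> socle_free"
    and conn: "\<And>S. S \<subseteq> verts G \<Longrightarrow> S \<noteq> {} \<Longrightarrow>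
      (\<And>c. c \<in> arcs G \<Longrightarrow> head G c \<in> S \<Longrightarrow> tail G c \<in> S) \<Longrightarrow> S = verts G"
  shows "\<exists>M. \<forall>e>M. \<forall>j\<in>verts G. hom_part e j \<subseteq> rel_ideal"
proof -
  define P where "P m \<longleftrightarrow> (\<exists>j\<in>verts G. \<exists>y\<in>hom_part m j. y \<notin> rel_ideal \<and>
    (\<forall>c\<in>arcs G. head G c = j \<longrightarrow> y \<cdot> arc_elem c \<in> rel_ideal))" for m
  obtain j g where g: "j \<in> verts G" "g \<in> starting j" "g \<notin> rel_ideal"
    "\<forall>c\<in>arcs G. head G c = j \<longrightarrow> g \<cdot> arc_elem c \<in> rel_ideal"
    using nsf unfolding socle_free_def by blast
  have "\<exists>m. deg_proj m g \<notin> rel_ideal"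
  proof (rule ccontr)
    assume *: "\<nexists>m. deg_proj m g \<notin> rel_ideal"
    have "g = (\<Sum>n\<in>(\<lambda>t. length (fst (snd t))) ` Poly_Mapping.keys g. deg_proj n g)"
      by (rule deg_proj_sum) (auto simp: image_iff intro!: bexI)
    also have "\<dots> \<in> rel_ideal"
      using * by (intro pm.subspace_sum) auto
    finally show False using g(3) by simp
  qed
  then obtain m where m: "deg_proj m g \<notin> rel_ideal" by blast
  have "deg_proj m g \<cdot> arc_elem c \<in> rel_ideal" if "c \<in> arcs G" "head G c = j" for c
    using deg_proj_rel_ideal[OF g(4)[rule_format, OF that], of "Suc m"] by (simp only: deg_proj_mult_arc)
  with m g have "P m"
    unfolding P_def using deg_proj_starting by blast
  then obtain m where m: "P m" "\<And>n. n < m \<Longrightarrow> \<not> P n"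
    by (metis exists_least_iff)
  obtain j y where y: "j \<in> verts G" "y \<in> hom_part m j" "y \<notin> rel_ideal"
    "\<And>c. c \<in> arcs G \<Longrightarrow> head G c = j \<Longrightarrow> y \<cdot> arc_elem c \<in> rel_ideal"
    using m(1) unfolding P_def by blast
  have outside: "x = 0" if "x \<in> hom_part n i" "i \<notin> verts G" for x n i
    using that by (intro path_pm_eqI) (auto simp: hom_part_def supported_iff)
  have min: "x \<in> rel_ideal" if "n < m" "x \<in> hom_part n i"
    "\<And>c. c \<in> arcs G \<Longrightarrow> head G c = i \<Longrightarrow> x \<cdot> arc_elem c \<in> rel_ideal" for n i x
  proof (cases "i \<in> verts G")
    case True
    with m(2)[OF that(1)] that show ?thesis unfolding P_def by blast
  next
    case False
    with outside[OF that(2)] show ?thesis by (simp add: rel_ideal_closed)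
  qed
  define S where "S = {i \<in> verts G. \<exists>M. \<forall>e>M. hom_part e i \<subseteq> rel_ideal}"
  have "S = verts G"
  proof (rule conn)
    have "hom_part e j \<subseteq> rel_ideal" if "m < e" for e
      by (rule socle_bounds_degree[OF J y(2,3) y(4) _ that]) (simp, simp, rule min)
    then have "j \<in> S"
      unfolding S_def using y(1) by blast
    then show "S \<noteq> {}" by auto
    show "S \<subseteq> verts G" by (auto simp: S_def)
    fix c assume c: "c \<in> arcs G" "head G c \<in> S"
    then obtain M where M: "\<And>e. e > M \<Longrightarrow> hom_part e (head G c) \<subseteq> rel_ideal"
      unfolding S_def by blast
    \<comment> \<open>\<open>Suc M\<close> leaves room for \<open>h\<close> below, whose degree is
      one less than that of \<open>x\<close>.\<close>
    have "hom_part e (tail G c) \<subseteq> rel_ideal" if "e > Suc M" for e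
    proof
      fix x assume x: "x \<in> hom_part e (tail G c)"
      define b where "b = star c"
      have b: "b \<in> arcs G" "tail G b = head G c" "head G b = tail G c" using c by (auto simp: b_def)
      obtain n where n: "e = Suc n" using \<open>e > Suc M\<close> by (cases e) auto
      have "x \<cdot> arc_elem b \<in> hom_part (Suc e) (tail G b)"
        using x b by (intro hom_part_mult_arc) auto
      then have "x \<cdot> arc_elem b \<in> rel_ideal"
        using M[of "Suc e"] that b by auto
      then obtain h where h: "h \<in> starting (tail G b)"
        "x - smul (\<eta> (star b)) (h \<cdot> arc_elem (star b)) \<in> rel_ideal"
        using single_exact_middle[of b x] b x hom_part_starting by auto
      have "deg_proj n h \<in> rel_ideal"
        using deg_proj_starting[OF h(1), of n] M[of n] b that n by auto
      then have "smul (\<eta> (star b)) (deg_proj n h \<cdot> arc_elem (star b)) \<in> rel_ideal"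
        using b(1) by (intro rel_ideal_closed rel_ideal_right) auto
      moreover have "x - smul (\<eta> (star b)) (deg_proj n h \<cdot> arc_elem (star b)) \<in> rel_ideal"
        using deg_proj_rel_ideal[OF h(2), of e] deg_proj_hom_part[OF x]
        by (simp only: pm_linearD[OF restrict_pm_linear] n deg_proj_mult_arc)
      ultimately show "x \<in> rel_ideal" using rel_ideal_diffD by blast
    qed
    then show "tail G c \<in> S" using c by (auto simp: S_def)
  qed
  then have "\<forall>i\<in>verts G. \<exists>M. \<forall>e>M. hom_part e i \<subseteq> rel_ideal"
    unfolding S_def by blast
  from bchoice[OF this] obtain M where M: "\<And>i e. i \<in> verts G \<Longrightarrow> e > M i \<Longrightarrow> hom_part e i \<subseteq> rel_ideal"
    by blast
  have "hom_part e i \<subseteq> rel_ideal" if "e > (\<Sum>i\<in>verts G. M i)" "i \<in> verts G" for e i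
    using M[OF that(2), of e] that member_le_sum[of i "verts G" M] by auto
  then show ?thesis by blast
qed

end

subsection \<open>Dimensions\<close>

context preprojective_datum
begin

text \<open>The piece \<open>e_i (kG)_n e_j\<close>; the end comes before the start, as in the
  matrix entries.\<close>

definition path_comp :: "nat \<Rightarrow> 'v \<Rightarrow> 'v \<Rightarrow> (('v, 'b) path \<Rightarrow>\<^sub>0 'k) set" where
  "path_comp n i j = supported {(u, p, v) \<in> paths G. u = j \<and> v = i \<and> length p = n}"

definition ideal_comp :: "nat \<Rightarrow> 'v \<Rightarrow> 'v \<Rightarrow> (('v, 'b) path \<Rightarrow>\<^sub>0 'k) set" where
  "ideal_comp n i j = path_comp n i j \<inter> rel_ideal"

lemma path_comp_subspace [simp]: "pm.subspace (path_comp n i j)"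
  by (simp add: path_comp_def)

lemma ideal_comp_subspace [simp]: "pm.subspace (ideal_comp n i j)"
  unfolding ideal_comp_def by (intro pm.subspace_inter) auto

lemma comp_hom_part: "x \<in> path_comp n i j \<Longrightarrow> x \<in> hom_part n j"
  unfolding path_comp_def hom_part_def by (rule subsetD[OF supported_mono]) auto

lemma finite_paths_length: "finite {(u, p, v) \<in> paths G. length p = n}"
proof (rule finite_subset)
  show "{(u, p, v) \<in> paths G. length p = n} \<subseteq>
      verts G \<times> {p. set p \<subseteq> arcs G \<and> length p = n} \<times> verts G"
  proof
    fix t assume "t \<in> {(u, p, v) \<in> paths G. length p = n}"
    then obtain u p v where "t = (u, p, v)" "awalk u p v" "length p = n" by auto
    moreover from this have "u \<in> verts G" "v \<in> verts G" "set p \<subseteq> arcs G"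
      using awalk_hd_in_verts[of u p v] awalk_last_in_verts[of u p v] unfolding awalk_def by blast+
    ultimately show "t \<in> verts G \<times> {p. set p \<subseteq> arcs G \<and> length p = n} \<times> verts G"
      by simp
  qed
qed (intro finite_cartesian_product finite_lists_length_eq finite_verts finite_arcs)

lemma comp_finite_span: "\<exists>F. finite F \<and> (\<forall>i j. path_comp n i j \<subseteq> pm.span F)"
proof (intro exI[of _ "(\<lambda>t. Poly_Mapping.single t 1) ` {(u, p, v) \<in> paths G. length p = n}"] conjI allI)
  fix i j
  show "path_comp n i j \<subseteq> pm.span ((\<lambda>t. Poly_Mapping.single t 1) ` {(u, p, v) \<in> paths G. length p = n})"
  proof
    fix x assume "x \<in> path_comp n i j"
    then have "Poly_Mapping.keys x \<subseteq> {(u, p, v) \<in> paths G. length p = n}"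
      unfolding path_comp_def supported_def by blast
    then show "x \<in> pm.span ((\<lambda>t. Poly_Mapping.single t 1) ` {(u, p, v) \<in> paths G. length p = n})"
      by (rule pm_in_span)
  qed
qed (use finite_paths_length in auto)

abbreviation idem :: "'v \<Rightarrow> ('v, 'b) path \<Rightarrow>\<^sub>0 'k" where
  "idem i \<equiv> Poly_Mapping.single (i, [], i) 1"

lemma idem_mult_comp: "x \<in> hom_part n j \<Longrightarrow> idem i \<cdot> x \<in> path_comp n i j"
  unfolding idem_mult hom_part_def path_comp_def
  by (rule subsetD[OF supported_mono restrict_pm_Int]) auto

lemma idem_mult_id: "x \<in> path_comp n i j \<Longrightarrow> idem i \<cdot> x = x"
  unfolding idem_mult path_comp_def by (rule restrict_pm_id) (auto simp: supported_iff)

lemma comp_mult_arc: "x \<in> path_comp n i (head G c) \<Longrightarrow> c \<in> arcs G \<Longrightarrow> x \<cdot> arc_elem c \<in> path_comp (Suc n) i (tail G c)"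
  using idem_mult_comp[OF hom_part_mult_arc[OF comp_hom_part], of x n i c i]
  by (simp add: path_alg_mult_assoc[symmetric] idem_mult_id)

lemma ideal_comp_mult_arc:
  "x \<in> ideal_comp n i (head G c) \<Longrightarrow> c \<in> arcs G \<Longrightarrow> x \<cdot> arc_elem c \<in> ideal_comp (Suc n) i (tail G c)"
  unfolding ideal_comp_def using comp_mult_arc rel_ideal_right arc_elem_kG by blast

lemma strip_comp:
  assumes "x \<in> path_comp (Suc n) i j" "c \<in> arcs G"
  shows "strip c x \<in> path_comp n i (head G c)"
  unfolding path_comp_def supported_iff
proof (intro allI impI)
  fix t assume t: "t \<notin> {(u, p, v) \<in> paths G. u = head G c \<and> v = i \<and> length p = n}"
  obtain u p v where [simp]: "t = (u, p, v)" by (cases t)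
  show "Poly_Mapping.lookup (strip c x) t = 0"
    using assms t unfolding path_comp_def supported_iff by (auto simp: lookup_strip awalk_Cons_iff)
qed

lemma comp_strip_expansion:
  assumes "x \<in> path_comp (Suc n) i j"
  shows "x = (\<Sum>c\<in>{c \<in> arcs G. tail G c = j}. strip c x \<cdot> arc_elem c)"
proof -
  have "x \<in> supported {(u, p, v) \<in> paths G. p \<noteq> []}"
    using assms unfolding path_comp_def by (rule subsetD[OF supported_mono, rotated]) auto
  then have "x = (\<Sum>c\<in>arcs G. strip c x \<cdot> arc_elem c)"
    by (rule strip_expansion)
  also have "\<dots> = (\<Sum>c\<in>{c \<in> arcs G. tail G c = j}. strip c x \<cdot> arc_elem c)"
  proof (intro sum.mono_neutral_right ballI)
    fix c assume c: "c \<in> arcs G - {c \<in> arcs G. tail G c = j}"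
    have "strip c x = 0"
    proof (rule path_pm_eqI)
      fix u p v
      have "Poly_Mapping.lookup x (tail G c, c # p, v) = 0"
        using assms c by (auto simp: path_comp_def supported_iff)
      then show "Poly_Mapping.lookup (strip c x) (u, p, v) = Poly_Mapping.lookup 0 (u, p, v)"
        by (simp add: lookup_strip)
    qed
    then show "strip c x \<cdot> arc_elem c = 0" by (simp add: path_alg_mult_left)
  qed auto
  finally show ?thesis .
qed

text \<open>These sums are direct because a path has a unique first arc.\<close>

definition arc_sum :: "'b set \<Rightarrow> ('b \<Rightarrow> (('v, 'b) path \<Rightarrow>\<^sub>0 'k) set) \<Rightarrow> (('v, 'b) path \<Rightarrow>\<^sub>0 'k) set" where
  "arc_sum C S = {\<Sum>c\<in>C. y c \<cdot> arc_elem c | y. \<forall>c\<in>C. y c \<in> S c}"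

lemma arc_sumI: "x = (\<Sum>c\<in>C. y c \<cdot> arc_elem c) \<Longrightarrow> \<forall>c\<in>C. y c \<in> S c \<Longrightarrow> x \<in> arc_sum C S"
  by (auto simp: arc_sum_def)

lemma arc_sum_subspace:
  assumes "\<And>c. c \<in> C \<Longrightarrow> pm.subspace (S c)"
  shows "pm.subspace (arc_sum C S)"
  unfolding pm.subspace_def
proof (intro conjI ballI allI)
  show "0 \<in> arc_sum C S"
    unfolding arc_sum_def
    by (intro CollectI exI[of _ "\<lambda>_. 0"]) (auto simp: path_alg_mult_left intro: pm.subspace_0 assms)
  fix x assume "x \<in> arc_sum C S"
  then obtain y where y: "x = (\<Sum>c\<in>C. y c \<cdot> arc_elem c)" "\<forall>c\<in>C. y c \<in> S c" by (auto simp: arc_sum_def)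
  show "smul a x \<in> arc_sum C S" for a
    unfolding arc_sum_def
    by (intro CollectI exI[of _ "\<lambda>c. smul a (y c)"])
      (auto simp: y path_alg_mult_left pm.scale_sum_right intro!: pm.subspace_scale assms)
  fix x' assume "x' \<in> arc_sum C S"
  then obtain y' where y': "x' = (\<Sum>c\<in>C. y' c \<cdot> arc_elem c)" "\<forall>c\<in>C. y' c \<in> S c" by (auto simp: arc_sum_def)
  show "x + x' \<in> arc_sum C S"
    unfolding arc_sum_def
    by (intro CollectI exI[of _ "\<lambda>c. y c + y' c"])
      (auto simp: y y' path_alg_mult_left sum.distrib intro!: pm.subspace_add assms)
qed

lemma dim_arc_sum:
  assumes "finite C" "C \<subseteq> arcs G" "\<And>c. c \<in> C \<Longrightarrow> pm.subspace (S c)" "\<And>c. c \<in> C \<Longrightarrow> S c \<subseteq> path_comp n i (head G c)"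
    and "\<And>c. c \<in> C \<Longrightarrow> tail G c = j"
  shows "pm.dim (arc_sum C S) = (\<Sum>c\<in>C. pm.dim (S c)) \<and> arc_sum C S \<subseteq> path_comp (Suc n) i j"
  using assms
proof (induction C rule: finite_induct)
  case empty
  have "arc_sum {} S = {0}" by (auto simp: arc_sum_def)
  moreover have "pm.dim {0 :: ('v, 'b) path \<Rightarrow>\<^sub>0 'k} = 0"
    using pm.dim_le_card[of "{0}" "{}"] by simp
  ultimately show ?case by (simp add: pm.subspace_0)
next
  case (insert c C)
  have IH: "pm.dim (arc_sum C S) = (\<Sum>c\<in>C. pm.dim (S c))" "arc_sum C S \<subseteq> path_comp (Suc n) i j"
    using insert by auto
  let ?T = "(\<lambda>x. x \<cdot> arc_elem c) ` S c"
  have c: "c \<in> arcs G" "tail G c = j" "pm.subspace (S c)" "S c \<subseteq> path_comp n i (head G c)"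
    using insert.prems by auto
  have sub: "pm.subspace (arc_sum C S)"
    using insert.prems by (intro arc_sum_subspace) auto
  have subT: "pm.subspace ?T"
    by (rule pmp.linear_subspace_image[OF path_alg_mult_linear_left c(3)])
  have strip: "strip c (x \<cdot> arc_elem c) = x" if "x \<in> S c" for x
    using starting_restrict[OF hom_part_starting[OF comp_hom_part[OF subsetD[OF c(4) that]]]]
    by (simp add: strip_mult_arc)
  have T: "?T \<subseteq> path_comp (Suc n) i j" using c comp_mult_arc by auto
  have sum: "arc_sum (insert c C) S = {x + y | x y. x \<in> ?T \<and> y \<in> arc_sum C S}"
  proof (intro equalityI subsetI)
    fix x assume "x \<in> arc_sum (insert c C) S"
    then obtain y where y: "x = y c \<cdot> arc_elem c + (\<Sum>c\<in>C. y c \<cdot> arc_elem c)" "\<forall>d\<in>insert c C. y d \<in> S d"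
      using insert.hyps by (auto simp: arc_sum_def)
    then show "x \<in> {x + y | x y. x \<in> ?T \<and> y \<in> arc_sum C S}"
      unfolding arc_sum_def by blast
  next
    fix x assume "x \<in> {x + y | x y. x \<in> ?T \<and> y \<in> arc_sum C S}"
    then obtain z y where zy: "z \<in> S c" "\<forall>d\<in>C. y d \<in> S d" "x = z \<cdot> arc_elem c + (\<Sum>c\<in>C. y c \<cdot> arc_elem c)"
      by (auto simp: arc_sum_def)
    have "(\<Sum>d\<in>C. (y(c := z)) d \<cdot> arc_elem d) = (\<Sum>c\<in>C. y c \<cdot> arc_elem c)"
      using insert.hyps by (intro sum.cong) auto
    with zy insert.hyps show "x \<in> arc_sum (insert c C) S"
      unfolding arc_sum_def by (intro CollectI exI[of _ "y(c := z)"]) auto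
  qed
  \<comment> \<open>Stripping \<open>c\<close> recovers \<open>z\<close> from \<open>z c\<close> but
    kills every summand that belongs to another arc.\<close>
  have "?T \<inter> arc_sum C S \<subseteq> {0}"
  proof
    fix x assume x: "x \<in> ?T \<inter> arc_sum C S"
    then obtain z where z: "x = z \<cdot> arc_elem c" "z \<in> S c" by blast
    from x obtain y where y: "x = (\<Sum>c\<in>C. y c \<cdot> arc_elem c)" by (auto simp: arc_sum_def)
    have "strip c x = (\<Sum>d\<in>C. 0)"
      unfolding y strip_simps using insert.hyps by (intro sum.cong) (auto simp: strip_mult_arc)
    with strip[OF z(2)] z(1) have "z = 0" by simp
    with z(1) show "x \<in> {0}" by (simp add: path_alg_mult_left)
  qed
  moreover obtain F where "finite F" "path_comp (Suc n) i j \<subseteq> pm.span F"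
    using comp_finite_span[of "Suc n"] by blast
  ultimately have "pm.dim (arc_sum (insert c C) S) = pm.dim ?T + pm.dim (arc_sum C S)"
    unfolding sum using T IH(2) by (intro pm.dim_direct_sum[OF subT sub, of F]) auto
  moreover have "pm.dim ?T = pm.dim (S c)"
    by (rule pmp.dim_linear_image_inj[OF path_alg_mult_linear_left c(3)])
      (use strip in \<open>auto intro: inj_on_inverseI\<close>)
  moreover have "arc_sum (insert c C) S \<subseteq> path_comp (Suc n) i j"
    unfolding sum using T IH(2) by (auto intro!: pm.subspace_add[OF path_comp_subspace])
  ultimately show ?case
    using IH(1) insert.hyps by simp
qed

lemma path_comp_Suc: "path_comp (Suc n) i j = arc_sum {c \<in> arcs G. tail G c = j} (\<lambda>c. path_comp n i (head G c))"
  and dim_path_comp_Suc: "pm.dim (path_comp (Suc n) i j) =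
    (\<Sum>c\<in>{c \<in> arcs G. tail G c = j}. pm.dim (path_comp n i (head G c)))"
proof -
  let ?C = "{c \<in> arcs G. tail G c = j}" and ?S = "\<lambda>c. path_comp n i (head G c)"
  have dim: "pm.dim (arc_sum ?C ?S) = (\<Sum>c\<in>?C. pm.dim (?S c)) \<and> arc_sum ?C ?S \<subseteq> path_comp (Suc n) i j"
    by (rule dim_arc_sum) auto
  have "x \<in> arc_sum ?C ?S" if "x \<in> path_comp (Suc n) i j" for x
  proof -
    have "\<forall>c\<in>?C. strip c x \<in> ?S c" using strip_comp[OF that] by blast
    with comp_strip_expansion[OF that] show ?thesis by (rule arc_sumI[where y = "\<lambda>c. strip c x"])
  qed
  with dim show eq: "path_comp (Suc n) i j = arc_sum ?C ?S" by blast
  show "pm.dim (path_comp (Suc n) i j) = (\<Sum>c\<in>?C. pm.dim (?S c))"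
    unfolding eq using dim by blast
qed

lemma mult_rel_strip:
  assumes "w \<in> starting j"
  shows "w \<cdot> rel_at j [] j [] j =
    (\<Sum>c\<in>{c \<in> arcs G. tail G c = j}. smul (\<eta> (star c)) (w \<cdot> arc_elem (star c)) \<cdot> arc_elem c)"
  unfolding mult_rel_at_expand[OF assms, symmetric]
  by (rule sum.reindex_bij_witness[of _ star star]) (auto simp: path_alg_mult_left)

lemma mult_rel_comp:
  assumes "w \<in> path_comp n i j"
  shows "w \<cdot> rel_at j [] j [] j \<in> path_comp (Suc (Suc n)) i j"
proof -
  have "smul (\<eta> (star c)) (w \<cdot> arc_elem (star c)) \<cdot> arc_elem c \<in> path_comp (Suc (Suc n)) i j"
    if "c \<in> arcs G" "tail G c = j" for c
    using comp_mult_arc[of "smul (\<eta> (star c)) (w \<cdot> arc_elem (star c))" "Suc n" i c]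
      comp_mult_arc[of w n i "star c"] that assms
    by (auto intro: pm.subspace_scale[OF path_comp_subspace])
  then show ?thesis
    unfolding mult_rel_strip[OF hom_part_starting[OF comp_hom_part[OF assms]]]
    by (intro pm.subspace_sum path_comp_subspace) auto
qed

text \<open>Exactness in the middle inside one component. Multiplication by \<open>idem i\<close>
  from the left makes \<open>g\<close> end at \<open>i\<close> and leaves the stripped elements
  unchanged, since they end there already.\<close>

lemma ideal_comp_decompose:
  assumes x: "x \<in> ideal_comp (Suc n) i j"
  shows "\<exists>g. (case n of 0 \<Rightarrow> g = 0 | Suc m \<Rightarrow> g \<in> path_comp m i j) \<and> (j \<in> J \<longrightarrow> g = 0) \<and>
    (\<forall>c\<in>arcs G. tail G c = j \<longrightarrow> strip c x - smul (\<eta> (star c)) (g \<cdot> arc_elem (star c)) \<in> ideal_comp n i (head G c))"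
proof -
  have x': "x \<in> path_comp (Suc n) i j" "x \<in> rel_ideal" using x by (auto simp: ideal_comp_def)
  have "(\<Sum>c\<in>{c \<in> arcs G. tail G c = j}. strip c x \<cdot> arc_elem c) \<in> rel_ideal"
    using comp_strip_expansion[OF x'(1)] x'(2) by simp
  moreover have str: "strip c x \<in> path_comp n i (head G c)" if "c \<in> arcs G" "tail G c = j" for c
    using strip_comp[OF x'(1) that(1)] .
  ultimately obtain g where g: "case n of 0 \<Rightarrow> g = 0 | Suc m \<Rightarrow> g \<in> hom_part m j" "j \<in> J \<longrightarrow> g = 0"
    "\<forall>c\<in>arcs G. tail G c = j \<longrightarrow> strip c x - smul (\<eta> (star c)) (g \<cdot> arc_elem (star c)) \<in> rel_ideal"
    using exact_middle_deg[of j "\<lambda>c. strip c x" n] comp_hom_part by blast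
  let ?g = "idem i \<cdot> g"
  have deg: "case n of 0 \<Rightarrow> ?g = 0 | Suc m \<Rightarrow> ?g \<in> path_comp m i j"
    using g(1) by (auto simp: path_alg_mult_right idem_mult_comp split: nat.splits)
  have "strip c x - smul (\<eta> (star c)) (?g \<cdot> arc_elem (star c)) \<in> ideal_comp n i (head G c)"
    if c: "c \<in> arcs G" "tail G c = j" for c
  proof -
    have "idem i \<cdot> (strip c x - smul (\<eta> (star c)) (g \<cdot> arc_elem (star c))) \<in> rel_ideal"
    proof (cases "i \<in> verts G")
      case True
      with g(3) c show ?thesis by (intro rel_ideal_left) (auto simp: awalk_Nil_iff)
    next
      case False
      have "idem i \<cdot> y = 0" if "y \<in> kG" for y
        using that False unfolding idem_mult by (intro restrict_pm_eq_0) auto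
      then show ?thesis using rel_ideal_supported g(3) c by (auto simp: rel_ideal_closed)
    qed
    then have "strip c x - smul (\<eta> (star c)) (?g \<cdot> arc_elem (star c)) \<in> rel_ideal"
      by (simp add: path_alg_mult_right idem_mult_id[OF str[OF c]] path_alg_mult_assoc)
    moreover have "?g \<cdot> arc_elem (star c) \<in> path_comp n i (head G c)"
    proof (cases n)
      case 0
      then show ?thesis using deg by (simp add: path_alg_mult_left pm.subspace_0)
    next
      case (Suc m)
      then show ?thesis using deg comp_mult_arc[of ?g m i "star c"] c by simp
    qed
    ultimately show ?thesis
      unfolding ideal_comp_def using str[OF c] by (auto intro: pm.subspace_diff[OF path_comp_subspace] pm.subspace_scale[OF path_comp_subspace])
  qed
  with deg g(2) show ?thesis by (intro exI[of _ ?g]) (auto simp: path_alg_mult_right)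
qed

abbreviation ideal_arc_sum :: "nat \<Rightarrow> 'v \<Rightarrow> 'v \<Rightarrow> (('v, 'b) path \<Rightarrow>\<^sub>0 'k) set" where
  "ideal_arc_sum n i j \<equiv> arc_sum {c \<in> arcs G. tail G c = j} (\<lambda>c. ideal_comp n i (head G c))"

lemma dim_ideal_arc_sum:
  "pm.dim (ideal_arc_sum n i j) = (\<Sum>c\<in>{c \<in> arcs G. tail G c = j}. pm.dim (ideal_comp n i (head G c)))"
  "ideal_arc_sum n i j \<subseteq> path_comp (Suc n) i j"
proof -
  have "pm.dim (ideal_arc_sum n i j) = (\<Sum>c\<in>{c \<in> arcs G. tail G c = j}. pm.dim (ideal_comp n i (head G c))) \<and>
      ideal_arc_sum n i j \<subseteq> path_comp (Suc n) i j"
    by (rule dim_arc_sum, simp, blast, simp, simp add: ideal_comp_def, simp)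
  then show "pm.dim (ideal_arc_sum n i j) = (\<Sum>c\<in>{c \<in> arcs G. tail G c = j}. pm.dim (ideal_comp n i (head G c)))"
    and "ideal_arc_sum n i j \<subseteq> path_comp (Suc n) i j"
    by (rule conjunct1, rule conjunct2)
qed

lemma ideal_arc_sum_subset: "ideal_arc_sum n i j \<subseteq> ideal_comp (Suc n) i j"
proof
  fix x assume "x \<in> ideal_arc_sum n i j"
  then obtain y where y: "x = (\<Sum>c\<in>{c \<in> arcs G. tail G c = j}. y c \<cdot> arc_elem c)"
    "\<And>c. c \<in> arcs G \<Longrightarrow> tail G c = j \<Longrightarrow> y c \<in> ideal_comp n i (head G c)"
    by (auto simp: arc_sum_def)
  show "x \<in> ideal_comp (Suc n) i j"
    unfolding y(1)
  proof (intro pm.subspace_sum ideal_comp_subspace)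
    fix c assume "c \<in> {c \<in> arcs G. tail G c = j}"
    then show "y c \<cdot> arc_elem c \<in> ideal_comp (Suc n) i j"
      using ideal_comp_mult_arc[OF y(2)] by auto
  qed
qed

text \<open>A relation can open a path from \<open>j\<close> only if \<open>j\<close> lies outside
  \<open>J\<close> and the path has length at least two. Otherwise the ideal in this degree comes
  from the previous degree by right multiplication.\<close>

lemma ideal_comp_no_relation:
  assumes "n = 0 \<or> j \<in> J"
  shows "ideal_comp (Suc n) i j = ideal_arc_sum n i j"
proof (intro equalityI ideal_arc_sum_subset subsetI)
  fix x assume x: "x \<in> ideal_comp (Suc n) i j"
  then have "x \<in> path_comp (Suc n) i j" by (simp add: ideal_comp_def)
  then have eq: "x = (\<Sum>c\<in>{c \<in> arcs G. tail G c = j}. strip c x \<cdot> arc_elem c)"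
    by (rule comp_strip_expansion)
  obtain g where g: "case n of 0 \<Rightarrow> g = 0 | Suc m \<Rightarrow> g \<in> path_comp m i j" "j \<in> J \<longrightarrow> g = 0"
    "\<forall>c\<in>arcs G. tail G c = j \<longrightarrow> strip c x - smul (\<eta> (star c)) (g \<cdot> arc_elem (star c)) \<in> ideal_comp n i (head G c)"
    using ideal_comp_decompose[OF x] by blast
  have "g = 0" using assms g(1,2) by (cases n) auto
  with g(3) have "\<forall>c\<in>{c \<in> arcs G. tail G c = j}. strip c x \<in> ideal_comp n i (head G c)"
    by (simp add: path_alg_mult_left)
  with eq show "x \<in> ideal_arc_sum n i j"
    by (rule arc_sumI[where y = "\<lambda>c. strip c x"])
qed

text \<open>Here the multiples of the relation are added. Factors from a complement \<open>W\<close>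
  of the ideal suffice, because a multiple with a factor in the ideal already lies in the first
  summand.\<close>

lemma ideal_comp_relation:
  assumes "j \<in> verts G" "j \<notin> J" "W \<subseteq> path_comp n i j" "\<And>g. g \<in> path_comp n i j \<Longrightarrow> \<exists>s\<in>ideal_comp n i j. \<exists>w\<in>W. g = s + w"
  shows "ideal_comp (Suc (Suc n)) i j =
    {x + y | x y. x \<in> ideal_arc_sum (Suc n) i j \<and> y \<in> (\<lambda>w. w \<cdot> rel_at j [] j [] j) ` W}" (is "_ = ?R")
proof (intro equalityI subsetI)
  fix x assume x: "x \<in> ideal_comp (Suc (Suc n)) i j"
  obtain g where g: "g \<in> path_comp n i j"
    "\<forall>c\<in>arcs G. tail G c = j \<longrightarrow> strip c x - smul (\<eta> (star c)) (g \<cdot> arc_elem (star c)) \<in> ideal_comp (Suc n) i (head G c)"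
    using ideal_comp_decompose[OF x] by auto
  obtain s w where sw: "s \<in> ideal_comp n i j" "w \<in> W" "g = s + w" using assms(4)[OF g(1)] by blast
  \<comment> \<open>The part \<open>s\<close> of \<open>g\<close> that lies in the ideal is absorbed
    into the coefficients of the arcs; only \<open>w\<close> stays in front of the relation.\<close>
  let ?y = "\<lambda>c. strip c x - smul (\<eta> (star c)) (w \<cdot> arc_elem (star c))"
  have y: "?y c \<in> ideal_comp (Suc n) i (head G c)" if c: "c \<in> arcs G" "tail G c = j" for c
  proof -
    have "smul (\<eta> (star c)) (s \<cdot> arc_elem (star c)) \<in> ideal_comp (Suc n) i (head G c)"
      using ideal_comp_mult_arc[of s n i "star c"] sw(1) c by (intro pm.subspace_scale) auto
    from pm.subspace_add[OF ideal_comp_subspace g(2)[rule_format, OF c] this] show ?thesis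
      by (simp add: sw(3) path_alg_mult_left pm.scale_right_distrib)
  qed
  have "w \<in> starting j" using sw(2) assms(3) comp_hom_part hom_part_starting by blast
  moreover have "x \<in> path_comp (Suc (Suc n)) i j" using x by (simp add: ideal_comp_def)
  ultimately have "x = (\<Sum>c\<in>{c \<in> arcs G. tail G c = j}. ?y c \<cdot> arc_elem c) + w \<cdot> rel_at j [] j [] j"
    using comp_strip_expansion[of x "Suc n" i j]
    by (simp add: mult_rel_strip path_alg_mult_left sum_subtractf)
  moreover have "(\<Sum>c\<in>{c \<in> arcs G. tail G c = j}. ?y c \<cdot> arc_elem c) \<in> ideal_arc_sum (Suc n) i j"
    by (rule arc_sumI[OF refl]) (use y in blast)
  ultimately show "x \<in> ?R" using sw(2) by blast
next
  fix x assume "x \<in> ?R"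
  then obtain y w where yw: "x = y + w \<cdot> rel_at j [] j [] j" "y \<in> ideal_arc_sum (Suc n) i j" "w \<in> W" by blast
  then have "w \<in> path_comp n i j" using assms(3) by auto
  then have "w \<cdot> rel_at j [] j [] j \<in> ideal_comp (Suc (Suc n)) i j"
    unfolding ideal_comp_def using assms(1,2) mult_rel_comp
    by (auto intro!: rel_ideal_left rel_at_in_ideal intro: starting_kG hom_part_starting comp_hom_part simp: awalk_Nil_iff)
  with yw ideal_arc_sum_subset show "x \<in> ideal_comp (Suc (Suc n)) i j"
    by (auto intro!: pm.subspace_add[OF ideal_comp_subspace])
qed

text \<open>The dimension of \<open>e_i \<Pi>_n e_j\<close>, as \<open>hilbert_series_B\<close>
  confirms. It is computed in the path algebra, and as an integer because the recursion
  subtracts.\<close>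

definition quot_dim :: "nat \<Rightarrow> 'v \<Rightarrow> 'v \<Rightarrow> int" where
  "quot_dim n i j = int (pm.dim (path_comp n i j)) - int (pm.dim (ideal_comp n i j))"

lemma comp_complement:
  "\<exists>B. B \<subseteq> path_comp n i j \<and> pm.independent B \<and> finite B \<and> pm.span B \<inter> ideal_comp n i j = {0} \<and>
    (\<forall>x\<in>path_comp n i j. \<exists>s\<in>ideal_comp n i j. \<exists>b\<in>pm.span B. x = s + b) \<and> int (card B) = quot_dim n i j"
proof -
  obtain F where F: "finite F" "path_comp n i j \<subseteq> pm.span F" using comp_finite_span[of n] by blast
  have "ideal_comp n i j \<subseteq> path_comp n i j" by (simp add: ideal_comp_def)
  from pm.complement_exists[OF ideal_comp_subspace this path_comp_subspace F(2,1)]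
  obtain B where B: "B \<subseteq> path_comp n i j" "pm.independent B" "finite B" "pm.span B \<inter> ideal_comp n i j = {0}"
    "\<forall>x\<in>path_comp n i j. \<exists>s\<in>ideal_comp n i j. \<exists>b\<in>pm.span B. x = s + b"
    "card B + pm.dim (ideal_comp n i j) = pm.dim (path_comp n i j)"
    by (elim exE conjE)
  have "int (card B) = quot_dim n i j"
    using B(6) unfolding quot_dim_def by linarith
  with B(1-5) show ?thesis by (intro exI[of _ B] conjI)
qed

lemma quot_dim_no_relation:
  assumes "n = 0 \<or> j \<in> J"
  shows "quot_dim (Suc n) i j = (\<Sum>c\<in>{c \<in> arcs G. tail G c = j}. quot_dim n i (head G c))"
  unfolding quot_dim_def ideal_comp_no_relation[OF assms]
  by (simp add: dim_path_comp_Suc dim_ideal_arc_sum sum_subtractf)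

text \<open>Dimensions are counted in \<open>ideal_comp_relation\<close>. Sums and images of
  subspaces can only be smaller than expected, which gives the inequality. If nothing outside the
  ideal is killed by all arcs, the sum is direct and multiplication by the relation is injective on
  the complement.\<close>

lemma quot_dim_relation:
  assumes j: "j \<in> verts G" "j \<notin> J"
  shows "quot_dim (Suc (Suc n)) i j \<ge>
      (\<Sum>c\<in>{c \<in> arcs G. tail G c = j}. quot_dim (Suc n) i (head G c)) - quot_dim n i j"
    and "socle_free \<Longrightarrow> quot_dim (Suc (Suc n)) i j =
      (\<Sum>c\<in>{c \<in> arcs G. tail G c = j}. quot_dim (Suc n) i (head G c)) - quot_dim n i j"
proof -
  obtain B where B: "B \<subseteq> path_comp n i j" "pm.independent B" "finite B" "pm.span B \<inter> ideal_comp n i j = {0}"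
    "\<forall>x\<in>path_comp n i j. \<exists>s\<in>ideal_comp n i j. \<exists>b\<in>pm.span B. x = s + b" "int (card B) = quot_dim n i j"
    using comp_complement[of n i j] by (elim exE conjE)
  define W where "W = pm.span B"
  have W: "pm.subspace W" "W \<subseteq> path_comp n i j" "int (pm.dim W) = quot_dim n i j"
    unfolding W_def using B pm.span_minimal[OF B(1) path_comp_subspace]
    by (auto simp: pm.dim_eq_card_independent)
  let ?f = "\<lambda>w. w \<cdot> rel_at j [] j [] j" and ?S = "ideal_arc_sum (Suc n) i j"
  have eq: "ideal_comp (Suc (Suc n)) i j = {x + y | x y. x \<in> ?S \<and> y \<in> ?f ` W}"
    by (rule ideal_comp_relation[OF j W(2)]) (use B(5) in \<open>auto simp: W_def\<close>)
  obtain F where F: "finite F" "path_comp (Suc (Suc n)) i j \<subseteq> pm.span F" using comp_finite_span[of "Suc (Suc n)"] by blast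
  have S: "pm.subspace ?S" by (rule arc_sum_subspace) auto
  have fW: "pm.subspace (?f ` W)" by (rule pmp.linear_subspace_image[OF path_alg_mult_linear_left W(1)])
  have fW_sub: "?f ` W \<subseteq> path_comp (Suc (Suc n)) i j" using mult_rel_comp W(2) by auto
  have le: "pm.dim (ideal_comp (Suc (Suc n)) i j) \<le> pm.dim ?S + pm.dim (?f ` W)"
    unfolding eq by (rule pm.dim_sum_le[OF S fW _ _ F(1)]) (use F fW_sub dim_ideal_arc_sum(2)[where n = "Suc n" and i = i and j = j] in auto)
  have "pm.dim (?f ` W) \<le> pm.dim W"
    by (rule pmp.dim_linear_image_le[OF path_alg_mult_linear_left W(1) _ B(3)]) (simp add: W_def)
  with le W(3) have "int (pm.dim (ideal_comp (Suc (Suc n)) i j)) \<le> int (pm.dim ?S) + quot_dim n i j"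
    by linarith
  then show "quot_dim (Suc (Suc n)) i j \<ge>
      (\<Sum>c\<in>{c \<in> arcs G. tail G c = j}. quot_dim (Suc n) i (head G c)) - quot_dim n i j"
    unfolding dim_ideal_arc_sum(1) quot_dim_def[where n = "Suc n"] quot_dim_def[where n = "Suc (Suc n)"] dim_path_comp_Suc[where n = "Suc n"]
    by (simp add: sum_subtractf)
  assume socle_free
  \<comment> \<open>Stripping the reversed arcs from \<open>w\<close> times the relation shows that
    \<open>w a\<close> lies in the ideal for every arc \<open>a\<close> into \<open>j\<close>. Hence
    so does \<open>w\<close>, which belongs to a complement of the ideal.\<close>
  have key: "w = 0" if w: "w \<in> W" "?f w \<in> ?S" for w
  proof -
    have st: "w \<in> starting j" using w W(2) comp_hom_part hom_part_starting by blast
    obtain y where y: "?f w = (\<Sum>c\<in>{c \<in> arcs G. tail G c = j}. y c \<cdot> arc_elem c)"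
      "\<forall>c\<in>{c \<in> arcs G. tail G c = j}. y c \<in> ideal_comp (Suc n) i (head G c)"
      using w(2) by (auto simp: arc_sum_def)
    have expand: "strip b (\<Sum>c\<in>{c \<in> arcs G. tail G c = j}. z c \<cdot> arc_elem c) = z b"
      if "b \<in> arcs G" "tail G b = j" "z b \<in> path_comp (Suc n) i (head G b)" for b z
    proof -
      have "strip b (\<Sum>c\<in>{c \<in> arcs G. tail G c = j}. z c \<cdot> arc_elem c) =
          (\<Sum>c\<in>{c \<in> arcs G. tail G c = j}. if b = c then z b else 0)"
        unfolding strip_simps using starting_restrict[OF hom_part_starting[OF comp_hom_part[OF that(3)]]]
        by (intro sum.cong) (auto simp: strip_mult_arc)
      with that show ?thesis by simp
    qed
    have "w \<cdot> arc_elem a \<in> rel_ideal" if a: "a \<in> arcs G" "head G a = j" for a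
    proof -
      let ?b = "star a"
      have b: "?b \<in> arcs G" "tail G ?b = j" using a by auto
      have "strip ?b (?f w) = smul (\<eta> (star ?b)) (w \<cdot> arc_elem (star ?b))"
        unfolding mult_rel_strip[OF st]
        by (rule expand[OF b]) (use comp_mult_arc[of w n i a] w(1) W(2) a in \<open>auto intro: pm.subspace_scale[OF path_comp_subspace]\<close>)
      moreover have "strip ?b (?f w) = y ?b"
        unfolding y(1) by (rule expand[OF b]) (use y(2) b in \<open>auto simp: ideal_comp_def\<close>)
      ultimately have "y ?b = smul (\<eta> a) (w \<cdot> arc_elem a)"
        using a by simp
      moreover have "y ?b \<in> rel_ideal"
        using y(2) b unfolding ideal_comp_def by blast
      ultimately have "smul (\<eta> a) (w \<cdot> arc_elem a) \<in> rel_ideal" by simp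
      then show ?thesis using scale_in_ideal_iff eta_nonzero[OF a(1)] a(2) j(2) by blast
    qed
    then have "w \<in> rel_ideal"
      using \<open>socle_free\<close> st j unfolding socle_free_def by blast
    with w(1) W(2) B(4) show ?thesis by (auto simp: W_def ideal_comp_def)
  qed
  have "?S \<inter> ?f ` W \<subseteq> {0}"
  proof
    fix x assume "x \<in> ?S \<inter> ?f ` W"
    then obtain w where w: "w \<in> W" "x = ?f w" "?f w \<in> ?S" by blast
    then show "x \<in> {0}" using key[OF w(1,3)] by (simp add: path_alg_mult_left)
  qed
  then have "pm.dim (ideal_comp (Suc (Suc n)) i j) = pm.dim ?S + pm.dim (?f ` W)"
    unfolding eq by (intro pm.dim_direct_sum[OF S fW _ _ F(1)]) (use F fW_sub dim_ideal_arc_sum(2)[where n = "Suc n" and i = i and j = j] in auto)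
  moreover have "inj_on ?f W"
    unfolding pmp.linear_inj_on_iff_eq_0[OF path_alg_mult_linear_left W(1)]
    using key pm.subspace_0[OF S] by auto
  then have "pm.dim (?f ` W) = pm.dim W"
    by (rule pmp.dim_linear_image_inj[OF path_alg_mult_linear_left W(1)])
  ultimately have "int (pm.dim (ideal_comp (Suc (Suc n)) i j)) = int (pm.dim ?S) + quot_dim n i j"
    using W(3) by simp
  then show "quot_dim (Suc (Suc n)) i j =
      (\<Sum>c\<in>{c \<in> arcs G. tail G c = j}. quot_dim (Suc n) i (head G c)) - quot_dim n i j"
    unfolding dim_ideal_arc_sum(1) quot_dim_def[where n = "Suc n"] quot_dim_def[where n = "Suc (Suc n)"] dim_path_comp_Suc[where n = "Suc n"]
    by (simp add: sum_subtractf)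
qed

lemma quot_dim_0: 
  assumes "i \<in> verts G"
  shows "quot_dim 0 i j = (if i = j then 1 else 0)"
proof -
  have zero: "pm.dim {0 :: ('v, 'b) path \<Rightarrow>\<^sub>0 'k} = 0"
    using pm.dim_le_card[of "{0}" "{}"] by simp
  have "x = 0" if x: "x \<in> ideal_comp 0 i j" for x
  proof -
    have "deg_proj 0 y = 0" if "y \<in> rel_ideal" for y
      using that
    proof (induction rule: rel_ideal_induct)
      case subspace
      show ?case by (auto simp: pm.subspace_def pm_linearD[OF restrict_pm_linear])
    next
      case (rel u p j q v)
      show ?case
        by (rule path_pm_eqI) (auto simp: rel_at_def lookup_sum lookup_single)
    qed
    then show ?thesis
      using x deg_proj_hom_part[OF comp_hom_part, of x 0 i j] by (auto simp: ideal_comp_def)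
  qed
  then have ideal: "ideal_comp 0 i j = {0}"
    using pm.subspace_0[OF ideal_comp_subspace] by auto
  show ?thesis
  proof (cases "i = j")
    case True
    have "path_comp 0 i j = pm.span {Poly_Mapping.single (j, [], j) 1}"
    proof (intro equalityI subsetI)
      fix x assume x: "x \<in> path_comp 0 i j"
      have "Poly_Mapping.keys x \<subseteq> {(j, [], j)}"
        using x True unfolding path_comp_def supported_def by auto
      from pm_in_span[OF this] show "x \<in> pm.span {Poly_Mapping.single (j, [], j) 1}" by simp
    next
      fix x :: "('v, 'b) path \<Rightarrow>\<^sub>0 'k" assume "x \<in> pm.span {Poly_Mapping.single (j, [], j) 1}"
      moreover have "pm.span {Poly_Mapping.single (j, [], j) 1} \<subseteq> path_comp 0 i j"
        using True assms by (intro pm.span_minimal path_comp_subspace) (auto simp: path_comp_def awalk_Nil_iff)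
      ultimately show "x \<in> path_comp 0 i j" by blast
    qed
    moreover have "pm.independent {Poly_Mapping.single (j, [], j) (1 :: 'k) :: ('v, 'b) path \<Rightarrow>\<^sub>0 'k}"
      by (simp add: pm.dependent_single poly_mapping_eq_iff fun_eq_iff lookup_single when_def)
    ultimately show ?thesis
      using True ideal zero by (simp add: quot_dim_def pm.dim_eq_card_independent)
  next
    case False
    then have empty: "{(u, p, v) \<in> paths G. u = j \<and> v = i \<and> length p = 0} = {}"
      by (auto simp: awalk_Nil_iff)
    have "path_comp 0 i j = {0}"
      unfolding path_comp_def empty by (auto simp: supported_iff intro: poly_mapping_eqI)
    then show ?thesis using False by (simp add: quot_dim_def ideal zero)
  qed
qed

end

subsection \<open>The Koszul complex of a graded algebra\<close>

lemma projective_module_simps: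
  fixes A (structure)
  shows "carrier (projective_module A X s w) =
      {f. finite {x. f x \<noteq> \<zero>} \<and> (\<forall>x\<in>X. f x \<in> carrier A \<and> f x \<otimes> videm A (s x) = f x) \<and> (\<forall>x. x \<notin> X \<longrightarrow> f x = \<zero>)}"
    and "zero (projective_module A X s w) = (\<lambda>x. \<zero>)"
    and "add (projective_module A X s w) f g = (\<lambda>x. f x \<oplus>\<^bsub>A\<^esub> g x)"
    and "smult (projective_module A X s w) a f = (\<lambda>x. a \<otimes> f x)"
    and "mgr (projective_module A X s w) d =
      {f \<in> carrier (projective_module A X s w). \<forall>x\<in>X. if w x \<le> d then f x \<in> gr A (d - w x) else f x = \<zero>}"
  by (simp_all add: projective_module_def Let_def)

locale graded_algebra = ring A
  for A :: "('a, 'v) graded_ring" (structure) +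
  assumes finite_vertices: "finite (vertices A)"
    and videm_gr: "i \<in> vertices A \<Longrightarrow> videm A i \<in> gr A 0"
    and videm_mult: "i \<in> vertices A \<Longrightarrow> j \<in> vertices A \<Longrightarrow> videm A i \<otimes> videm A j = (if i = j then videm A i else \<zero>)"
    and videm_sum: "(\<Oplus>i\<in>vertices A. videm A i) = \<one>"
    and gr_subgroup: "additive_subgroup (gr A d) A"
    and gr_mult: "x \<in> gr A d \<Longrightarrow> y \<in> gr A e \<Longrightarrow> x \<otimes> y \<in> gr A (d + e)"
begin

lemma gr_carrier: "x \<in> gr A d \<Longrightarrow> x \<in> carrier A"
  using additive_subgroup.a_Hcarr[OF gr_subgroup] .

lemma gr_zero: "\<zero> \<in> gr A d"
  by (rule additive_subgroup.zero_closed[OF gr_subgroup])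

lemma videm_carrier [simp, intro]: "i \<in> vertices A \<Longrightarrow> videm A i \<in> carrier A"
  using gr_carrier videm_gr by blast

lemma gr_finsum: "finite C \<Longrightarrow> (\<And>c. c \<in> C \<Longrightarrow> f c \<in> gr A d) \<Longrightarrow> (\<Oplus>c\<in>C. f c) \<in> gr A d"
proof (induction C rule: finite_induct)
  case empty
  then show ?case by (simp add: gr_zero)
next
  case (insert c C)
  then have "(\<Oplus>c\<in>insert c C. f c) = f c \<oplus>\<^bsub>A\<^esub> (\<Oplus>c\<in>C. f c)"
    by (intro finsum_insert) (auto intro: gr_carrier)
  with insert show ?case
    using additive_subgroup.a_closed[OF gr_subgroup] by auto
qed

abbreviation L :: "'a set" where
  "L \<equiv> augmentation_ideal A"

lemma ideal_L: "ideal L A"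
  unfolding augmentation_ideal_def by (rule genideal_ideal) (auto intro: gr_carrier)

lemma gr_L: "0 < d \<Longrightarrow> gr A d \<subseteq> L"
proof -
  assume "0 < d"
  then have "gr A d \<subseteq> (\<Union>d\<in>{1..}. gr A d)" by (intro UN_upper) auto
  also have "\<dots> \<subseteq> L"
    unfolding augmentation_ideal_def by (rule genideal_self) (auto intro: gr_carrier)
  finally show ?thesis .
qed

abbreviation Res :: "('a, 'a set) graded_module" where
  "Res \<equiv> residue_module A"

lemma Res_simps:
  "carrier Res = (\<lambda>a. L +> a) ` carrier A" "zero Res = L"
  "add Res x y = x \<oplus>\<^bsub>A Quot L\<^esub> y"
  "smult Res a r = (L +> a) \<otimes>\<^bsub>A Quot L\<^esub> r"
  "mgr Res d = (\<lambda>a. L +> a) ` gr A d"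
  by (auto simp: residue_module_def Let_def ring.extend_def FactRing_def A_RCOSETS_def' a_r_coset_def')

lemma Quot_simps:
  "carrier (A Quot L) = (\<lambda>a. L +> a) ` carrier A" "zero (A Quot L) = L"
  "a \<in> carrier A \<Longrightarrow> b \<in> carrier A \<Longrightarrow> (L +> a) \<oplus>\<^bsub>A Quot L\<^esub> (L +> b) = L +> (a \<oplus>\<^bsub>A\<^esub> b)"
  "a \<in> carrier A \<Longrightarrow> b \<in> carrier A \<Longrightarrow> (L +> a) \<otimes>\<^bsub>A Quot L\<^esub> (L +> b) = L +> (a \<otimes> b)"
  using ideal.a_rcos_sum[OF ideal_L] ideal.rcoset_mult_add[OF ideal_L]
  by (auto simp: FactRing_def A_RCOSETS_def' a_r_coset_def')

lemma coset_L_iff: "a \<in> carrier A \<Longrightarrow> L +> a = L \<longleftrightarrow> a \<in> L"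
  using ideal.rcos_const_imp_mem[OF ideal_L]
  by (metis ideal_L ring.a_rcos_zero ring_axioms)

lemma mgr_Res_pos: "0 < d \<Longrightarrow> mgr Res d \<subseteq> {zero Res}"
  using gr_L[of d] coset_L_iff gr_carrier by (auto simp: Res_simps)

text \<open>\<open>R\<close> lives in degree zero, so the images of the generators lie in zero parts of \<open>R\<close>.\<close>

lemma graded_hom_Res_zero:
  assumes \<phi>: "\<phi> \<in> graded_hom A (projective_module A X s (\<lambda>_. w)) Res j" and "s ` X \<subseteq> vertices A"
    and "j \<noteq> int w" and f: "f \<in> carrier (projective_module A X s (\<lambda>_. w))"
  shows "\<phi> f = zero Res"
proof -
  let ?P = "projective_module A X s (\<lambda>_. w)"
  interpret Q: ring "A Quot L" by (rule ideal.quotient_is_ring[OF ideal_L])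
  have add: "\<phi> (x \<oplus>\<^bsub>?P\<^esub> y) = \<phi> x \<oplus>\<^bsub>Res\<^esub> \<phi> y" and smul: "\<phi> (a \<odot>\<^bsub>?P\<^esub> x) = a \<odot>\<^bsub>Res\<^esub> \<phi> x"
    and car: "\<phi> x \<in> carrier Res"
    if "x \<in> carrier ?P" "y \<in> carrier ?P" "a \<in> carrier A" for x y a
    using \<phi> that by (auto simp: graded_hom_def left_module_hom_def)
  have gen: "\<phi> ((\<lambda>_. \<zero>)(x := videm A (s x))) = zero Res" if x: "x \<in> X" for x
  proof -
    have "(\<lambda>_. \<zero>)(x := videm A (s x)) \<in> mgr ?P w"
      using assms(2) x by (auto simp: projective_module_simps videm_mult gr_zero videm_gr)
    then have "\<phi> ((\<lambda>_. \<zero>)(x := videm A (s x))) \<in> (if j \<le> int w then mgr Res (nat (int w - j)) else {zero Res})"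
      using \<phi> unfolding graded_hom_def by blast
    then show ?thesis
      using assms(3) mgr_Res_pos[of "nat (int w - j)"] by (auto split: if_splits)
  qed
  have zero_P: "(\<lambda>_. \<zero>) \<in> carrier ?P"
    using assms(2) by (auto simp: projective_module_simps)
  \<comment> \<open>Induction on the support: \<open>f\<close> is the sum of its other coordinates
    and of \<open>f x\<close> times the generator at \<open>x\<close>.\<close>
  have "\<phi> f = zero Res" if "finite F" "f \<in> carrier ?P" "{x. f x \<noteq> \<zero>} \<subseteq> F" for F f
    using that
  proof (induction F arbitrary: f rule: finite_induct)
    case empty
    then have "f = (\<lambda>_. \<zero>)" by auto
    then have "f \<oplus>\<^bsub>?P\<^esub> f = f" by (simp add: projective_module_simps)
    then have "\<phi> f \<oplus>\<^bsub>A Quot L\<^esub> \<phi> f = \<phi> f"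
      using add[of f f \<zero>] empty by (simp add: Res_simps)
    moreover have "\<phi> f \<in> carrier (A Quot L)"
      using car[of f f \<zero>] empty by (simp add: Res_simps Quot_simps)
    ultimately show ?case
      using Q.add.l_cancel_one by (auto simp: Res_simps Quot_simps)
  next
    case (insert x F)
    show ?case
    proof (cases "x \<in> X")
      case False
      then have "f x = \<zero>" using insert.prems(1) by (simp add: projective_module_simps)
      with insert show ?thesis by (intro insert.IH) auto
    next
      case True
      let ?g = "f(x := \<zero>)" and ?e = "(\<lambda>_. \<zero>)(x := videm A (s x))"
      have fx: "f x \<in> carrier A" "f x \<otimes> videm A (s x) = f x"
        using insert.prems(1) True by (auto simp: projective_module_simps)
      have sx: "s x \<in> vertices A" using assms(2) True by auto
      have f_car: "f y \<in> carrier A" for y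
        using insert.prems(1) by (cases "y \<in> X") (auto simp: projective_module_simps)
      have g: "?g \<in> carrier ?P"
        using insert.prems(1) assms(2) True
        by (auto simp: projective_module_simps elim!: finite_subset[rotated])
      have e: "?e \<in> carrier ?P"
        using assms(2) True by (auto simp: projective_module_simps videm_mult)
      have fe: "f x \<odot>\<^bsub>?P\<^esub> ?e \<in> carrier ?P"
        using True fx assms(2)
        by (auto simp: projective_module_simps videm_mult elim!: finite_subset[rotated])
      have split: "f = ?g \<oplus>\<^bsub>?P\<^esub> (f x \<odot>\<^bsub>?P\<^esub> ?e)"
        by (rule ext) (simp add: projective_module_simps(3,4) fx f_car)
      have "\<phi> f = \<phi> ?g \<oplus>\<^bsub>Res\<^esub> \<phi> (f x \<odot>\<^bsub>?P\<^esub> ?e)"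
        by (rule trans[OF arg_cong[OF split, of \<phi>] add[OF g fe fx(1)]])
      also have "\<dots> = \<phi> ?g \<oplus>\<^bsub>Res\<^esub> (f x \<odot>\<^bsub>Res\<^esub> \<phi> ?e)"
        unfolding smul[OF e e fx(1)] ..
      also have "\<dots> = zero Res"
      proof -
        have "\<phi> ?g = zero Res"
          by (rule insert.IH[OF g]) (use insert.prems(2) in auto)
        moreover have "L +> f x \<in> carrier (A Quot L)" using fx(1) by (simp add: Quot_simps(1))
        moreover have "zero Res = zero (A Quot L)" by (simp add: Res_simps Quot_simps(2))
        ultimately show ?thesis
          unfolding gen[OF True] Res_simps(3,4) by simp
      qed
      finally show ?thesis .
    qed
  qed
  from this[of "{x. f x \<noteq> \<zero>}" f] f show ?thesis by (auto simp: projective_module_simps)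
qed

end

text \<open>
  The arc \<open>c\<close> contributes \<open>A e(hd c)\<close> to the middle term of the complex; \<open>\<xi> c\<close> and \<open>\<rho> c\<close> are the
  components of the two differentials, which multiply from the right.
\<close>

locale koszul_complex = graded_algebra A
  for A :: "('a, 'v) graded_ring" (structure) +
  fixes E :: "'b set" and hd tl :: "'b \<Rightarrow> 'v" and \<xi> \<rho> :: "'b \<Rightarrow> 'a" and W :: "'v set"
  assumes finite_E: "finite E" and W: "W \<subseteq> vertices A"
    and ends: "c \<in> E \<Longrightarrow> hd c \<in> vertices A" "c \<in> E \<Longrightarrow> tl c \<in> vertices A"
    and \<xi>_gr: "c \<in> E \<Longrightarrow> \<xi> c \<in> gr A 1" and \<xi>_tl: "c \<in> E \<Longrightarrow> \<xi> c \<otimes> videm A (tl c) = \<xi> c"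
    and \<rho>_gr: "c \<in> E \<Longrightarrow> \<rho> c \<in> gr A 1" and \<rho>_hd: "c \<in> E \<Longrightarrow> \<rho> c \<otimes> videm A (hd c) = \<rho> c"
    and relation: "j \<in> W \<Longrightarrow> (\<Oplus>c\<in>{c \<in> E. tl c = j}. \<rho> c \<otimes> \<xi> c) = \<zero>"
    and exact_0: "j \<in> vertices A \<Longrightarrow> a \<in> augmentation_ideal A \<Longrightarrow> a \<otimes> videm A j = a \<Longrightarrow>
      \<exists>y. (\<forall>c\<in>E. y c \<in> carrier A \<and> y c \<otimes> videm A (hd c) = y c) \<and> a = (\<Oplus>c\<in>{c \<in> E. tl c = j}. y c \<otimes> \<xi> c)"
    and exact_1: "j \<in> vertices A \<Longrightarrow> (\<And>c. c \<in> E \<Longrightarrow> y c \<in> carrier A \<and> y c \<otimes> videm A (hd c) = y c) \<Longrightarrow>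
      (\<Oplus>c\<in>{c \<in> E. tl c = j}. y c \<otimes> \<xi> c) = \<zero> \<Longrightarrow>
      \<exists>g\<in>carrier A. g \<otimes> videm A j = g \<and> (j \<notin> W \<longrightarrow> g = \<zero>) \<and> (\<forall>c\<in>E. tl c = j \<longrightarrow> y c = g \<otimes> \<rho> c)"
    and exact_2: "j \<in> W \<Longrightarrow> g \<in> carrier A \<Longrightarrow> g \<otimes> videm A j = g \<Longrightarrow>
      (\<And>c. c \<in> E \<Longrightarrow> tl c = j \<Longrightarrow> g \<otimes> \<rho> c = \<zero>) \<Longrightarrow> g = \<zero>"
begin

lemma \<xi>_carrier [simp, intro]: "c \<in> E \<Longrightarrow> \<xi> c \<in> carrier A"
  and \<rho>_carrier [simp, intro]: "c \<in> E \<Longrightarrow> \<rho> c \<in> carrier A"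
  using \<xi>_gr \<rho>_gr gr_carrier by blast+

text \<open>The term \<open>P i\<close> is generated in degree \<open>i\<close>, and from
  \<open>i = 3\<close> on it is zero. Homomorphisms to \<open>R\<close> that lower the degree by
  some \<open>j \<noteq> i\<close> therefore vanish, so every off-diagonal cocycle is zero, and zero
  is a coboundary.\<close>

lemma koszul: "ext_diagonal A"
proof -
  define V where "V = vertices A"
  have finV: "finite V" unfolding V_def by (rule finite_vertices)
  \<comment> \<open>Projective modules are indexed by natural numbers: \<open>iv\<close> and
    \<open>ie\<close> number vertices and arcs, \<open>sv\<close> and \<open>se\<close> decode the
    numbers.\<close>
  obtain iv :: "'v \<Rightarrow> nat" where iv: "inj_on iv V"
    using finite_imp_inj_to_nat_seg[OF finV] by blast
  obtain ie :: "'b \<Rightarrow> nat" where ie: "inj_on ie E"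
    using finite_imp_inj_to_nat_seg[OF finite_E] by blast
  define sv where "sv = inv_into V iv"
  define se where "se = inv_into E ie"
  have sv [simp]: "sv (iv j) = j" if "j \<in> V" for j
    unfolding sv_def by (rule inv_into_f_f[OF iv that])
  have se [simp]: "se (ie c) = c" if "c \<in> E" for c
    unfolding se_def by (rule inv_into_f_f[OF ie that])
  have WV: "W \<subseteq> V" using W by (simp add: V_def)
  have svW [simp]: "sv (iv j) = j" if "j \<in> W" for j using that WV sv by blast
  have endsV: "hd c \<in> V" "tl c \<in> V" if "c \<in> E" for c using ends that by (auto simp: V_def)
  \<comment> \<open>The degree of the generators equals the position in the resolution. From
    position three on the index set is empty.\<close>
  define P where "P n = (case n of 0 \<Rightarrow> projective_module A (iv ` V) sv (\<lambda>_. n)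
    | Suc 0 \<Rightarrow> projective_module A (ie ` E) (hd \<circ> se) (\<lambda>_. n)
    | Suc (Suc 0) \<Rightarrow> projective_module A (iv ` W) sv (\<lambda>_. n)
    | _ \<Rightarrow> projective_module A {} sv (\<lambda>_. n))" for n
  have P0: "P 0 = projective_module A (iv ` V) sv (\<lambda>_. 0)"
    and P1: "P 1 = projective_module A (ie ` E) (hd \<circ> se) (\<lambda>_. 1)"
    and P2: "P 2 = projective_module A (iv ` W) sv (\<lambda>_. 2)"
    and Pn: "P (Suc (Suc (Suc n))) = projective_module A {} sv (\<lambda>_. Suc (Suc (Suc n)))" for n
    by (simp_all add: P_def numeral_2_eq_2)
  \<comment> \<open>The coordinates of \<open>f\<close> lie in different summands
    \<open>A e_j\<close> of \<open>A\<close>, so nothing is lost by adding them;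
    \<open>eps_comp\<close> recovers them.\<close>
  define \<epsilon> where "\<epsilon> f = L +> (\<Oplus>j\<in>V. f (iv j))" for f :: "nat \<Rightarrow> 'a"
  define d0 where "d0 f = (\<lambda>n. if n \<in> iv ` V then \<Oplus>c\<in>{c \<in> E. tl c = sv n}. f (ie c) \<otimes> \<xi> c else \<zero>)"
    for f :: "nat \<Rightarrow> 'a"
  define d1 where "d1 f = (\<lambda>n. if n \<in> ie ` E then f (iv (tl (se n))) \<otimes> \<rho> (se n) else \<zero>)"
    for f :: "nat \<Rightarrow> 'a"
  define \<delta> where "\<delta> n = (case n of 0 \<Rightarrow> d0 | Suc 0 \<Rightarrow> d1 | _ \<Rightarrow> (\<lambda>_ _. \<zero>))" for n
  have \<delta>: "\<delta> 0 = d0" "\<delta> 1 = d1" "\<delta> (Suc (Suc n)) = (\<lambda>_ _. \<zero>)" for n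
    by (simp_all add: \<delta>_def)

  have fin_ind: "finite {n. f n \<noteq> \<zero>}" if "\<And>n. n \<notin> X \<Longrightarrow> f n = \<zero>" "finite X" for f :: "nat \<Rightarrow> 'a" and X
    using that(2) by (rule finite_subset[rotated]) (use that(1) in auto)
  have C0: "f \<in> carrier (P 0) \<longleftrightarrow> (\<forall>j\<in>V. f (iv j) \<in> carrier A \<and> f (iv j) \<otimes> videm A j = f (iv j)) \<and>
      (\<forall>n. n \<notin> iv ` V \<longrightarrow> f n = \<zero>)" for f
    unfolding P0 projective_module_simps using fin_ind[of "iv ` V" f] finV by auto
  have C1: "f \<in> carrier (P 1) \<longleftrightarrow> (\<forall>c\<in>E. f (ie c) \<in> carrier A \<and> f (ie c) \<otimes> videm A (hd c) = f (ie c)) \<and>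
      (\<forall>n. n \<notin> ie ` E \<longrightarrow> f n = \<zero>)" for f
    unfolding P1 projective_module_simps using fin_ind[of "ie ` E" f] finite_E by auto
  have C2: "f \<in> carrier (P 2) \<longleftrightarrow> (\<forall>j\<in>W. f (iv j) \<in> carrier A \<and> f (iv j) \<otimes> videm A j = f (iv j)) \<and>
      (\<forall>n. n \<notin> iv ` W \<longrightarrow> f n = \<zero>)" for f
    unfolding P2 projective_module_simps
    using fin_ind[of "iv ` W" f] finite_subset[OF WV finV] WV by auto
  have Cn: "carrier (P (Suc (Suc (Suc n)))) = {\<lambda>_. \<zero>}" for n
    unfolding Pn projective_module_simps by auto
  have C2': "f (iv j) \<in> carrier A" "f (iv j) \<otimes> videm A j = f (iv j)" "j \<notin> W \<Longrightarrow> f (iv j) = \<zero>"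
    if "f \<in> carrier (P 2)" "j \<in> V" for f j
  proof -
    have *: "f (iv j) = \<zero>" if "j \<notin> W"
    proof -
      have "iv j \<notin> iv ` W" using that \<open>j \<in> V\<close> WV iv by (auto simp: inj_on_def)
      then show ?thesis using \<open>f \<in> carrier (P 2)\<close> unfolding C2 by blast
    qed
    then show "j \<notin> W \<Longrightarrow> f (iv j) = \<zero>" .
    show "f (iv j) \<in> carrier A" "f (iv j) \<otimes> videm A j = f (iv j)"
      using that * unfolding C2 by (cases "j \<in> W"; auto simp: V_def)+
  qed
  have G0: "f \<in> mgr (P 0) d \<longleftrightarrow> f \<in> carrier (P 0) \<and> (\<forall>j\<in>V. f (iv j) \<in> gr A d)" for f d
    unfolding P0 projective_module_simps(5) by auto
  have G1: "f \<in> mgr (P 1) d \<longleftrightarrow> f \<in> carrier (P 1) \<and> (\<forall>c\<in>E. if 1 \<le> d then f (ie c) \<in> gr A (d - 1) else f (ie c) = \<zero>)" for f d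
    unfolding P1 projective_module_simps(5) by auto
  have G2: "f \<in> mgr (P 2) d \<longleftrightarrow> f \<in> carrier (P 2) \<and> (\<forall>j\<in>W. if 2 \<le> d then f (iv j) \<in> gr A (d - 2) else f (iv j) = \<zero>)" for f d
    unfolding P2 projective_module_simps(5) by auto

  have add: "add (P n) f g = (\<lambda>x. f x \<oplus>\<^bsub>A\<^esub> g x)" and smul: "smult (P n) a f = (\<lambda>x. a \<otimes> f x)" and zero: "zero (P n) = (\<lambda>_. \<zero>)"
    for n f g a
    unfolding P_def by (auto simp: projective_module_simps split: nat.splits)

  have eps_car: "(\<Oplus>j\<in>V. f (iv j)) \<in> carrier A" if "f \<in> carrier (P 0)" for f
    using that C0 by (intro finsum_closed) auto
  have eps_comp: "(\<Oplus>j\<in>V. f (iv j)) \<otimes> videm A i = f (iv i)" if f: "f \<in> carrier (P 0)" and i: "i \<in> V" for f i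
  proof -
    have "(\<Oplus>j\<in>V. f (iv j)) \<otimes> videm A i = (\<Oplus>j\<in>V. f (iv j) \<otimes> videm A i)"
      using f i C0 finV by (intro finsum_ldistr) (auto simp: V_def)
    also have "\<dots> = (\<Oplus>j\<in>V. if i = j then f (iv j) else \<zero>)"
    proof (rule finsum_cong')
      fix j assume j: "j \<in> V"
      have "f (iv j) \<otimes> videm A i = f (iv j) \<otimes> (videm A j \<otimes> videm A i)"
        using f i j C0 m_assoc[of "f (iv j)" "videm A j" "videm A i"] by (auto simp: V_def)
      also have "\<dots> = (if i = j then f (iv j) else \<zero>)"
        using f i j C0 by (auto simp: V_def videm_mult)
      finally show "f (iv j) \<otimes> videm A i = (if i = j then f (iv j) else \<zero>)" .
    qed (use f C0 in auto)
    also have "\<dots> = f (iv i)"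
      using f i C0 finV by (intro finsum_singleton) auto
    finally show ?thesis .
  qed
  have d0_at: "d0 f (iv j) = (\<Oplus>c\<in>{c \<in> E. tl c = j}. f (ie c) \<otimes> \<xi> c)" if "j \<in> V" for f j
    using that by (simp add: d0_def)
  have d1_at: "d1 f (ie c) = f (iv (tl c)) \<otimes> \<rho> c" if "c \<in> E" for f c
    using that by (simp add: d1_def)

  have d0_car: "d0 f \<in> carrier (P 0)" if f: "f \<in> carrier (P 1)" for f
    unfolding C0
  proof (intro conjI ballI allI impI)
    fix j assume j: "j \<in> V"
    have mem: "f (ie c) \<otimes> \<xi> c \<in> carrier A" if "c \<in> E" for c using f that C1 by auto
    then show "d0 f (iv j) \<in> carrier A" unfolding d0_at[OF j] by (intro finsum_closed) auto
    have "d0 f (iv j) \<otimes> videm A j = (\<Oplus>c\<in>{c \<in> E. tl c = j}. f (ie c) \<otimes> \<xi> c \<otimes> videm A j)"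
      unfolding d0_at[OF j] using mem j finite_E by (intro finsum_ldistr) (auto simp: V_def)
    also have "\<dots> = d0 f (iv j)"
      unfolding d0_at[OF j]
    proof (rule finsum_cong')
      fix c assume c: "c \<in> {c \<in> E. tl c = j}"
      then show "f (ie c) \<otimes> \<xi> c \<otimes> videm A j = f (ie c) \<otimes> \<xi> c"
        using f C1 \<xi>_tl[of c] ends[of c] m_assoc[of "f (ie c)" "\<xi> c" "videm A j"] by auto
    qed (use mem in auto)
    finally show "d0 f (iv j) \<otimes> videm A j = d0 f (iv j)" .
  qed (simp add: d0_def)
  have d1_car: "d1 f \<in> carrier (P 1)" if f: "f \<in> carrier (P 2)" for f
    unfolding C1
  proof (intro conjI ballI allI impI)
    fix c assume c: "c \<in> E"
    note fc = C2'[OF f endsV(2)[OF c]]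
    show "d1 f (ie c) \<in> carrier A" unfolding d1_at[OF c] using fc c by auto
    show "d1 f (ie c) \<otimes> videm A (hd c) = d1 f (ie c)"
      unfolding d1_at[OF c] using fc c \<rho>_hd[OF c] ends(1)[OF c]
        m_assoc[of "f (iv (tl c))" "\<rho> c" "videm A (hd c)"] by auto
  qed (simp add: d1_def)

  have resolution: "projective_resolution A P \<delta> \<epsilon>"
    unfolding projective_resolution_def
  proof (intro conjI allI)
    fix n
    show "\<exists>X s w. s ` X \<subseteq> vertices A \<and> P n = projective_module A X s w"
    proof -
      consider "n = 0" | "n = 1" | "n = 2" | m where "n = Suc (Suc (Suc m))"
        by (metis One_nat_def Suc_1 not0_implies_Suc)
      then show ?thesis
      proof cases
        case 1
        then show ?thesis using P0 by (intro exI[of _ "iv ` V"] exI[of _ sv] exI conjI) (auto simp: V_def[symmetric])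
      next
        case 2
        then show ?thesis using P1 ends by (intro exI[of _ "ie ` E"] exI[of _ "hd \<circ> se"] exI conjI) auto
      next
        case 3
        then show ?thesis using P2 W WV by (intro exI[of _ "iv ` W"] exI[of _ sv] exI conjI) (auto simp: subset_iff)
      next
        case 4
        then show ?thesis using Pn by (intro exI[of _ "{}"] exI[of _ sv] exI conjI) auto
      qed
    qed
  next
    have sum_add: "(\<Oplus>j\<in>V. f (iv j) \<oplus>\<^bsub>A\<^esub> g (iv j)) = (\<Oplus>j\<in>V. f (iv j)) \<oplus>\<^bsub>A\<^esub> (\<Oplus>j\<in>V. g (iv j))"
      if "f \<in> carrier (P 0)" "g \<in> carrier (P 0)" for f g
      using that C0 by (intro finsum_addf) auto
    have sum_smul: "(\<Oplus>j\<in>V. a \<otimes> f (iv j)) = a \<otimes> (\<Oplus>j\<in>V. f (iv j))"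
      if "f \<in> carrier (P 0)" "a \<in> carrier A" for f a
      using that C0 finV by (intro finsum_rdistr[symmetric]) auto
    show "\<epsilon> \<in> graded_hom A (P 0) Res 0"
      unfolding graded_hom_def left_module_hom_def
    proof (intro CollectI conjI ballI allI funcsetI)
      fix f assume f: "f \<in> carrier (P 0)"
      then show "\<epsilon> f \<in> carrier Res" using eps_car by (auto simp: \<epsilon>_def Res_simps)
      show "\<epsilon> (a \<odot>\<^bsub>P 0\<^esub> f) = a \<odot>\<^bsub>Res\<^esub> \<epsilon> f" if "a \<in> carrier A" for a
        using f that eps_car by (simp add: \<epsilon>_def smul sum_smul Res_simps Quot_simps)
      show "\<epsilon> (f \<oplus>\<^bsub>P 0\<^esub> g) = \<epsilon> f \<oplus>\<^bsub>Res\<^esub> \<epsilon> g" if "g \<in> carrier (P 0)" for g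
        using f that eps_car by (simp add: \<epsilon>_def add sum_add Res_simps Quot_simps)
    next
      fix d
      have "\<epsilon> f \<in> mgr Res d" if "f \<in> mgr (P 0) d" for f
        using that finV unfolding G0 by (auto simp: \<epsilon>_def Res_simps intro!: imageI gr_finsum)
      then show "\<epsilon> ` mgr (P 0) d \<subseteq> (if 0 \<le> int d then mgr Res (nat (int d - 0)) else {\<zero>\<^bsub>Res\<^esub>})"
        by auto
    qed
  next
    have d0_hom: "d0 \<in> graded_hom A (P 1) (P 0) 0"
      unfolding graded_hom_def left_module_hom_def
    proof (intro CollectI conjI ballI allI funcsetI)
      fix f assume f: "f \<in> carrier (P 1)"
      show "d0 f \<in> carrier (P 0)" by (rule d0_car[OF f])
      have mem: "f (ie c) \<in> carrier A" if "c \<in> E" for c using f that C1 by auto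
      show "d0 (a \<odot>\<^bsub>P 1\<^esub> f) = a \<odot>\<^bsub>P 0\<^esub> d0 f" if a: "a \<in> carrier A" for a
      proof
        fix n
        have "(\<Oplus>c\<in>{c \<in> E. tl c = sv n}. a \<otimes> f (ie c) \<otimes> \<xi> c) =
            (\<Oplus>c\<in>{c \<in> E. tl c = sv n}. a \<otimes> (f (ie c) \<otimes> \<xi> c))"
          using mem a by (intro finsum_cong') (auto simp: m_assoc)
        also have "\<dots> = a \<otimes> (\<Oplus>c\<in>{c \<in> E. tl c = sv n}. f (ie c) \<otimes> \<xi> c)"
          using mem a finite_E by (intro finsum_rdistr[symmetric]) auto
        finally show "d0 (a \<odot>\<^bsub>P 1\<^esub> f) n = (a \<odot>\<^bsub>P 0\<^esub> d0 f) n"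
          using a by (simp add: d0_def smul)
      qed
      show "d0 (f \<oplus>\<^bsub>P 1\<^esub> g) = d0 f \<oplus>\<^bsub>P 0\<^esub> d0 g" if g: "g \<in> carrier (P 1)" for g
      proof
        fix n
        have memg: "g (ie c) \<in> carrier A" if "c \<in> E" for c using g that C1 by auto
        have "(\<Oplus>c\<in>{c \<in> E. tl c = sv n}. (f (ie c) \<oplus>\<^bsub>A\<^esub> g (ie c)) \<otimes> \<xi> c) =
            (\<Oplus>c\<in>{c \<in> E. tl c = sv n}. f (ie c) \<otimes> \<xi> c \<oplus>\<^bsub>A\<^esub> g (ie c) \<otimes> \<xi> c)"
          using mem memg by (intro finsum_cong') (auto simp: l_distr)
        also have "\<dots> = (\<Oplus>c\<in>{c \<in> E. tl c = sv n}. f (ie c) \<otimes> \<xi> c) \<oplus>\<^bsub>A\<^esub> (\<Oplus>c\<in>{c \<in> E. tl c = sv n}. g (ie c) \<otimes> \<xi> c)"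
          using mem memg by (intro finsum_addf) auto
        finally show "d0 (f \<oplus>\<^bsub>P 1\<^esub> g) n = (d0 f \<oplus>\<^bsub>P 0\<^esub> d0 g) n"
          by (simp add: d0_def add)
      qed
    next
      fix d
      have "d0 f \<in> mgr (P 0) d" if f: "f \<in> mgr (P 1) d" for f
        unfolding G0
      proof (intro conjI ballI)
        show "d0 f \<in> carrier (P 0)" using f d0_car unfolding G1 by blast
        fix j assume j: "j \<in> V"
        show "d0 f (iv j) \<in> gr A d"
          unfolding d0_at[OF j]
        proof (rule gr_finsum)
          fix c assume c: "c \<in> {c \<in> E. tl c = j}"
          show "f (ie c) \<otimes> \<xi> c \<in> gr A d"
          proof (cases "1 \<le> d")
            case True
            then show ?thesis using f c gr_mult[of "f (ie c)" "d - 1" "\<xi> c" 1] \<xi>_gr unfolding G1 by auto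
          next
            case False
            then have "f (ie c) = \<zero>" using f c unfolding G1 by auto
            then show ?thesis using c gr_zero by auto
          qed
        qed (use finite_E in auto)
      qed
      then show "d0 ` mgr (P 1) d \<subseteq> (if 0 \<le> int d then mgr (P 0) (nat (int d - 0)) else {\<zero>\<^bsub>P 0\<^esub>})"
        by auto
    qed
    have d1_hom: "d1 \<in> graded_hom A (P 2) (P 1) 0"
      unfolding graded_hom_def left_module_hom_def
    proof (intro CollectI conjI ballI allI funcsetI)
      fix f assume f: "f \<in> carrier (P 2)"
      show "d1 f \<in> carrier (P 1)" by (rule d1_car[OF f])
      have mem: "f (iv (tl c)) \<in> carrier A" if "c \<in> E" for c using C2'(1)[OF f endsV(2)[OF that]] .
      show "d1 (a \<odot>\<^bsub>P 2\<^esub> f) = a \<odot>\<^bsub>P 1\<^esub> d1 f" if a: "a \<in> carrier A" for a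
        using a mem by (auto simp: d1_def smul fun_eq_iff m_assoc)
      show "d1 (f \<oplus>\<^bsub>P 2\<^esub> g) = d1 f \<oplus>\<^bsub>P 1\<^esub> d1 g" if g: "g \<in> carrier (P 2)" for g
        using mem C2'(1)[OF g endsV(2)] by (auto simp: d1_def add fun_eq_iff l_distr)
    next
      fix d
      have "d1 f \<in> mgr (P 1) d" if f: "f \<in> mgr (P 2) d" for f
        unfolding G1
      proof (intro conjI ballI)
        have fcar: "f \<in> carrier (P 2)" using f unfolding G2 by blast
        then show "d1 f \<in> carrier (P 1)" by (rule d1_car)
        fix c assume c: "c \<in> E"
        \<comment> \<open>For \<open>d < 2\<close> the truncated difference \<open>d - 2\<close>
          does no harm, because the element is then zero.\<close>
        have "f (iv (tl c)) \<in> gr A (d - 2) \<and> (\<not> 2 \<le> d \<longrightarrow> f (iv (tl c)) = \<zero>)"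
        proof (cases "tl c \<in> W")
          case True
          with f show ?thesis unfolding G2 by (auto simp: gr_zero split: if_splits)
        next
          case False
          then show ?thesis using C2'(3)[OF fcar endsV(2)[OF c]] gr_zero by auto
        qed
        then show "if 1 \<le> d then d1 f (ie c) \<in> gr A (d - 1) else d1 f (ie c) = \<zero>"
          unfolding d1_at[OF c]
          using gr_mult[of "f (iv (tl c))" "d - 2" "\<rho> c" 1] \<rho>_gr[OF c] c Suc_diff_Suc[of 1 d]
          by (cases "2 \<le> d") (auto simp: gr_zero numeral_2_eq_2)
      qed
      then show "d1 ` mgr (P 2) d \<subseteq> (if 0 \<le> int d then mgr (P 1) (nat (int d - 0)) else {\<zero>\<^bsub>P 1\<^esub>})"
        by auto
    qed
    have dn_hom: "(\<lambda>_ _. \<zero>) \<in> graded_hom A (P (Suc (Suc (Suc n)))) (P (Suc (Suc n))) 0" for n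
    proof -
      have z: "(\<lambda>_. \<zero>) \<in> carrier (P (Suc (Suc n)))"
        by (cases n) (use Cn C2 WV in \<open>auto simp: numeral_2_eq_2 V_def\<close>)
      have zd: "(\<lambda>_. \<zero>) \<in> mgr (P (Suc (Suc n))) d" for d
      proof (cases n)
        case 0
        then show ?thesis using z G2[of "\<lambda>_. \<zero>" d] by (simp add: numeral_2_eq_2 gr_zero)
      next
        case (Suc m)
        with z show ?thesis unfolding Suc Pn projective_module_simps(5) by simp
      qed
      show ?thesis
        unfolding graded_hom_def left_module_hom_def using z zd by (auto simp: add smul)
    qed
    fix n
    show "\<delta> n \<in> graded_hom A (P (Suc n)) (P n) 0"
    proof -
      consider "n = 0" | "n = 1" | m where "n = Suc (Suc m)"
        by (metis One_nat_def not0_implies_Suc)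
      then show ?thesis
        by cases (use d0_hom d1_hom dn_hom \<delta> in \<open>auto simp: numeral_2_eq_2\<close>)
    qed
  next
    show "\<epsilon> ` carrier (P 0) = carrier Res"
    proof (intro equalityI subsetI)
      fix r assume "r \<in> \<epsilon> ` carrier (P 0)"
      then show "r \<in> carrier Res" using eps_car by (auto simp: \<epsilon>_def Res_simps)
    next
      fix r assume "r \<in> carrier Res"
      then obtain a where a: "a \<in> carrier A" "r = L +> a" by (auto simp: Res_simps)
      \<comment> \<open>As the idempotents add up to one, \<open>a\<close> is the sum of its
        components \<open>a e_j\<close>.\<close>
      define f where "f n = (if n \<in> iv ` V then a \<otimes> videm A (sv n) else \<zero>)" for n
      have fiv: "f (iv j) = a \<otimes> videm A j" if "j \<in> V" for j using that by (simp add: f_def)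
      have f: "f \<in> carrier (P 0)"
        unfolding C0
      proof (intro conjI ballI allI impI)
        fix j assume j: "j \<in> V"
        show "f (iv j) \<in> carrier A" "f (iv j) \<otimes> videm A j = f (iv j)"
          using a(1) j by (auto simp: fiv m_assoc V_def videm_mult)
      qed (simp add: f_def)
      have "(\<Oplus>j\<in>V. f (iv j)) = (\<Oplus>j\<in>V. a \<otimes> videm A j)"
        using a(1) fiv by (intro finsum_cong') (auto simp: V_def)
      also have "\<dots> = a \<otimes> (\<Oplus>j\<in>V. videm A j)"
        using a(1) finV by (intro finsum_rdistr[symmetric]) (auto simp: V_def)
      also have "\<dots> = a" using a(1) videm_sum by (simp add: V_def)
      finally have "\<epsilon> f = r" by (simp add: \<epsilon>_def a(2))
      with f show "r \<in> \<epsilon> ` carrier (P 0)" by blast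
    qed
  next
    show "\<delta> 0 ` carrier (P 1) = {x \<in> carrier (P 0). \<epsilon> x = \<zero>\<^bsub>Res\<^esub>}"
    proof (intro equalityI subsetI)
      fix x assume "x \<in> \<delta> 0 ` carrier (P 1)"
      then obtain f where f: "f \<in> carrier (P 1)" "x = d0 f" by (auto simp: \<delta>)
      have x: "x \<in> carrier (P 0)" using d0_car f by simp
      interpret LI: ideal L A by (rule ideal_L)
      have L_sum: "(\<Oplus>c\<in>C. g c) \<in> L" if "finite C" "\<And>c. c \<in> C \<Longrightarrow> g c \<in> L" for C :: "'z set" and g
        using that
      proof (induction C rule: finite_induct)
        case (insert c C)
        then have "(\<Oplus>c\<in>insert c C. g c) = g c \<oplus>\<^bsub>A\<^esub> (\<Oplus>c\<in>C. g c)"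
          by (intro finsum_insert) auto
        with insert show ?case by auto
      qed simp
      have "x (iv j) \<in> L" if j: "j \<in> V" for j
        unfolding f(2) d0_at[OF j]
      proof (rule L_sum)
        fix c assume c: "c \<in> {c \<in> E. tl c = j}"
        then have "\<xi> c \<in> L" using \<xi>_gr gr_L[of 1] by auto
        then show "f (ie c) \<otimes> \<xi> c \<in> L" using f(1) c C1 by (intro LI.I_l_closed) auto
      qed (use finite_E in auto)
      then have "(\<Oplus>j\<in>V. x (iv j)) \<in> L" using finV by (intro L_sum) auto
      with x show "x \<in> {x \<in> carrier (P 0). \<epsilon> x = \<zero>\<^bsub>Res\<^esub>}"
        using coset_L_iff eps_car by (auto simp: \<epsilon>_def Res_simps)
    next
      fix x assume "x \<in> {x \<in> carrier (P 0). \<epsilon> x = \<zero>\<^bsub>Res\<^esub>}"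
      then have x: "x \<in> carrier (P 0)" "(\<Oplus>j\<in>V. x (iv j)) \<in> L"
        using coset_L_iff eps_car by (auto simp: \<epsilon>_def Res_simps)
      have "\<exists>y. (\<forall>c\<in>E. y c \<in> carrier A \<and> y c \<otimes> videm A (hd c) = y c) \<and>
          x (iv j) = (\<Oplus>c\<in>{c \<in> E. tl c = j}. y c \<otimes> \<xi> c)" if j: "j \<in> V" for j
      proof (rule exact_0)
        show "x (iv j) \<in> L"
          using eps_comp[OF x(1) j] ideal.I_r_closed[OF ideal_L x(2), of "videm A j"] j by (auto simp: V_def)
      qed (use j x(1) C0 in \<open>auto simp: V_def\<close>)
      then have "\<forall>j\<in>V. \<exists>y. (\<forall>c\<in>E. y c \<in> carrier A \<and> y c \<otimes> videm A (hd c) = y c) \<and>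
          x (iv j) = (\<Oplus>c\<in>{c \<in> E. tl c = j}. y c \<otimes> \<xi> c)" by blast
      from bchoice[OF this] obtain Y where Y: "\<And>j c. j \<in> V \<Longrightarrow> c \<in> E \<Longrightarrow> Y j c \<in> carrier A \<and> Y j c \<otimes> videm A (hd c) = Y j c"
        "\<And>j. j \<in> V \<Longrightarrow> x (iv j) = (\<Oplus>c\<in>{c \<in> E. tl c = j}. Y j c \<otimes> \<xi> c)"
        by blast
      define f where "f n = (if n \<in> ie ` E then Y (tl (se n)) (se n) else \<zero>)" for n
      have fie: "f (ie c) = Y (tl c) c" if "c \<in> E" for c using that by (simp add: f_def)
      have f: "f \<in> carrier (P 1)"
        unfolding C1 using Y(1) endsV by (auto simp: fie) (simp add: f_def)
      have "d0 f n = x n" for n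
      proof (cases "n \<in> iv ` V")
        case True
        then obtain j where j: "j \<in> V" "n = iv j" by blast
        have "d0 f n = (\<Oplus>c\<in>{c \<in> E. tl c = j}. Y j c \<otimes> \<xi> c)"
          unfolding j(2) d0_at[OF j(1)] using Y(1)[OF j(1)] by (intro finsum_cong') (auto simp: fie)
        with Y(2) j show ?thesis by simp
      next
        case False
        then show ?thesis using x(1) C0 by (simp add: d0_def)
      qed
      then have "x = \<delta> 0 f" by (auto simp: \<delta>)
      with f show "x \<in> \<delta> 0 ` carrier (P 1)" by blast
    qed
  next
    have ex1: "d1 ` carrier (P 2) = {x \<in> carrier (P 1). d0 x = \<zero>\<^bsub>P 0\<^esub>}"
    proof (intro equalityI subsetI)
      fix x assume "x \<in> d1 ` carrier (P 2)"
      then obtain f where f: "f \<in> carrier (P 2)" "x = d1 f" by blast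
      have "d0 x n = \<zero>" for n
      proof (cases "n \<in> iv ` V")
        case True
        then obtain j where j: "j \<in> V" "n = iv j" by blast
        note fj = C2'[OF f(1) j(1)]
        have "d0 x n = (\<Oplus>c\<in>{c \<in> E. tl c = j}. f (iv j) \<otimes> (\<rho> c \<otimes> \<xi> c))"
          unfolding j(2) d0_at[OF j(1)] f(2)
          using fj(1) by (intro finsum_cong') (auto simp: d1_at m_assoc)
        also have "\<dots> = f (iv j) \<otimes> (\<Oplus>c\<in>{c \<in> E. tl c = j}. \<rho> c \<otimes> \<xi> c)"
          using fj(1) finite_E by (intro finsum_rdistr[symmetric]) auto
        also have "\<dots> = \<zero>"
        proof (cases "j \<in> W")
          case True
          then show ?thesis using relation fj(1) by simp
        next
          case False
          have "(\<Oplus>c\<in>{c \<in> E. tl c = j}. \<rho> c \<otimes> \<xi> c) \<in> carrier A" by (intro finsum_closed) auto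
          then show ?thesis using fj(3)[OF False] by simp
        qed
        finally show ?thesis .
      qed (simp add: d0_def)
      with f d1_car show "x \<in> {x \<in> carrier (P 1). d0 x = \<zero>\<^bsub>P 0\<^esub>}" by (auto simp: zero)
    next
      fix x assume "x \<in> {x \<in> carrier (P 1). d0 x = \<zero>\<^bsub>P 0\<^esub>}"
      then have x: "x \<in> carrier (P 1)" "\<And>n. d0 x n = \<zero>" by (auto simp: zero)
      have "\<exists>g\<in>carrier A. g \<otimes> videm A j = g \<and> (j \<notin> W \<longrightarrow> g = \<zero>) \<and> (\<forall>c\<in>E. tl c = j \<longrightarrow> x (ie c) = g \<otimes> \<rho> c)"
        if j: "j \<in> V" for j
      proof (rule exact_1)
        show "(\<Oplus>c\<in>{c \<in> E. tl c = j}. x (ie c) \<otimes> \<xi> c) = \<zero>"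
          using x(2)[of "iv j"] d0_at[OF j] by simp
      qed (use j x(1) C1 in \<open>auto simp: V_def\<close>)
      then have "\<forall>j\<in>V. \<exists>g. g \<in> carrier A \<and> g \<otimes> videm A j = g \<and> (j \<notin> W \<longrightarrow> g = \<zero>) \<and>
          (\<forall>c\<in>E. tl c = j \<longrightarrow> x (ie c) = g \<otimes> \<rho> c)" by blast
      from bchoice[OF this] obtain g where g: "\<And>j. j \<in> V \<Longrightarrow> g j \<in> carrier A \<and> g j \<otimes> videm A j = g j \<and> (j \<notin> W \<longrightarrow> g j = \<zero>) \<and>
          (\<forall>c\<in>E. tl c = j \<longrightarrow> x (ie c) = g j \<otimes> \<rho> c)"
        by blast
      define f where "f n = (if n \<in> iv ` W then g (sv n) else \<zero>)" for n
      have fiv: "f (iv j) = g j" if j: "j \<in> V" for j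
      proof (cases "j \<in> W")
        case False
        then have "iv j \<notin> iv ` W" using j WV iv by (auto simp: inj_on_def)
        with False g j show ?thesis by (simp add: f_def)
      qed (use j in \<open>simp add: f_def\<close>)
      have f: "f \<in> carrier (P 2)"
        unfolding C2 using g WV by (auto simp: fiv subset_iff) (simp add: f_def)
      have "d1 f n = x n" for n
      proof (cases "n \<in> ie ` E")
        case True
        then obtain c where c: "c \<in> E" "n = ie c" by blast
        then show ?thesis using g[OF endsV(2)[OF c(1)]] by (simp add: d1_at fiv endsV)
      next
        case False
        then show ?thesis using x(1) C1 by (simp add: d1_def)
      qed
      then have "x = d1 f" by auto
      with f show "x \<in> d1 ` carrier (P 2)" by blast
    qed
    \<comment> \<open>The next term is zero, so exactness at \<open>P 2\<close> is injectivity of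
      \<open>d1\<close>, that is, \<open>exact_2\<close>.\<close>
    have ex2: "{\<lambda>_ :: nat. \<zero>} = {x \<in> carrier (P 2). d1 x = \<zero>\<^bsub>P 1\<^esub>}"
    proof (intro equalityI subsetI)
      fix x :: "nat \<Rightarrow> 'a" assume "x \<in> {\<lambda>_. \<zero>}"
      then have "x = (\<lambda>_. \<zero>)" by simp
      moreover have "(\<lambda>_. \<zero>) \<in> carrier (P 2)" unfolding C2 using WV by (auto simp: V_def)
      moreover have "d1 (\<lambda>_. \<zero>) = (\<lambda>_. \<zero>)" by (rule ext) (auto simp: d1_def)
      ultimately show "x \<in> {x \<in> carrier (P 2). d1 x = \<zero>\<^bsub>P 1\<^esub>}" by (simp add: zero)
    next
      fix x assume "x \<in> {x \<in> carrier (P 2). d1 x = \<zero>\<^bsub>P 1\<^esub>}"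
      then have x: "x \<in> carrier (P 2)" "\<And>n. d1 x n = \<zero>" by (auto simp: zero)
      have "x (iv j) = \<zero>" if j: "j \<in> W" for j
      proof (rule exact_2[OF j])
        show "x (iv j) \<in> carrier A" "x (iv j) \<otimes> videm A j = x (iv j)" using x(1) j C2 by auto
        show "x (iv j) \<otimes> \<rho> c = \<zero>" if "c \<in> E" "tl c = j" for c
          using x(2)[of "ie c"] d1_at[OF that(1), of x] that(2) by simp
      qed
      then have "x n = \<zero>" for n using x(1) unfolding C2 by (cases "n \<in> iv ` W") auto
      then show "x \<in> {\<lambda>_. \<zero>}" by auto
    qed
    fix n
    show "\<delta> (Suc n) ` carrier (P (Suc (Suc n))) = {x \<in> carrier (P (Suc n)). \<delta> n x = \<zero>\<^bsub>P n\<^esub>}"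
    proof -
      consider "n = 0" | "n = 1" | m where "n = Suc (Suc m)"
        by (metis One_nat_def not0_implies_Suc)
      then show ?thesis
      proof cases
        case 1
        then show ?thesis using ex1 \<delta> by (simp add: numeral_2_eq_2)
      next
        case 2
        have "\<delta> (Suc 1) ` carrier (P (Suc (Suc 1))) = {\<lambda>_. \<zero>}"
          using \<delta>(3)[of 0] Cn[of 0] by simp
        with 2 show ?thesis using ex2[symmetric] \<delta>(2) by (simp add: numeral_2_eq_2)
      next
        case 3
        then show ?thesis using \<delta>(3) Cn by (auto simp: zero)
      qed
    qed
  qed
  have vanish: "\<phi> x = zero Res" if "\<phi> \<in> graded_hom A (P i) Res j" "j \<noteq> int i" "x \<in> carrier (P i)" for \<phi> x i j
  proof -
    have "\<exists>X s. s ` X \<subseteq> vertices A \<and> P i = projective_module A X s (\<lambda>_. i)"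
    proof -
      consider "i = 0" | "i = 1" | "i = 2" | m where "i = Suc (Suc (Suc m))"
        by (metis One_nat_def Suc_1 not0_implies_Suc)
      then show ?thesis
      proof cases
        case 1
        then show ?thesis using P0 by (intro exI[of _ "iv ` V"] exI[of _ sv] conjI) (auto simp: V_def[symmetric])
      next
        case 2
        then show ?thesis using P1 ends by (intro exI[of _ "ie ` E"] exI[of _ "hd \<circ> se"] conjI) auto
      next
        case 3
        then show ?thesis using P2 W WV by (intro exI[of _ "iv ` W"] exI[of _ sv] conjI) (auto simp: subset_iff)
      next
        case 4
        then show ?thesis using Pn by (intro exI[of _ "{}"] exI[of _ sv] conjI) auto
      qed
    qed
    then obtain X s where "s ` X \<subseteq> vertices A" "P i = projective_module A X s (\<lambda>_. i)" by blast
    with graded_hom_Res_zero[of \<phi> X s i j x] that show ?thesis by simp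
  qed
  \<comment> \<open>The zero map is the cochain whose coboundary is a vanishing cocycle.\<close>
  have zero_hom: "(\<lambda>_. zero Res) \<in> graded_hom A (P n) Res j" for n j
  proof -
    interpret Q: ring "A Quot L" by (rule ideal.quotient_is_ring[OF ideal_L])
    have zL: "L = L +> \<zero>" using coset_L_iff[of \<zero>] ideal.axioms(1)[OF ideal_L] additive_subgroup.zero_closed by auto
    have "L \<in> carrier Res" "\<And>d. L \<in> mgr Res d"
      unfolding Res_simps using zL gr_zero by (blast intro: image_eqI)+
    moreover have "L \<oplus>\<^bsub>A Quot L\<^esub> L = L"
      using Q.r_zero[OF Q.zero_closed] by (simp add: Quot_simps)
    moreover have "(L +> a) \<otimes>\<^bsub>A Quot L\<^esub> L = L" if "a \<in> carrier A" for a
      using Q.r_null[of "L +> a"] that by (simp add: Quot_simps)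
    ultimately show ?thesis
      unfolding graded_hom_def left_module_hom_def by (auto simp: Res_simps)
  qed
  have "\<phi> \<in> ext_coboundaries A P \<delta> i j" if "\<phi> \<in> ext_cocycles A P \<delta> i j" "j \<noteq> int i" for \<phi> i j
  proof -
    have \<phi>: "\<phi> \<in> graded_hom A (P i) Res j" using that(1) by (simp add: ext_cocycles_def)
    note van = vanish[OF \<phi> that(2)]
    show ?thesis
    proof (cases i)
      case 0
      then show ?thesis using \<phi> van by (simp add: ext_coboundaries_def)
    next
      case (Suc n)
      then show ?thesis using \<phi> van zero_hom[of n j] by (auto simp: ext_coboundaries_def)
    qed
  qed
  with resolution show ?thesis unfolding ext_diagonal_def by blast
qed

end

subsection \<open>The quotient algebra\<close>

lemma ring_extend_simps [simp]:
  "carrier (ring.extend R m) = carrier R" "monoid.mult (ring.extend R m) = monoid.mult R"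
  "one (ring.extend R m) = one R" "zero (ring.extend R m) = zero R" "add (ring.extend R m) = add R"
  by (simp_all add: ring.extend_def)

lemma ring_extend: "ring R \<Longrightarrow> ring (ring.extend R m)"
proof -
  assume "ring R"
  then interpret R: ring R .
  show ?thesis
  proof (rule ringI)
    show "abelian_group (ring.extend R m)"
      by (rule abelian_groupI) (auto simp: R.add.m_ac intro: R.l_neg R.a_inv_closed)
    show "Group.monoid (ring.extend R m)"
      by (rule Group.monoidI) (auto simp: R.m_assoc)
  qed (auto simp: R.l_distr R.r_distr)
qed

context preprojective_datum
begin

text \<open>Let \<open>f e\<close> be the dimension of degree \<open>e\<close> of
  \<open>e_i \<Pi>\<close>, weighted by \<open>\<delta>\<close>. The inequality for dimensions and
  \<open>C \<delta> \<ge> 2 \<delta>\<close> give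
  \<open>f (e+2) - f (e+1) \<ge> f (e+1) - f e\<close> and \<open>f 1 \<ge> 2 f 0\<close>. So every
  increment is at least \<open>f 0 = \<delta> i > 0\<close>, whereas a socle element would force
  \<open>f\<close> to vanish in high degrees.\<close>

lemma socle_free_empty:
  fixes \<delta> :: "'v \<Rightarrow> nat"
  assumes J: "J = {}"
    and conn: "\<And>S. S \<subseteq> verts G \<Longrightarrow> S \<noteq> {} \<Longrightarrow>
      (\<And>c. c \<in> arcs G \<Longrightarrow> head G c \<in> S \<Longrightarrow> tail G c \<in> S) \<Longrightarrow> S = verts G"
    and i: "i \<in> verts G" "0 < \<delta> i"
    and \<delta>: "\<And>l. l \<in> verts G \<Longrightarrow> 2 * \<delta> l \<le> (\<Sum>c\<in>{c \<in> arcs G. head G c = l}. \<delta> (tail G c))"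
  shows socle_free
proof (rule ccontr)
  assume "\<not> socle_free"
  from socle_finite[OF J this conn] obtain M where
    "\<forall>e>M. \<forall>j\<in>verts G. hom_part e j \<subseteq> rel_ideal" ..
  then have M: "hom_part e j \<subseteq> rel_ideal" if "e > M" "j \<in> verts G" for e j using that by simp
  have vanish: "quot_dim e i j = 0" if "e > M" "j \<in> verts G" for e j
  proof -
    have "ideal_comp e i j = path_comp e i j"
      unfolding ideal_comp_def using M[OF that] comp_hom_part by blast
    then show ?thesis by (simp add: quot_dim_def)
  qed
  have nonneg: "0 \<le> quot_dim e i j" for e j
  proof -
    obtain B :: "(('v, 'b) path \<Rightarrow>\<^sub>0 'k) set" where "int (card B) = quot_dim e i j"
      using comp_complement[of e i j] by (elim exE conjE)
    then show ?thesis by simp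
  qed
  define f where "f e = (\<Sum>j\<in>verts G. quot_dim e i j * int (\<delta> j))" for e
  \<comment> \<open>Double counting of arcs: grouped by heads the sum meets the hypothesis on
    \<open>\<delta>\<close>, grouped by tails it becomes the main term of the recursion.\<close>
  have shift: "2 * f e \<le> (\<Sum>j\<in>verts G. (\<Sum>c\<in>{c \<in> arcs G. tail G c = j}. quot_dim e i (head G c)) * int (\<delta> j))" for e
  proof -
    let ?g = "\<lambda>c. quot_dim e i (head G c) * int (\<delta> (tail G c))"
    have "2 * f e = (\<Sum>l\<in>verts G. quot_dim e i l * int (2 * \<delta> l))"
      by (simp add: f_def sum_distrib_left ac_simps)
    also have "\<dots> \<le> (\<Sum>l\<in>verts G. quot_dim e i l * int (\<Sum>c\<in>{c \<in> arcs G. head G c = l}. \<delta> (tail G c)))"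
    proof (rule sum_mono)
      fix l assume "l \<in> verts G"
      then have "int (2 * \<delta> l) \<le> int (\<Sum>c\<in>{c \<in> arcs G. head G c = l}. \<delta> (tail G c))"
        using \<delta> by (simp only: of_nat_le_iff)
      then show "quot_dim e i l * int (2 * \<delta> l) \<le>
          quot_dim e i l * int (\<Sum>c\<in>{c \<in> arcs G. head G c = l}. \<delta> (tail G c))"
        by (rule mult_left_mono) (rule nonneg)
    qed
    also have "\<dots> = (\<Sum>l\<in>verts G. \<Sum>c\<in>{c \<in> arcs G. head G c = l}. ?g c)"
      by (simp add: sum_distrib_left)
    also have "\<dots> = (\<Sum>c\<in>arcs G. ?g c)"
      by (rule sum.group) auto
    also have "\<dots> = (\<Sum>j\<in>verts G. \<Sum>c\<in>{c \<in> arcs G. tail G c = j}. ?g c)"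
      by (rule sum.group[symmetric]) auto
    also have "\<dots> = (\<Sum>j\<in>verts G. (\<Sum>c\<in>{c \<in> arcs G. tail G c = j}. quot_dim e i (head G c)) * int (\<delta> j))"
      by (simp add: sum_distrib_right)
    finally show ?thesis .
  qed
  have f0: "f 0 = int (\<delta> i)"
  proof -
    have "f 0 = (\<Sum>j\<in>verts G. if i = j then int (\<delta> j) else 0)"
      unfolding f_def using quot_dim_0[OF i(1)] by (intro sum.cong) auto
    with i(1) show ?thesis by simp
  qed
  have f1: "2 * f 0 \<le> f 1"
    using shift[of 0] by (simp add: f_def[of "Suc 0"] quot_dim_no_relation)
  have f2: "2 * f (Suc e) - f e \<le> f (Suc (Suc e))" for e
  proof -
    have "2 * f (Suc e) - f e \<le> (\<Sum>j\<in>verts G. (\<Sum>c\<in>{c \<in> arcs G. tail G c = j}. quot_dim (Suc e) i (head G c)) * int (\<delta> j))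
        - (\<Sum>j\<in>verts G. quot_dim e i j * int (\<delta> j))"
      using shift[of "Suc e"] by (simp add: f_def)
    also have "\<dots> = (\<Sum>j\<in>verts G. ((\<Sum>c\<in>{c \<in> arcs G. tail G c = j}. quot_dim (Suc e) i (head G c)) - quot_dim e i j) * int (\<delta> j))"
      by (simp add: sum_subtractf left_diff_distrib)
    also have "\<dots> \<le> f (Suc (Suc e))"
      unfolding f_def using quot_dim_relation(1) J by (intro sum_mono mult_right_mono) auto
    finally show ?thesis .
  qed
  have step: "f 0 \<le> f (Suc e) - f e" for e
  proof (induction e)
    case (Suc e)
    then show ?case using f2[of e] by linarith
  qed (use f1 in simp)
  have "0 < f e" for e
  proof (induction e)
    case (Suc e)
    then show ?case using step[of e] f0 by linarith
  qed (use f0 i(2) in simp)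
  moreover have "f (Suc M) = 0"
    unfolding f_def using vanish by (intro sum.neutral) auto
  ultimately show False by (metis less_irrefl)
qed

section \<open>The ideal generated by the relation, and the quotient map\<close>

abbreviation A :: "(('v, 'b) path \<Rightarrow>\<^sub>0 'k, 'v) graded_ring" where
  "A \<equiv> path_algebra G"

definition relation_sum :: "('v, 'b) path \<Rightarrow>\<^sub>0 'k" where
  "relation_sum = (\<Sum>j\<in>verts G - J. rel_at j [] j [] j)"

lemma subspace_additive_subgroup:
  assumes "pm.subspace S" "S \<subseteq> kG"
  shows "subgroup S (add_monoid A)"
proof -
  interpret A: ring A by (rule ring_path_algebra)
  have inv: "\<ominus>\<^bsub>A\<^esub> x = - x" if "x \<in> kG" for x
    by (rule A.minus_equality) (use that in auto)
  show ?thesis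
  proof (rule A.add.subgroupI)
    show "S \<noteq> {}" using pm.subspace_0[OF assms(1)] by auto
    fix x assume "x \<in> S"
    then show "\<ominus>\<^bsub>A\<^esub> x \<in> S" using inv assms pm.subspace_neg by (auto simp: subset_iff)
  qed (use assms pm.subspace_add in auto)
qed

lemma ideal_rel_ideal: "ideal rel_ideal A"
  by (rule idealI[OF ring_path_algebra subspace_additive_subgroup])
    (auto intro: rel_ideal_left rel_ideal_right simp: subsetD[OF rel_ideal_supported] rel_ideal_supported)

lemma idem_kG [simp]: "v \<in> verts G \<Longrightarrow> idem v \<in> kG"
  by (auto simp: awalk_Nil_iff)

lemma idem_mult_relation_sum:
  assumes "j \<in> verts G - J"
  shows "idem j \<cdot> relation_sum = rel_at j [] j [] j"
proof -
  have "idem j \<cdot> relation_sum = (\<Sum>i\<in>verts G - J. if i = j then rel_at j [] j [] j else 0)"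
    unfolding relation_sum_def path_alg_mult_right by (intro sum.cong) (auto simp: mult_rel_at)
  then show ?thesis using assms by simp
qed

text \<open>The relation is one element summed over vertices, but multiplication by
  \<open>idem j\<close> isolates its part at \<open>j\<close>. The generated ideal is closed under
  scalars because they act as the ring elements \<open>path_scalar G c\<close>.\<close>

lemma genideal_relation_sum: "Idl\<^bsub>A\<^esub> {relation_sum} = rel_ideal"
proof
  interpret A: ring A by (rule ring_path_algebra)
  have "relation_sum \<in> rel_ideal"
    unfolding relation_sum_def
    by (intro pm.subspace_sum rel_ideal_subspace rel_at_in_ideal) (auto simp: awalk_Nil_iff)
  then show "Idl\<^bsub>A\<^esub> {relation_sum} \<subseteq> rel_ideal"
    by (intro A.genideal_minimal ideal_rel_ideal) auto
  let ?I = "Idl\<^bsub>A\<^esub> {relation_sum}"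
  have "{relation_sum} \<subseteq> carrier A" using \<open>relation_sum \<in> rel_ideal\<close> rel_ideal_supported by auto
  then interpret I: ideal ?I A by (rule A.genideal_ideal)
  have mem: "relation_sum \<in> ?I" using A.genideal_self[OF \<open>{relation_sum} \<subseteq> carrier A\<close>] by simp
  have I_kG: "?I \<subseteq> kG" using I.a_subset by simp
  have sub: "pm.subspace ?I"
    unfolding pm.subspace_def
  proof (intro conjI ballI allI)
    show "0 \<in> ?I" using I.zero_closed by simp
    show "x + y \<in> ?I" if "x \<in> ?I" "y \<in> ?I" for x y using I.a_closed[OF that] by simp
    show "smul c x \<in> ?I" if "x \<in> ?I" for c x
    proof -
      have "path_scalar G c \<cdot> x \<in> ?I"
        using I.I_l_closed[OF that, of "path_scalar G c"] path_scalar_supported[of c] by simp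
      moreover have "x \<in> kG" using that I_kG by blast
      ultimately show ?thesis by (simp add: path_scalar_mult)
    qed
  qed
  show "rel_ideal \<subseteq> ?I"
    unfolding rel_ideal_def
  proof (rule pm.span_minimal[OF _ sub], clarify)
    fix u p j q v assume *: "awalk u p j" "awalk j q v" "j \<in> verts G" "j \<notin> J"
    have paths: "idem j \<in> carrier A" "Poly_Mapping.single (j, q, v) 1 \<in> carrier A"
      "Poly_Mapping.single (u, p, j) 1 \<in> carrier A"
      using * by auto
    have "rel_at j [] j [] j \<in> ?I"
      using idem_mult_relation_sum[of j] I.I_l_closed[OF mem paths(1)] *(3,4) by simp
    then have "rel_at j [] j q v \<in> ?I"
      using I.I_l_closed[OF _ paths(2), of "rel_at j [] j [] j"] by (simp add: mult_rel_at)
    then show "rel_at u p j q v \<in> ?I"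
      using I.I_r_closed[OF _ paths(3), of "rel_at j [] j q v"] by (simp add: rel_at_mult)
  qed
qed

abbreviation B :: "((('v, 'b) path \<Rightarrow>\<^sub>0 'k) set, 'v) graded_ring" where
  "B \<equiv> path_algebra_mod G {relation_sum}"

abbreviation q :: "(('v, 'b) path \<Rightarrow>\<^sub>0 'k) \<Rightarrow> (('v, 'b) path \<Rightarrow>\<^sub>0 'k) set" where
  "q x \<equiv> rel_ideal +>\<^bsub>A\<^esub> x"

lemma B_eq: "B = ring.extend (A Quot rel_ideal)
     (graded_ring.fields (verts G) (q ` range (path_scalar G)) (\<lambda>i. q (idem i))
       (\<lambda>d. q ` supported {(u, p, v) \<in> paths G. length p = d}))"
  unfolding path_algebra_mod_def genideal_relation_sum graded_quotient_def by simp

lemma B_simps [simp]: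
  "vertices B = verts G" "vscalars B = q ` range (path_scalar G)" "videm B i = q (idem i)"
  "gr B d = q ` supported {(u, p, v) \<in> paths G. length p = d}"
  unfolding B_eq by (simp_all add: ring.extend_def graded_ring.fields_def)

lemma B_ring_fields:
  "carrier B = carrier (A Quot rel_ideal)" "monoid.mult B = monoid.mult (A Quot rel_ideal)"
  "one B = one (A Quot rel_ideal)" "zero B = zero (A Quot rel_ideal)" "add B = add (A Quot rel_ideal)"
  unfolding B_eq by simp_all

lemma ring_B: "ring B"
  unfolding B_eq by (rule ring_extend[OF ideal.quotient_is_ring[OF ideal_rel_ideal]])

lemma q_hom: "ring_hom_ring A B q"
proof (rule ring_hom_ringI2[OF ring_path_algebra ring_B])
  show "q \<in> ring_hom A B"
    using ideal.rcos_ring_hom[OF ideal_rel_ideal] by (simp add: ring_hom_def B_ring_fields)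
qed

lemma q_simps:
  "x \<in> kG \<Longrightarrow> q x \<in> carrier B"
  "x \<in> kG \<Longrightarrow> y \<in> kG \<Longrightarrow> q x \<otimes>\<^bsub>B\<^esub> q y = q (x \<cdot> y)"
  "x \<in> kG \<Longrightarrow> y \<in> kG \<Longrightarrow> q x \<oplus>\<^bsub>B\<^esub> q y = q (x + y)"
  "one B = q (path_scalar G 1)" "zero B = q 0"
proof -
  interpret h: ring_hom_ring A B q by (rule q_hom)
  show "x \<in> kG \<Longrightarrow> q x \<in> carrier B" using h.hom_closed by simp
  show "x \<in> kG \<Longrightarrow> y \<in> kG \<Longrightarrow> q x \<otimes>\<^bsub>B\<^esub> q y = q (x \<cdot> y)" using h.hom_mult[of x y] by simp
  show "x \<in> kG \<Longrightarrow> y \<in> kG \<Longrightarrow> q x \<oplus>\<^bsub>B\<^esub> q y = q (x + y)" using h.hom_add[of x y] by simp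
  show "one B = q (path_scalar G 1)" "zero B = q 0" using h.hom_one h.hom_zero by simp_all
qed

lemma q_surj: "carrier B = q ` kG"
  by (auto simp: B_ring_fields FactRing_def A_RCOSETS_def' a_r_coset_def')

lemma q_eq_zero_iff: "x \<in> kG \<Longrightarrow> q x = zero B \<longleftrightarrow> x \<in> rel_ideal"
proof -
  assume x: "x \<in> kG"
  have "zero B = rel_ideal" by (simp add: B_ring_fields FactRing_def)
  with x show ?thesis
    using ideal.rcos_const_imp_mem[OF ideal_rel_ideal, of x] ring.a_rcos_zero[OF ring_path_algebra ideal_rel_ideal, of x]
    by auto
qed

lemma q_eq_iff:
  assumes "x \<in> kG" "y \<in> kG"
  shows "q x = q y \<longleftrightarrow> x - y \<in> rel_ideal"
proof -
  interpret B: ring B by (rule ring_B)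
  have "q x = q (x - y) \<oplus>\<^bsub>B\<^esub> q y" using assms by (simp add: q_simps)
  moreover have "q y \<in> carrier B" "q (x - y) \<in> carrier B" using assms by (auto simp: q_simps)
  ultimately have "q x = q y \<longleftrightarrow> q (x - y) = zero B"
    by (metis B.add.l_cancel_one' B.add.r_cancel_one B.l_zero)
  with assms q_eq_zero_iff[of "x - y"] show ?thesis by auto
qed

lemma q_sum:
  assumes "finite C" "\<And>c. c \<in> C \<Longrightarrow> f c \<in> kG"
  shows "finsum B (\<lambda>c. q (f c)) C = q (\<Sum>c\<in>C. f c)"
  using assms
proof (induction C rule: finite_induct)
  case empty
  interpret B: ring B by (rule ring_B)
  show ?case by (simp add: q_simps(5)[symmetric])
next
  case (insert c C)
  interpret B: ring B by (rule ring_B)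
  have "finsum B (\<lambda>c. q (f c)) (insert c C) = q (f c) \<oplus>\<^bsub>B\<^esub> finsum B (\<lambda>c. q (f c)) C"
    using insert by (intro B.finsum_insert) (auto simp: q_simps)
  with insert show ?case by (auto simp: q_simps)
qed

abbreviation paths_pos :: "(('v, 'b) path \<Rightarrow>\<^sub>0 'k) set" where
  "paths_pos \<equiv> supported {(u, p, v) \<in> paths G. p \<noteq> []}"

abbreviation gr_part :: "nat \<Rightarrow> (('v, 'b) path \<Rightarrow>\<^sub>0 'k) set" where
  "gr_part d \<equiv> supported {(u, p, v) \<in> paths G. length p = d}"

lemma gr_part_kG: "gr_part d \<subseteq> kG" and paths_pos_kG: "paths_pos \<subseteq> kG"
  by (auto intro!: supported_mono)

lemma mult_in_subspace:
  assumes "pm.subspace S" "x \<in> supported X" "y \<in> supported Y"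
    and "\<And>u p v u' p' v'. (u, p, v) \<in> X \<Longrightarrow> (u', p', v') \<in> Y \<Longrightarrow> v' = u \<Longrightarrow> Poly_Mapping.single (u', p' @ p, v) 1 \<in> S"
  shows "x \<cdot> y \<in> S"
proof -
  have "Poly_Mapping.single s 1 \<cdot> y \<in> S" if s: "s \<in> X" for s
  proof (rule pm_linear_in_subspace[OF path_alg_mult_linear_right assms(1,3)])
    fix t assume t: "t \<in> Y"
    obtain u p v u' p' v' where "s = (u, p, v)" "t = (u', p', v')" by (cases s; cases t)
    then show "Poly_Mapping.single s 1 \<cdot> Poly_Mapping.single t 1 \<in> S"
      using assms(4)[of u p v u' p' v'] s t pm.subspace_0[OF assms(1)]
      by (cases "v' = u") (simp_all add: path_alg_mult_single_paths)
  qed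
  then show ?thesis
    by (rule pm_linear_in_subspace[OF path_alg_mult_linear_left assms(1,2)])
qed

lemma gr_part_mult: "x \<in> gr_part d \<Longrightarrow> y \<in> gr_part e \<Longrightarrow> x \<cdot> y \<in> gr_part (d + e)"
  by (rule mult_in_subspace[OF supported_subspace]) auto

lemma paths_pos_left: "x \<in> kG \<Longrightarrow> y \<in> paths_pos \<Longrightarrow> x \<cdot> y \<in> paths_pos"
  and paths_pos_right: "x \<in> kG \<Longrightarrow> y \<in> paths_pos \<Longrightarrow> y \<cdot> x \<in> paths_pos"
  by (rule mult_in_subspace[OF supported_subspace, of _ "paths G" _ "{(u, p, v) \<in> paths G. p \<noteq> []}"], auto)
    (rule mult_in_subspace[OF supported_subspace, of _ "{(u, p, v) \<in> paths G. p \<noteq> []}" _ "paths G"], auto)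

lemma q_subgroup:
  assumes "pm.subspace S" "S \<subseteq> kG"
  shows "subgroup (q ` S) (add_monoid B)"
proof -
  interpret B: ring B by (rule ring_B)
  have inv: "\<ominus>\<^bsub>B\<^esub> q x = q (- x)" if "x \<in> kG" for x
    by (rule B.minus_equality) (use that in \<open>auto simp: q_simps\<close>)
  show ?thesis
  proof (rule B.add.subgroupI)
    show "q ` S \<subseteq> carrier B" using assms(2) by (auto simp: q_simps)
    show "q ` S \<noteq> {}" using pm.subspace_0[OF assms(1)] by auto
    fix a assume "a \<in> q ` S"
    then obtain x where x: "x \<in> S" "a = q x" by blast
    show "\<ominus>\<^bsub>B\<^esub> a \<in> q ` S" using inv[of x] x assms(2) pm.subspace_neg[OF assms(1)] by auto
    fix b assume "b \<in> q ` S"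
    then obtain y where y: "y \<in> S" "b = q y" by blast
    show "a \<oplus>\<^bsub>B\<^esub> b \<in> q ` S"
      using q_simps(3)[OF subsetD[OF assms(2) x(1)] subsetD[OF assms(2) y(1)]] x(2) y(2)
        imageI[OF pm.subspace_add[OF assms(1) x(1) y(1)], of q] by (simp del: image_eqI)
  qed
qed

text \<open>An element of the augmentation ideal thus has a representative without trivial paths,
  which can be expanded along first arcs; this yields exactness at \<open>P 0\<close>.\<close>

lemma augmentation_B: "augmentation_ideal B \<subseteq> q ` paths_pos"
proof -
  interpret B: ring B by (rule ring_B)
  have "ideal (q ` paths_pos) B"
  proof (rule idealI[OF ring_B q_subgroup[OF supported_subspace paths_pos_kG]])
    fix a x assume "a \<in> q ` paths_pos" "x \<in> carrier B"
    then obtain y z where yz: "y \<in> paths_pos" "a = q y" "z \<in> kG" "x = q z" by (auto simp: q_surj)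
    have "y \<in> kG" using yz(1) paths_pos_kG by blast
    then show "x \<otimes>\<^bsub>B\<^esub> a \<in> q ` paths_pos" "a \<otimes>\<^bsub>B\<^esub> x \<in> q ` paths_pos"
      using yz paths_pos_left[of z y] paths_pos_right[of z y] by (auto simp: q_simps)
  qed
  moreover have "(\<Union>d\<in>{1..}. gr B d) \<subseteq> q ` paths_pos"
  proof (intro UN_least)
    fix d :: nat assume "d \<in> {1..}"
    then have "gr_part d \<subseteq> paths_pos" by (intro supported_mono) auto
    then show "gr B d \<subseteq> q ` paths_pos" by auto
  qed
  ultimately show ?thesis
    unfolding augmentation_ideal_def by (rule B.genideal_minimal)
qed

lemma mult_idem_starting: "x \<in> kG \<Longrightarrow> x \<cdot> idem j \<in> starting j"
  unfolding mult_idem starting_def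
  by (rule subsetD[OF supported_mono restrict_pm_Int]) auto

lemma starting_mult_idem: "x \<in> starting j \<Longrightarrow> x \<cdot> idem j = x"
  unfolding mult_idem by (rule starting_restrict)

lemma B_representative:
  assumes "a \<in> carrier B" "j \<in> verts G" "a \<otimes>\<^bsub>B\<^esub> q (idem j) = a"
  shows "\<exists>x\<in>starting j. a = q x"
proof -
  obtain x where x: "x \<in> kG" "a = q x" using assms(1) by (auto simp: q_surj)
  then have "a = q (x \<cdot> idem j)" using assms(2,3) by (simp add: q_simps)
  with mult_idem_starting[OF x(1)] show ?thesis by blast
qed

lemma starting_strip_expansion:
  assumes "x \<in> paths_pos" "x \<in> starting j"
  shows "x = (\<Sum>c\<in>{c \<in> arcs G. tail G c = j}. strip c x \<cdot> arc_elem c)"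
proof -
  have "(\<Sum>c\<in>arcs G. strip c x \<cdot> arc_elem c) = (\<Sum>c\<in>{c \<in> arcs G. tail G c = j}. strip c x \<cdot> arc_elem c)"
  proof (intro sum.mono_neutral_right ballI)
    fix c assume c: "c \<in> arcs G - {c \<in> arcs G. tail G c = j}"
    have "strip c x = 0"
    proof (rule path_pm_eqI)
      fix u p v
      have "Poly_Mapping.lookup x (tail G c, c # p, v) = 0"
        using assms(2) c by (auto simp: starting_def supported_iff)
      then show "Poly_Mapping.lookup (strip c x) (u, p, v) = Poly_Mapping.lookup 0 (u, p, v)"
        by (simp add: lookup_strip)
    qed
    then show "strip c x \<cdot> arc_elem c = 0" by (simp add: path_alg_mult_left)
  qed auto
  with strip_expansion[OF assms(1)] show ?thesis by simp
qed

text \<open>The coefficients of the left differential make the sum of its products with the arcs out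
  of \<open>j\<close> equal to the relation at \<open>j\<close>. Of the exactness conditions,
  \<open>exact_0\<close> is the expansion along first arcs, \<open>exact_1\<close> is
  \<open>exact_middle\<close>, and \<open>exact_2\<close> is \<open>socle_free\<close>.\<close>

lemma koszul_complex_B:
  assumes sf: socle_free
  shows "koszul_complex B (arcs G) (head G) (tail G) (\<lambda>c. q (arc_elem c))
    (\<lambda>c. q (smul (\<eta> (star c)) (arc_elem (star c)))) (verts G - J)"
proof -
  interpret B: ring B by (rule ring_B)
  have arc_gr: "arc_elem c \<in> gr_part 1" if "c \<in> arcs G" for c
    using that by (auto simp: arc_elem_def arc_implies_awalk)
  have rho: "smul (\<eta> (star c)) (arc_elem (star c)) \<in> gr_part 1" "smul (\<eta> (star c)) (arc_elem (star c)) \<in> kG"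
    if "c \<in> arcs G" for c
    using arc_gr[of "star c"] arc_elem_kG[of "star c"] that by auto
  have starting_q: "q x \<otimes>\<^bsub>B\<^esub> q (idem j) = q x" if "x \<in> starting j" "j \<in> verts G" for x j
    using that starting_kG[OF that(1)] starting_mult_idem[OF that(1)] by (simp add: q_simps)
  have arc_starting: "arc_elem c \<in> starting (tail G c)" if "c \<in> arcs G" for c
    using that by (auto simp: arc_elem_def starting_def arc_implies_awalk)
  show ?thesis
  proof (intro koszul_complex.intro graded_algebra.intro ring_B graded_algebra_axioms.intro
      koszul_complex_axioms.intro, unfold B_simps)
    show "finite (verts G)" "finite (arcs G)" "verts G - J \<subseteq> verts G" by auto
    show "q (idem i) \<in> q ` gr_part 0" if "i \<in> verts G" for i
      using that by (intro imageI) (auto simp: awalk_Nil_iff)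
    show "q (idem i) \<otimes>\<^bsub>B\<^esub> q (idem j) = (if i = j then q (idem i) else \<zero>\<^bsub>B\<^esub>)" if "i \<in> verts G" "j \<in> verts G" for i j
      using that by (simp add: q_simps path_alg_mult_single_paths)
    have "(\<Sum>i\<in>verts G. idem i) = path_scalar G 1" by (simp add: path_scalar_def)
    then show "finsum B (\<lambda>i. q (idem i)) (verts G) = \<one>\<^bsub>B\<^esub>"
      using q_sum[of "verts G" idem] by (simp add: q_simps)
    show "additive_subgroup (q ` gr_part d) B" for d
      by (rule additive_subgroupI[OF q_subgroup[OF supported_subspace gr_part_kG]])
    show "x \<otimes>\<^bsub>B\<^esub> y \<in> q ` gr_part (d + e)" if "x \<in> q ` gr_part d" "y \<in> q ` gr_part e" for x y d e
    proof -
      from that(1) obtain x' where x': "x = q x'" "x' \<in> gr_part d" by (rule imageE)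
      from that(2) obtain y' where y': "y = q y'" "y' \<in> gr_part e" by (rule imageE)
      have "x \<otimes>\<^bsub>B\<^esub> y = q (x' \<cdot> y')"
        unfolding x'(1) y'(1)
        by (rule q_simps(2)[OF subsetD[OF gr_part_kG x'(2)] subsetD[OF gr_part_kG y'(2)]])
      then show ?thesis using imageI[OF gr_part_mult[OF x'(2) y'(2)], of q] by simp
    qed
    fix c assume c: "c \<in> arcs G"
    show "head G c \<in> verts G" "tail G c \<in> verts G" using c by auto
    show "q (arc_elem c) \<in> q ` gr_part 1" using arc_gr[OF c] by (rule imageI)
    show "q (arc_elem c) \<otimes>\<^bsub>B\<^esub> q (idem (tail G c)) = q (arc_elem c)"
      using starting_q[OF arc_starting[OF c]] c by simp
    show "q (smul (\<eta> (star c)) (arc_elem (star c))) \<in> q ` gr_part 1" using rho(1)[OF c] by (rule imageI)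
    show "q (smul (\<eta> (star c)) (arc_elem (star c))) \<otimes>\<^bsub>B\<^esub> q (idem (head G c)) = q (smul (\<eta> (star c)) (arc_elem (star c)))"
      using starting_q[of "smul (\<eta> (star c)) (arc_elem (star c))" "head G c"] arc_starting[of "star c"] c
      by (simp add: pm.subspace_scale)
  next
    fix j assume j: "j \<in> verts G - J"
    let ?f = "\<lambda>c. smul (\<eta> (star c)) (arc_elem (star c)) \<cdot> arc_elem c"
    have "(\<Oplus>\<^bsub>B\<^esub>c\<in>{c \<in> arcs G. tail G c = j}. q (smul (\<eta> (star c)) (arc_elem (star c))) \<otimes>\<^bsub>B\<^esub> q (arc_elem c)) =
        (\<Oplus>\<^bsub>B\<^esub>c\<in>{c \<in> arcs G. tail G c = j}. q (?f c))"
    proof (rule B.finsum_cong')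
      show "(\<lambda>c. q (?f c)) \<in> {c \<in> arcs G. tail G c = j} \<rightarrow> carrier B"
        using rho(2) arc_elem_kG by (auto intro!: q_simps(1) path_alg_mult_supported)
      fix c assume "c \<in> {c \<in> arcs G. tail G c = j}"
      then show "q (smul (\<eta> (star c)) (arc_elem (star c))) \<otimes>\<^bsub>B\<^esub> q (arc_elem c) = q (?f c)"
        using rho(2)[of c] by (simp add: q_simps)
    qed simp
    also have "\<dots> = q (\<Sum>c\<in>{c \<in> arcs G. tail G c = j}. ?f c)"
      using rho(2) by (intro q_sum) (auto intro!: path_alg_mult_supported)
    also have "(\<Sum>c\<in>{c \<in> arcs G. tail G c = j}. ?f c) = idem j \<cdot> rel_at j [] j [] j"
    proof -
      have "idem j \<in> starting j" using j by (auto simp: starting_def awalk_Nil_iff)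
      have "idem j \<cdot> arc_elem (star c) = arc_elem (star c)" if "c \<in> arcs G" "tail G c = j" for c
        using that by (simp add: arc_elem_def path_alg_mult_single_paths)
      then show ?thesis
        unfolding mult_rel_strip[OF \<open>idem j \<in> starting j\<close>] by (intro sum.cong) auto
    qed
    also have "q \<dots> = \<zero>\<^bsub>B\<^esub>"
    proof -
      have "idem j \<cdot> rel_at j [] j [] j \<in> rel_ideal"
        using j by (intro rel_ideal_left rel_at_in_ideal) (auto simp: awalk_Nil_iff)
      then show ?thesis using q_eq_zero_iff rel_ideal_supported by blast
    qed
    finally show "(\<Oplus>\<^bsub>B\<^esub>c\<in>{c \<in> arcs G. tail G c = j}. q (smul (\<eta> (star c)) (arc_elem (star c))) \<otimes>\<^bsub>B\<^esub> q (arc_elem c)) = \<zero>\<^bsub>B\<^esub>" .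
  next
    fix j a assume j: "j \<in> verts G" and a: "a \<in> augmentation_ideal B" "a \<otimes>\<^bsub>B\<^esub> q (idem j) = a"
    obtain x where x: "x \<in> paths_pos" "a = q x" using a(1) augmentation_B by blast
    let ?x = "x \<cdot> idem j"
    have xkG: "x \<in> kG" using x(1) paths_pos_kG by blast
    have x': "?x \<in> paths_pos" "?x \<in> starting j" "a = q ?x"
      using paths_pos_right[of "idem j" x] mult_idem_starting[OF xkG] a(2) x j xkG by (auto simp: q_simps)
    have st: "strip c ?x \<in> starting (head G c)" if "c \<in> arcs G" for c
      using strip_starting[OF starting_kG[OF x'(2)] that] .
    have stkG: "strip c ?x \<in> kG" if "c \<in> arcs G" for c
      by (rule starting_kG[OF st[OF that]])
    have "a = q (\<Sum>c\<in>{c \<in> arcs G. tail G c = j}. strip c ?x \<cdot> arc_elem c)"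
      using x'(3) starting_strip_expansion[OF x'(1,2)] by simp
    also have "\<dots> = (\<Oplus>\<^bsub>B\<^esub>c\<in>{c \<in> arcs G. tail G c = j}. q (strip c ?x \<cdot> arc_elem c))"
      using stkG by (intro q_sum[symmetric]) (auto intro!: path_alg_mult_supported)
    also have "\<dots> = (\<Oplus>\<^bsub>B\<^esub>c\<in>{c \<in> arcs G. tail G c = j}. q (strip c ?x) \<otimes>\<^bsub>B\<^esub> q (arc_elem c))"
      using stkG by (intro B.finsum_cong') (simp_all add: q_simps path_alg_mult_supported)
    finally show "\<exists>y. (\<forall>c\<in>arcs G. y c \<in> carrier B \<and> y c \<otimes>\<^bsub>B\<^esub> q (idem (head G c)) = y c) \<and>
        a = (\<Oplus>\<^bsub>B\<^esub>c\<in>{c \<in> arcs G. tail G c = j}. y c \<otimes>\<^bsub>B\<^esub> q (arc_elem c))"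
      using starting_q[OF st head_in_verts] q_simps(1)[OF stkG]
      by (intro exI[of _ "\<lambda>c. q (strip c ?x)"]) simp
  next
    fix j y assume j: "j \<in> verts G"
      and y: "\<And>c. c \<in> arcs G \<Longrightarrow> y c \<in> carrier B \<and> y c \<otimes>\<^bsub>B\<^esub> q (idem (head G c)) = y c"
      and sum: "(\<Oplus>\<^bsub>B\<^esub>c\<in>{c \<in> arcs G. tail G c = j}. y c \<otimes>\<^bsub>B\<^esub> q (arc_elem c)) = \<zero>\<^bsub>B\<^esub>"
    have "\<forall>c\<in>arcs G. \<exists>x. x \<in> starting (head G c) \<and> y c = q x"
      using B_representative y head_in_verts by blast
    from bchoice[OF this] obtain Y where Y: "\<And>c. c \<in> arcs G \<Longrightarrow> Y c \<in> starting (head G c)"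
      "\<And>c. c \<in> arcs G \<Longrightarrow> y c = q (Y c)" by blast
    have YkG: "Y c \<in> kG" if "c \<in> arcs G" for c using Y(1)[OF that] by (rule starting_kG)
    have "q (\<Sum>c\<in>{c \<in> arcs G. tail G c = j}. Y c \<cdot> arc_elem c) =
        (\<Oplus>\<^bsub>B\<^esub>c\<in>{c \<in> arcs G. tail G c = j}. q (Y c \<cdot> arc_elem c))"
      using YkG by (intro q_sum[symmetric]) (auto intro!: path_alg_mult_supported)
    also have "\<dots> = (\<Oplus>\<^bsub>B\<^esub>c\<in>{c \<in> arcs G. tail G c = j}. y c \<otimes>\<^bsub>B\<^esub> q (arc_elem c))"
      using YkG Y(2) by (intro B.finsum_cong') (simp_all add: q_simps path_alg_mult_supported)
    also have "\<dots> = \<zero>\<^bsub>B\<^esub>" by (rule sum)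
    finally have "(\<Sum>c\<in>{c \<in> arcs G. tail G c = j}. Y c \<cdot> arc_elem c) \<in> rel_ideal"
      using YkG by (subst (asm) q_eq_zero_iff) (auto intro!: path_alg_mult_supported)
    from exact_middle[OF Y(1) this] obtain g where g: "g \<in> starting j" "j \<in> J \<longrightarrow> g = 0"
      "\<forall>c\<in>arcs G. tail G c = j \<longrightarrow> Y c - smul (\<eta> (star c)) (g \<cdot> arc_elem (star c)) \<in> rel_ideal" by blast
    have gkG: "g \<in> kG" using g(1) by (rule starting_kG)
    have "y c = q g \<otimes>\<^bsub>B\<^esub> q (smul (\<eta> (star c)) (arc_elem (star c)))" if c: "c \<in> arcs G" "tail G c = j" for c
    proof -
      have mem: "g \<cdot> smul (\<eta> (star c)) (arc_elem (star c)) \<in> kG"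
        using gkG rho(2)[OF c(1)] by (rule path_alg_mult_supported)
      have "Y c - g \<cdot> smul (\<eta> (star c)) (arc_elem (star c)) \<in> rel_ideal"
        using g(3) c by (simp add: path_alg_mult_right)
      then have "q (Y c) = q (g \<cdot> smul (\<eta> (star c)) (arc_elem (star c)))"
        using q_eq_iff[OF YkG[OF c(1)] mem] by blast
      then show ?thesis using Y(2)[OF c(1)] q_simps(2)[OF gkG rho(2)[OF c(1)]] by simp
    qed
    moreover have "q g \<otimes>\<^bsub>B\<^esub> q (idem j) = q g" by (rule starting_q[OF g(1) j])
    moreover have "j \<notin> verts G - J \<longrightarrow> q g = \<zero>\<^bsub>B\<^esub>" using g(2) j by (auto simp: q_simps)
    ultimately show "\<exists>g\<in>carrier B. g \<otimes>\<^bsub>B\<^esub> q (idem j) = g \<and> (j \<notin> verts G - J \<longrightarrow> g = \<zero>\<^bsub>B\<^esub>) \<and>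
        (\<forall>c\<in>arcs G. tail G c = j \<longrightarrow> y c = g \<otimes>\<^bsub>B\<^esub> q (smul (\<eta> (star c)) (arc_elem (star c))))"
      using q_simps(1)[OF gkG] by blast
  next
    fix j g assume j: "j \<in> verts G - J" and g: "g \<in> carrier B" "g \<otimes>\<^bsub>B\<^esub> q (idem j) = g"
      and kill: "\<And>c. c \<in> arcs G \<Longrightarrow> tail G c = j \<Longrightarrow> g \<otimes>\<^bsub>B\<^esub> q (smul (\<eta> (star c)) (arc_elem (star c))) = \<zero>\<^bsub>B\<^esub>"
    obtain x where x: "x \<in> starting j" "g = q x" using B_representative[OF g(1) _ g(2)] j by blast
    have xkG: "x \<in> kG" using x(1) by (rule starting_kG)
    have "x \<cdot> arc_elem b \<in> rel_ideal" if b: "b \<in> arcs G" "head G b = j" for b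
    proof -
      have "q (x \<cdot> smul (\<eta> b) (arc_elem b)) = \<zero>\<^bsub>B\<^esub>"
        using kill[of "star b"] b q_simps(2)[OF xkG, of "smul (\<eta> b) (arc_elem b)"] x(2) by simp
      then have "smul (\<eta> b) (x \<cdot> arc_elem b) \<in> rel_ideal"
        using b xkG by (subst (asm) q_eq_zero_iff) (auto intro!: path_alg_mult_supported simp: path_alg_mult_right)
      then show ?thesis using scale_in_ideal_iff eta_nonzero[OF b(1)] b(2) j by blast
    qed
    then have "x \<in> rel_ideal" using sf x(1) j unfolding socle_free_def by blast
    then show "g = \<zero>\<^bsub>B\<^esub>" using x(2) q_eq_zero_iff[OF xkG] by blast
  qed
qed

end

subsection \<open>Graphs without subadditive functions\<close>

text \<open>
  A simple connected graph without nonzero subadditive weights. Every proper extension of a Dynkin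
  diagram contains an extended Dynkin diagram, whose null root is such a weight; the proof reads the
  diagram off a longest path.
\<close>

locale definite_graph =
  fixes V :: "'v set" and adj :: "'v \<Rightarrow> 'v \<Rightarrow> bool"
  assumes finite_V: "finite V" and nonempty: "V \<noteq> {}"
    and adj_V: "adj u v \<Longrightarrow> u \<in> V" and adj_sym: "adj u v \<Longrightarrow> adj v u" and adj_irrefl: "\<not> adj v v"
    and connected: "S \<subseteq> V \<Longrightarrow> S \<noteq> {} \<Longrightarrow> (\<And>u v. u \<in> S \<Longrightarrow> adj u v \<Longrightarrow> v \<in> S) \<Longrightarrow> S = V"
    and definite: "(\<And>v. v \<in> V \<Longrightarrow> 0 < \<delta> v \<Longrightarrow>
      \<exists>T. finite T \<and> (\<forall>t\<in>T. adj v t) \<and> 2 * \<delta> v \<le> sum \<delta> T) \<Longrightarrow> v \<in> V \<Longrightarrow> \<delta> v = (0 :: nat)"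
begin

text \<open>The weights \<open>w\<close> of a pattern \<open>q\<close> are extended by zero to all
  vertices, and where the weight is zero nothing is required. The pattern need not be an induced
  subgraph, because any set of neighbours may serve for the lower bound.\<close>

lemma configuration:
  fixes q :: "nat \<Rightarrow> 'v" and w :: "nat \<Rightarrow> nat"
  assumes "inj_on q {..<m}" "\<And>k. k < m \<Longrightarrow> q k \<in> V"
    and T: "\<And>k. k < m \<Longrightarrow> \<exists>T\<subseteq>{..<m}. (\<forall>l\<in>T. adj (q k) (q l)) \<and> 2 * w k \<le> sum w T"
    and "k < m"
  shows "w k = 0"
proof -
  define \<delta> where "\<delta> v = (if v \<in> q ` {..<m} then w (inv_into {..<m} q v) else 0)" for v
  have \<delta>q: "\<delta> (q k) = w k" if "k < m" for k
    using that assms(1) by (auto simp: \<delta>_def)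
  have "\<delta> (q k) = 0"
  proof (rule definite)
    fix v assume "v \<in> V" "0 < \<delta> v"
    then obtain k where k: "k < m" "v = q k" by (auto simp: \<delta>_def split: if_splits)
    obtain T where T: "T \<subseteq> {..<m}" "\<forall>l\<in>T. adj (q k) (q l)" "2 * w k \<le> sum w T"
      using T[OF k(1)] by blast
    have "sum \<delta> (q ` T) = sum (\<delta> \<circ> q) T"
      using T(1) assms(1) by (intro sum.reindex) (auto intro: inj_on_subset)
    also have "\<dots> = sum w T"
      using T(1) \<delta>q by (intro sum.cong) auto
    finally show "\<exists>T. finite T \<and> (\<forall>t\<in>T. adj v t) \<and> 2 * \<delta> v \<le> sum \<delta> T"
      using T k \<delta>q[OF k(1)] finite_subset[OF T(1)] by (intro exI[of _ "q ` T"]) auto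
  qed (use assms in auto)
  with \<delta>q \<open>k < m\<close> show ?thesis by simp
qed

text \<open>A cycle is an extended diagram of type \<open>A\<close>; its null root is
  constant.\<close>

lemma no_cycle:
  assumes "inj_on q {..<m}" "3 \<le> m" "\<And>k. Suc k < m \<Longrightarrow> adj (q k) (q (Suc k))" "adj (q 0) (q (m - 1))"
  shows False
proof -
  have qV: "q k \<in> V" if "k < m" for k
  proof (cases "Suc k < m")
    case True
    then show ?thesis using assms(3) adj_V by blast
  next
    case False
    with that have "k = m - 1" by simp
    then show ?thesis using assms(4) adj_sym adj_V by blast
  qed
  have "(1 :: nat) = 0"
  proof (rule configuration[where q = q and m = m and w = "\<lambda>_. 1" and k = 0, OF assms(1) qV])
    fix k assume k: "k < m"
    consider "k = 0" | "k = m - 1" "k \<noteq> 0" | "0 < k" "Suc k < m" using k by linarith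
    then show "\<exists>T\<subseteq>{..<m}. (\<forall>l\<in>T. adj (q k) (q l)) \<and> 2 * (1 :: nat) \<le> (\<Sum>_\<in>T. 1)"
    proof cases
      case 1
      then show ?thesis using assms by (intro exI[of _ "{1, m - 1}"]) auto
    next
      case 2
      have "adj (q (m - 2)) (q (Suc (m - 2)))" using assms(2) by (intro assms(3)) auto
      moreover have "Suc (m - 2) = m - 1" using assms(2) by simp
      ultimately show ?thesis using 2 assms adj_sym by (intro exI[of _ "{0, m - 2}"]) auto
    next
      case 3
      have "adj (q (k - 1)) (q (Suc (k - 1)))" using 3 by (intro assms(3)) auto
      then show ?thesis using 3 assms adj_sym by (intro exI[of _ "{k - 1, k + 1}"]) auto
    qed
  qed (use assms in auto)
  then show False by simp
qed

text \<open>An extended diagram of type \<open>D\<close>: a path with one more leaf next to each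
  end. Its null root is 2 on the inner vertices of the path and 1 on the four leaves. For
  \<open>m = 3\<close> the only inner vertex carries all four leaves.\<close>

lemma no_two_branches:
  assumes "inj_on q {..<m}" "3 \<le> m" "\<And>k. Suc k < m \<Longrightarrow> adj (q k) (q (Suc k))"
    and "adj w (q 1)" "adj w' (q (m - 2))" "w \<notin> q ` {..<m}" "w' \<notin> q ` {..<m}" "w \<noteq> w'"
  shows False
proof -
  define r where "r k = (if k < m then q k else if k = m then w else w')" for k
  define c where "c k = (if 0 < k \<and> k < m - 1 then 2 else 1 :: nat)" for k
  have inj: "inj_on r {..<m + 2}"
    using assms(1,6-8) by (auto simp: inj_on_def r_def image_iff)
  have r_adj: "adj (r k) (r (Suc k))" if "Suc k < m" for k
    using that assms(3) by (simp add: r_def)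
  have r_adj': "adj (r k) (r (k - 1))" if "0 < k" "k < m" for k
    using that r_adj[of "k - 1"] adj_sym by auto
  have rw: "adj (r m) (r 1)" "adj (r 1) (r m)" "adj (r (m + 1)) (r (m - 2))" "adj (r (m - 2)) (r (m + 1))"
    using assms(2,4,5) adj_sym by (auto simp: r_def)
  have rV: "r k \<in> V" if k: "k < m + 2" for k
  proof -
    consider "Suc k < m" | "k = m - 1" "0 < k" | "k = m" | "k = m + 1" using k assms(2) by linarith
    then show ?thesis
    proof cases
      case 2
      then show ?thesis using adj_V[OF r_adj'[of k]] by simp
    qed (use adj_V[OF r_adj] adj_V[OF rw(1)] adj_V[OF rw(3)] in auto)
  qed
  have "c 0 = 0"
  proof (rule configuration[where w = c and k = 0, OF inj rV])
    fix k assume "k < m + 2"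
    then consider "k = 0" | "k = m - 1" | "k = m" | "k = m + 1" | "k = 1" "m = 3"
      | "k = 1" "3 < m" | "k = m - 2" "3 < m" | "1 < k" "k < m - 2"
      using assms(2) by linarith
    then show "\<exists>T\<subseteq>{..<m + 2}. (\<forall>l\<in>T. adj (r k) (r l)) \<and> 2 * c k \<le> sum c T"
    proof cases
      case 1
      then show ?thesis using r_adj[of 0] assms(2) by (intro exI[of _ "{1}"]) (auto simp: c_def)
    next
      case 2
      have "m - Suc (Suc 0) = m - 1 - 1" by simp
      then show ?thesis using 2 r_adj'[of "m - 1"] assms(2) by (intro exI[of _ "{m - 2}"]) (auto simp: c_def numeral_2_eq_2)
    next
      case 3
      then show ?thesis using rw assms(2) by (intro exI[of _ "{1}"]) (auto simp: c_def)
    next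
      case 4
      then show ?thesis using rw assms(2) by (intro exI[of _ "{m - 2}"]) (auto simp: c_def)
    next
      case 5
      then show ?thesis using rw r_adj[of 1] r_adj'[of 1]
        by (intro exI[of _ "{0, 2, 3, 4}"]) (auto simp: c_def numeral_2_eq_2 numeral_3_eq_3 numeral_eq_Suc)
    next
      case 6
      then show ?thesis using rw r_adj[of 1] r_adj'[of 1]
        by (intro exI[of _ "{0, 2, m}"]) (auto simp: c_def numeral_2_eq_2)
    next
      case 7
      define n where "n = m - 4"
      have m: "m = Suc (Suc (Suc (Suc n)))" using 7 by (simp add: n_def)
      have k: "k = Suc (Suc n)" using 7 m by simp
      show ?thesis using rw(4) r_adj[of k] r_adj'[of k] unfolding k m
        by (intro exI[of _ "{Suc n, Suc (Suc (Suc n)), Suc (Suc (Suc (Suc (Suc n))))}"]) (auto simp: c_def m)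
    next
      case 8
      then show ?thesis using r_adj[of k] r_adj'[of k]
        by (intro exI[of _ "{k - 1, k + 1}"]) (auto simp: c_def)
    qed
  qed (use assms in auto)
  then show False by (simp add: c_def)
qed

text \<open>For the exceptional diagrams, vertices and weights are given as explicit lists, and
  \<open>Ts ! k\<close> lists the positions of the neighbours of the vertex at position
  \<open>k\<close>.\<close>

lemma list_configuration:
  fixes ws :: "nat list"
  assumes "distinct vs" "length ws = length vs" "length Ts = length vs" "i < length vs" "0 < ws ! i"
    and "\<forall>k<length vs. vs ! k \<in> V"
    and "\<forall>k<length vs. distinct (Ts ! k) \<and> (\<forall>l\<in>set (Ts ! k). l < length vs \<and> adj (vs ! k) (vs ! l)) \<and>
      2 * ws ! k \<le> (\<Sum>l\<leftarrow>Ts ! k. ws ! l)"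
  shows False
proof -
  have "ws ! i = 0"
  proof (rule configuration[where q = "(!) vs" and m = "length vs" and w = "(!) ws" and k = i])
    show "inj_on ((!) vs) {..<length vs}" using assms(1) by (auto intro: inj_on_nth)
    fix k assume "k < length vs"
    then show "\<exists>T\<subseteq>{..<length vs}. (\<forall>l\<in>T. adj (vs ! k) (vs ! l)) \<and> 2 * ws ! k \<le> sum ((!) ws) T"
      using assms(7) by (intro exI[of _ "set (Ts ! k)"]) (auto simp: sum_list_distinct_conv_sum_set)
  qed (use assms in auto)
  with assms(5) show False by simp
qed

text \<open>Three arms of length two at \<open>c\<close>. The weights are those of the null root,
  which is 3 at the branch vertex.\<close>

lemma no_E6:
  assumes "distinct [a, b, c, d, e, f, g]"
    and "adj a b" "adj b c" "adj c d" "adj d e" "adj c f" "adj f g"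
  shows False
  by (rule list_configuration[OF assms(1), of "[1, 2, 3, 2, 1, 2, 1]"
        "[[1], [0, 2], [1, 3, 5], [2, 4], [3], [2, 6], [5]]" 0])
    (use assms adj_V adj_sym in \<open>auto simp: All_less_Suc\<close>)

text \<open>Arms of lengths three, three and one at \<open>d\<close>, where the null root is
  4.\<close>

lemma no_E7:
  assumes "distinct [a, b, c, d, e, f, g, h]"
    and "adj a b" "adj b c" "adj c d" "adj d e" "adj e f" "adj f g" "adj d h"
  shows False
  by (rule list_configuration[OF assms(1), of "[1, 2, 3, 4, 3, 2, 1, 2]"
        "[[1], [0, 2], [1, 3], [2, 4, 7], [3, 5], [4, 6], [5], [3]]" 0])
    (use assms adj_V adj_sym in \<open>auto simp: All_less_Suc\<close>)

text \<open>Arms of lengths two, five and one at \<open>c\<close>, where the null root is 6.\<close>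

lemma no_E8:
  assumes "distinct [a, b, c, d, e, f, g, h, i]"
    and "adj a b" "adj b c" "adj c d" "adj d e" "adj e f" "adj f g" "adj g h" "adj c i"
  shows False
  by (rule list_configuration[OF assms(1), of "[2, 4, 6, 5, 4, 3, 2, 1, 3]"
        "[[1], [0, 2], [1, 3, 8], [2, 4], [3, 5], [4, 6], [5, 7], [6], [2]]" 0])
    (use assms adj_V adj_sym in \<open>auto simp: All_less_Suc\<close>)

section \<open>Reading the diagram off a longest path\<close>

definition gpath :: "'v list \<Rightarrow> bool" where
  "gpath p \<longleftrightarrow> p \<noteq> [] \<and> distinct p \<and> set p \<subseteq> V \<and> successively adj p"

definition longest :: "'v list \<Rightarrow> bool" where
  "longest p \<longleftrightarrow> gpath p \<and> (\<forall>q. gpath q \<longrightarrow> length q \<le> length p)"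

lemma ex_longest: "\<exists>p. longest p"
proof -
  obtain v where "v \<in> V" using nonempty by auto
  then have "gpath [v]" by (simp add: gpath_def)
  moreover have "length q \<le> card V" if "gpath q" for q
  proof -
    have "card (set q) \<le> card V" using that by (intro card_mono finite_V) (simp add: gpath_def)
    then show ?thesis using that by (simp add: gpath_def distinct_card)
  qed
  ultimately have "\<exists>p. gpath p \<and> (\<forall>q. gpath q \<longrightarrow> length q \<le> length p)"
    by (intro ex_has_greatest_nat[of gpath "[v]" length "Suc (card V)"]) (auto simp: less_Suc_eq_le)
  then show ?thesis unfolding longest_def .
qed

lemma gpath_rev:
  assumes "gpath p"
  shows "gpath (rev p)"
proof -
  have "successively (\<lambda>x y. adj y x) p"
    using assms adj_sym unfolding gpath_def successively_conv_nth by blast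
  then show ?thesis using assms by (simp add: gpath_def successively_rev)
qed

lemma longest_rev: "longest p \<Longrightarrow> longest (rev p)"
  unfolding longest_def using gpath_rev by auto

lemma gpath_nth:
  assumes "gpath p"
  shows "Suc i < length p \<Longrightarrow> adj (p ! i) (p ! Suc i)"
    and "inj_on ((!) p) {..<length p}"
  using assms unfolding gpath_def successively_conv_nth by (auto intro: inj_on_nth)

lemma no_chord:
  assumes "gpath p" "Suc i < j" "j < length p" "adj (p ! i) (p ! j)"
  shows False
proof (rule no_cycle)
  let ?q = "\<lambda>k. p ! (i + k)" and ?m = "j - i + 1"
  show "inj_on ?q {..<?m}"
    using assms by (auto simp: inj_on_def gpath_def nth_eq_iff_index_eq)
  show "3 \<le> ?m" using assms by simp
  show "adj (?q k) (?q (Suc k))" if "Suc k < ?m" for k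
    using gpath_nth(1)[OF assms(1), of "i + k"] that assms(3) by simp
  show "adj (?q 0) (?q (?m - 1))" using assms by simp
qed

lemma adj_path_iff:
  assumes "gpath p" "i < length p" "j < length p"
  shows "adj (p ! i) (p ! j) \<longleftrightarrow> j = Suc i \<or> i = Suc j"
proof
  assume adj: "adj (p ! i) (p ! j)"
  show "j = Suc i \<or> i = Suc j"
  proof (rule ccontr)
    assume "\<not> ?thesis"
    moreover have "i \<noteq> j" using adj adj_irrefl by auto
    ultimately have "Suc i < j \<or> Suc j < i" by linarith
    then show False using no_chord[OF assms(1)] assms adj adj_sym by blast
  qed
next
  assume "j = Suc i \<or> i = Suc j"
  then show "adj (p ! i) (p ! j)" using gpath_nth(1)[OF assms(1)] assms adj_sym by blast
qed

lemma unique_attachment: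
  assumes "gpath p" "i < j" "j < length p" "w \<notin> set p" "adj w (p ! i)" "adj w (p ! j)"
  shows False
proof (rule no_cycle)
  let ?q = "\<lambda>k. case k of 0 \<Rightarrow> w | Suc k \<Rightarrow> p ! (i + k)" and ?m = "j - i + 2"
  show "inj_on ?q {..<?m}"
    using assms by (auto simp: inj_on_def gpath_def nth_eq_iff_index_eq split: nat.splits)
  show "3 \<le> ?m" using assms by simp
  show "adj (?q k) (?q (Suc k))" if "Suc k < ?m" for k
    using gpath_nth(1)[OF assms(1), of "i + (k - 1)"] that assms by (cases k) auto
  show "adj (?q 0) (?q (?m - 1))" using assms by simp
qed

lemma longest_attachment:
  assumes "longest p" "w \<notin> set p" "adj w (p ! i)" "i < length p"
  shows "0 < i \<and> Suc i < length p"
proof -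
  have p: "gpath p" and max: "\<And>q. gpath q \<Longrightarrow> length q \<le> length p" using assms(1) by (auto simp: longest_def)
  have wV: "w \<in> V" using assms(3) adj_V by blast
  have "i \<noteq> 0"
  proof
    assume "i = 0"
    then have "gpath (w # p)"
      using p assms wV by (auto simp: gpath_def successively_Cons hd_conv_nth)
    from max[OF this] show False by simp
  qed
  moreover have "i \<noteq> length p - 1"
  proof
    assume "i = length p - 1"
    then have "gpath (p @ [w])"
      using p assms wV adj_sym by (auto simp: gpath_def successively_append_iff last_conv_nth)
    from max[OF this] show False by simp
  qed
  ultimately show ?thesis using assms(4) by linarith
qed

text \<open>Replacing either side of \<open>p\<close> at position \<open>i\<close> by the vertices
  \<open>w\<close> and \<open>w'\<close> gives a path again, which cannot be longer than
  \<open>p\<close>. So each side has at least two vertices.\<close>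

lemma longest_attachment_2:
  assumes "longest p" "w \<notin> set p" "w' \<notin> set p" "w \<noteq> w'" "adj w (p ! i)" "adj w' w" "i < length p"
  shows "2 \<le> i \<and> i + 2 < length p"
proof -
  have p: "gpath p" and max: "\<And>q. gpath q \<Longrightarrow> length q \<le> length p" using assms(1) by (auto simp: longest_def)
  have wV: "w \<in> V" "w' \<in> V" using assms adj_V by blast+
  have "successively adj (drop i p)" "successively adj (take (Suc i) p)"
    using p by (auto simp: gpath_def successively_conv_nth)
  moreover have "last (take (Suc i) p) = p ! i"
    using assms(7) by (simp add: take_Suc_conv_app_nth)
  moreover have "p \<noteq> []" using p by (simp add: gpath_def)
  ultimately have "successively adj (drop i p)" "successively adj (take (Suc i) p)"
    "last (take (Suc i) p) = p ! i" "p \<noteq> []" by blast+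
  note segments = this set_drop_subset[of i p] set_take_subset[of "Suc i" p]
  have "gpath (w' # w # drop i p)"
    using p assms wV segments
    by (auto simp: gpath_def successively_Cons hd_drop_conv_nth)
  from max[OF this] have "2 \<le> i" using assms(7) by simp
  moreover have "gpath (take (Suc i) p @ [w, w'])"
    using p assms wV segments adj_sym
    by (auto simp: gpath_def successively_append_iff)
  from max[OF this] have "i + 2 < length p" using assms(7) by simp
  ultimately show ?thesis by simp
qed

lemma neighbour_outside:
  assumes "S \<subseteq> V" "S \<noteq> {}" "S \<noteq> V"
  shows "\<exists>u\<in>S. \<exists>v. v \<notin> S \<and> adj v u"
  using connected[OF assms(1,2)] assms(3) adj_sym by blast

text \<open>By connectedness a further vertex would be attached to \<open>w\<close> or to the path.
  The first gives three arms of length two at \<open>p ! i\<close>, the extended \<open>E6\<close>;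
  the second gives another branch on the path, an extended \<open>D\<close>.\<close>

lemma at_most_one_outside:
  assumes p: "longest p" and w: "w \<notin> set p" "adj w (p ! i)" "i < length p"
  shows "V = insert w (set p)"
proof (rule ccontr)
  assume "V \<noteq> insert w (set p)"
  have gp: "gpath p" using p by (simp add: longest_def)
  have "insert w (set p) \<subseteq> V" using gp w adj_V by (auto simp: gpath_def)
  then obtain u v where uv: "u \<in> insert w (set p)" "v \<notin> insert w (set p)" "adj v u"
    using neighbour_outside[of "insert w (set p)"] \<open>V \<noteq> insert w (set p)\<close> by blast
  have i: "0 < i" "Suc i < length p" using longest_attachment[OF p w] by auto
  show False
  proof (cases "u = w")
    case True
    have i2: "2 \<le> i" "i + 2 < length p"
      using longest_attachment_2[OF p w(1) _ _ w(2) _ w(3), of v] uv True by auto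
    define k where "k = i - 2"
    have ik: "i = k + 2" using i2 by (simp add: k_def)
    have dist: "distinct [p ! k, p ! (k + 1), p ! (k + 2), p ! (k + 3), p ! (k + 4), w, v]"
      using gp w(1) uv(1,2) True i2 ik
      by (auto simp: gpath_def nth_eq_iff_index_eq)
    show False
      by (rule no_E6[OF dist])
        (use i2 ik gp uv(3) True w(2) adj_sym in \<open>auto simp: adj_path_iff\<close>)
  next
    case False
    then obtain j where j: "j < length p" "u = p ! j" using uv(1) by (auto simp: in_set_conv_nth)
    have j': "0 < j" "Suc j < length p" using longest_attachment[OF p _ _ j(1), of v] uv j by auto
    \<comment> \<open>The pattern uses the part of the path from \<open>a - 1\<close> to
      \<open>b + 1\<close>, so that both branches sit next to its ends.\<close>
    have main: False if "a \<le> b" "0 < a" "Suc b < length p" "x \<notin> set p" "y \<notin> set p" "x \<noteq> y"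
      "adj x (p ! a)" "adj y (p ! b)" for a b x y
    proof (rule no_two_branches)
      let ?q = "\<lambda>k. p ! (a - 1 + k)" and ?m = "b - a + 3"
      show "inj_on ?q {..<?m}"
        using that gp by (auto simp: inj_on_def gpath_def nth_eq_iff_index_eq)
      show "3 \<le> ?m" by simp
      show "adj (?q k) (?q (Suc k))" if "Suc k < ?m" for k
        using gpath_nth(1)[OF gp, of "a - 1 + k"] that \<open>a \<le> b\<close> \<open>0 < a\<close> \<open>Suc b < length p\<close> by simp
      show "adj x (?q 1)" using that by simp
      have "a - 1 + (?m - 2) = b" using that by simp
      then show "adj y (?q (?m - 2))" using that by simp
      have "?q ` {..<?m} \<subseteq> set p" using that by auto
      then show "x \<notin> ?q ` {..<?m}" "y \<notin> ?q ` {..<?m}" using that by blast+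
    qed (rule \<open>x \<noteq> y\<close>)
    show False
    proof (cases "i \<le> j")
      case True
      then show ?thesis using main[of i j w v] i j' w uv j by auto
    next
      case False
      then show ?thesis using main[of j i v w] i j' w uv j by auto
    qed
  qed
qed

text \<open>The two arms of the path at \<open>p ! i\<close> cannot both have length three or more,
  by the extended \<open>E7\<close>, and an arm of length two excludes one of length five, by the
  extended \<open>E8\<close>. What remains is type \<open>D\<close>, with the branch next to an end,
  or type \<open>E\<close>, with 5, 6 or 7 vertices on the path.\<close>

lemma branch_position:
  assumes p: "longest p" and w: "w \<notin> set p" "adj w (p ! i)" "i < length p"
  shows "i = length p - 2 \<or> i = 1 \<or> (i = 2 \<or> i = length p - 3) \<and> length p \<in> {5, 6, 7}"
proof (rule ccontr)
  assume contr: "\<not> ?thesis"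
  have gp: "gpath p" using p by (simp add: longest_def)
  have i: "0 < i" "Suc i < length p" using longest_attachment[OF p w] by auto
  have E8: False if "longest p" "w \<notin> set p" "adj w (p ! 2)" "8 \<le> length p" for p
  proof -
    have gp: "gpath p" "p \<noteq> []" using that by (auto simp: longest_def)
    have "distinct [p ! 0, p ! 1, p ! 2, p ! 3, p ! 4, p ! 5, p ! 6, p ! 7, w]"
      using gp that by (auto simp: gpath_def nth_eq_iff_index_eq)
    then show False
      by (rule no_E8) (use that gp adj_sym in \<open>auto simp: adj_path_iff\<close>)
  qed
  show False
  proof (cases "3 \<le> i \<and> i + 3 < length p")
    case True
    define k where "k = i - 3"
    have ik: "i = k + 3" using True by (simp add: k_def)
    have "distinct [p ! k, p ! (k + 1), p ! (k + 2), p ! (k + 3), p ! (k + 4), p ! (k + 5), p ! (k + 6), w]"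
      using gp w(1) True ik by (auto simp: gpath_def nth_eq_iff_index_eq)
    then show False
      by (rule no_E7) (use True ik gp w(2) adj_sym in \<open>auto simp: adj_path_iff\<close>)
  next
    case False
    with contr i have cases: "i = 2 \<or> i = length p - 3" and len: "8 \<le> length p \<or> length p < 5" by auto
    have "5 \<le> length p" using contr i cases by auto
    with len have len: "8 \<le> length p" by simp
    from cases show False
    proof
      assume "i = 2"
      with E8[OF p w(1) _ len] w(2) show False by simp
    next
      assume "i = length p - 3"
      then have "rev p ! 2 = p ! i" using len by (simp add: rev_nth)
      with E8[OF longest_rev[OF p]] w len show False by simp
    qed
  qed
qed

definition edges_via :: "('v \<Rightarrow> nat) \<Rightarrow> nat set set" where
  "edges_via f = {{f u, f v} | u v. adj u v}"

lemma path_coordinates: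
  assumes p: "gpath p" and V: "V = set p"
  shows "\<exists>f. bij_betw f V {..<length p} \<and> edges_via f = line_edges (length p)"
proof -
  have bij: "bij_betw ((!) p) {..<length p} V"
  proof (rule bij_betw_nth[OF _ refl V])
    show "distinct p" using p by (simp add: gpath_def)
  qed
  define f where "f = inv_into {..<length p} ((!) p)"
  have f: "f (p ! i) = i" if "i < length p" for i
    unfolding f_def using bij that by (intro inv_into_f_f) (auto simp: bij_betw_def)
  have "edges_via f = line_edges (length p)"
  proof (intro equalityI subsetI)
    fix e assume "e \<in> edges_via f"
    then obtain u v where e: "e = {f u, f v}" "adj u v" by (auto simp: edges_via_def)
    then obtain i j where ij: "u = p ! i" "v = p ! j" "i < length p" "j < length p"
      using V adj_V adj_sym by (metis in_set_conv_nth)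
    with e have "j = Suc i \<or> i = Suc j" using adj_path_iff[OF p] by blast
    with e(1) ij f show "e \<in> line_edges (length p)"
      by (auto simp: line_edges_def insert_commute)
  next
    fix e assume "e \<in> line_edges (length p)"
    then obtain i where "e = {i, Suc i}" "Suc i < length p" by (auto simp: line_edges_def)
    then show "e \<in> edges_via f"
      unfolding edges_via_def using gpath_nth(1)[OF p, of i] f[of i] f[of "Suc i"]
      by (intro CollectI exI[of _ "p ! i"] exI[of _ "p ! Suc i"]) auto
  qed
  moreover have "bij_betw f V {..<length p}"
    unfolding f_def by (rule bij_betw_inv_into[OF bij])
  ultimately show ?thesis by blast
qed

lemma branch_coordinates:
  assumes p: "gpath p" and V: "V = insert w (set p)" and w: "w \<notin> set p" "adj w (p ! i)" "i < length p"
  shows "\<exists>f. bij_betw f V {..<length p + 1} \<and> edges_via f = insert {i, length p} (line_edges (length p))"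
proof -
  let ?n = "length p"
  have bij: "bij_betw ((!) (p @ [w])) {..<?n + 1} V"
  proof (rule bij_betw_nth)
    show "distinct (p @ [w])" using p w(1) by (simp add: gpath_def)
  qed (use V in auto)
  define f where "f = inv_into {..<?n + 1} ((!) (p @ [w]))"
  have f': "f ((p @ [w]) ! i) = i" if "i < ?n + 1" for i
    unfolding f_def using bij that by (intro inv_into_f_f) (auto simp: bij_betw_def)
  have f: "f (p ! i) = i" if "i < ?n" for i using f'[of i] that by (simp add: nth_append)
  have fw: "f w = ?n" using f'[of ?n] by simp
  have wi: "j = i" if "adj w (p ! j)" "j < ?n" for j
    using unique_attachment[OF p _ _ w(1)] w(2,3) that by (metis linorder_neqE_nat)
  have "edges_via f = insert {i, ?n} (line_edges ?n)"
  proof (intro equalityI subsetI)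
    fix e assume "e \<in> edges_via f"
    then obtain u v where e: "e = {f u, f v}" "adj u v" by (auto simp: edges_via_def)
    have uv: "u \<in> V" "v \<in> V" using e(2) adj_V adj_sym by blast+
    consider "u = w" | "v = w" | "u \<in> set p" "v \<in> set p" using uv V by blast
    then show "e \<in> insert {i, ?n} (line_edges ?n)"
    proof cases
      case 1
      then have "v \<in> set p" using uv(2) V e(2) adj_irrefl by auto
      then obtain j where "j < ?n" "v = p ! j" by (auto simp: in_set_conv_nth)
      with 1 e wi f fw show ?thesis by auto
    next
      case 2
      then have "u \<in> set p" using uv(1) V e(2) adj_irrefl by auto
      then obtain j where "j < ?n" "u = p ! j" by (auto simp: in_set_conv_nth)
      with 2 e wi f fw adj_sym show ?thesis by auto
    next
      case 3
      then obtain i j where ij: "u = p ! i" "v = p ! j" "i < length p" "j < length p"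
        by (metis in_set_conv_nth)
      with e have "j = Suc i \<or> i = Suc j" using adj_path_iff[OF p] by blast
      with e(1) ij f show ?thesis
        by (auto simp: line_edges_def insert_commute)
    qed
  next
    fix e assume "e \<in> insert {i, ?n} (line_edges ?n)"
    then consider "e = {i, ?n}" | k where "e = {k, Suc k}" "Suc k < ?n" by (auto simp: line_edges_def)
    then show "e \<in> edges_via f"
    proof cases
      case 1
      then show ?thesis
        unfolding edges_via_def using w adj_sym f fw
        by (intro CollectI exI[of _ "p ! i"] exI[of _ w]) auto
    next
      case (2 k)
      then show ?thesis
        unfolding edges_via_def using gpath_nth(1)[OF p, of k] f[of k] f[of "Suc k"]
        by (intro CollectI exI[of _ "p ! k"] exI[of _ "p ! Suc k"]) auto
    qed
  qed
  moreover have "bij_betw f V {..<?n + 1}"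
    unfolding f_def by (rule bij_betw_inv_into[OF bij])
  ultimately show ?thesis by blast
qed

text \<open>The standard diagrams have the branch at position \<open>n - 3\<close> or
  \<open>2\<close> of the line, here with \<open>n = length p + 1\<close>. If the branch is counted
  from the other end, the coordinates \<open>g\<close> along the reversed path are used.\<close>

lemma Dynkin_coordinates:
  "\<exists>f n Es. bij_betw f V {..<n} \<and> edges_via f = Es \<and>
    (1 \<le> n \<and> Es = line_edges n \<or>
     4 \<le> n \<and> Es = insert {n - 3, n - 1} (line_edges (n - 1)) \<or>
     n \<in> {6, 7, 8} \<and> Es = insert {2, n - 1} (line_edges (n - 1)))"
proof -
  obtain p where p: "longest p" using ex_longest by blast
  then have gp: "gpath p" by (simp add: longest_def)
  have "set p \<subseteq> V" "set p \<noteq> {}" using gp by (auto simp: gpath_def)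
  show ?thesis
  proof (cases "V = set p")
    case True
    moreover have "1 \<le> length p" using gp by (cases p) (auto simp: gpath_def)
    ultimately show ?thesis using path_coordinates[OF gp] by blast
  next
    case False
    then obtain u w where "u \<in> set p" "w \<notin> set p" "adj w u"
      using neighbour_outside[OF \<open>set p \<subseteq> V\<close> \<open>set p \<noteq> {}\<close>] by blast
    then obtain i where w: "w \<notin> set p" "adj w (p ! i)" "i < length p" by (auto simp: in_set_conv_nth)
    have V: "V = insert w (set p)" by (rule at_most_one_outside[OF p w])
    have i: "0 < i" "Suc i < length p" using longest_attachment[OF p w] by auto
    have rev: "V = insert w (set (rev p))" "w \<notin> set (rev p)" "adj w (rev p ! (length p - Suc i))"
      "length p - Suc i < length (rev p)"
      using V w by (auto simp: rev_nth)
    obtain f where f: "bij_betw f V {..<length p + 1}" "edges_via f = insert {i, length p} (line_edges (length p))"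
      using branch_coordinates[OF gp V w] by blast
    obtain g where g: "bij_betw g V {..<length p + 1}"
      "edges_via g = insert {length p - Suc i, length p} (line_edges (length p))"
      using branch_coordinates[OF gpath_rev[OF gp] rev] unfolding length_rev by blast
    from branch_position[OF p w] consider "i = length p - 2" | "i = 1"
      | "i = 2" "length p \<in> {5, 6, 7}" | "i = length p - 3" "length p \<in> {5, 6, 7}" by blast
    then show ?thesis
    proof cases
      case 1
      then show ?thesis
        using f i by (intro exI[of _ f] exI[of _ "length p + 1"] exI[of _ "edges_via f"]) simp
    next
      case 2
      then show ?thesis
        using g i by (intro exI[of _ g] exI[of _ "length p + 1"] exI[of _ "edges_via g"]) (simp add: numeral_2_eq_2)
    next
      case 3
      then show ?thesis
        using f by (intro exI[of _ f] exI[of _ "length p + 1"] exI[of _ "edges_via f"]) auto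
    next
      case 4
      then have "length p - Suc i = 2" by auto
      with 4 show ?thesis
        using g by (intro exI[of _ g] exI[of _ "length p + 1"] exI[of _ "edges_via g"]) auto
    qed
  qed
qed

end

section \<open>From quivers to graphs without subadditive weights\<close>

lemma double_simps [simp]:
  "verts (double Q) = verts Q" "arcs (double Q) = arcs Q <+> arcs Q"
  "tail (double Q) (Inl a) = tail Q a" "tail (double Q) (Inr a) = head Q a"
  "head (double Q) (Inl a) = head Q a" "head (double Q) (Inr a) = tail Q a"
  by (simp_all add: double_def)

lemma fin_digraph_double: "fin_digraph Q \<Longrightarrow> fin_digraph (double Q)"
  by (auto simp: fin_digraph_def fin_digraph_axioms_def wf_digraph_def)

text \<open>Connectedness as an induction principle over vertices: the double contains every arc in
  both directions, so closure under tails is closure under neighbours.\<close>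

lemma connected_induct:
  assumes "Digraph_Component.connected Q" and S: "S \<subseteq> verts Q" "S \<noteq> {}"
    and closed: "\<And>c. c \<in> arcs (double Q) \<Longrightarrow> head (double Q) c \<in> S \<Longrightarrow> tail (double Q) c \<in> S"
  shows "S = verts Q"
proof
  obtain u where u: "u \<in> S" using S by auto
  show "verts Q \<subseteq> S"
  proof
    fix v assume "v \<in> verts Q"
    then have "u \<rightarrow>\<^sup>*\<^bsub>with_proj (mk_symmetric Q)\<^esub> v"
      using assms(1) u S unfolding connected_def strongly_connected_def by (auto simp: mk_symmetric_def)
    then have "(u, v) \<in> rtrancl_on (verts (with_proj (mk_symmetric Q))) (arcs_ends (with_proj (mk_symmetric Q)))"
      by (simp add: reachable_def)
    then show "v \<in> S"
    proof (induction rule: rtrancl_on_induct)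
      case (step x y)
      then obtain a where a: "a \<in> arcs Q" "(x, y) = (tail Q a, head Q a) \<or> (x, y) = (head Q a, tail Q a)"
        by (auto simp: mk_symmetric_def arcs_ends_conv)
      from a(2) show ?case
        using closed[of "Inr a"] closed[of "Inl a"] a(1) step by auto
    qed (rule u)
  qed
qed (rule S)

lemma sum_ge_card_mult:
  fixes f :: "'a \<Rightarrow> nat"
  assumes "finite A" "B \<subseteq> A" "\<And>b. b \<in> B \<Longrightarrow> f b = 1" "card B = 2"
  shows "2 \<le> sum f A"
proof -
  have "2 = sum f B" using assms(3,4) by simp
  also have "\<dots> \<le> sum f A" using assms(1,2) by (intro sum_mono2) auto
  finally show ?thesis .
qed

text \<open>By contraposition: without such a weight the quiver has neither loops nor multiple
  edges, so its underlying graph falls under \<open>definite_graph\<close> and gets the coordinates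
  of a Dynkin diagram.\<close>

lemma non_Dynkin_weight:
  fixes Q :: "('v, 'e) pre_digraph"
  assumes Q: "fin_digraph Q" and conn: "Digraph_Component.connected Q" and "\<not> Dynkin Q"
  shows "\<exists>\<delta> :: 'v \<Rightarrow> nat. (\<exists>v\<in>verts Q. 0 < \<delta> v) \<and>
    (\<forall>l\<in>verts Q. 2 * \<delta> l \<le> (\<Sum>c\<in>{c \<in> arcs (double Q). head (double Q) c = l}. \<delta> (tail (double Q) c)))"
proof (rule ccontr)
  assume contr: "\<not> ?thesis"
  interpret fin_digraph Q by (rule Q)
  interpret G: fin_digraph "double Q" by (rule fin_digraph_double[OF Q])
  define H where "H l = {c \<in> arcs (double Q). head (double Q) c = l}" for l
  have finH: "finite (H l)" for l using G.finite_arcs by (simp add: H_def)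
  have zero: "\<delta> v = 0" if "\<And>l. l \<in> verts Q \<Longrightarrow> 2 * \<delta> l \<le> (\<Sum>c\<in>H l. \<delta> (tail (double Q) c))" "v \<in> verts Q"
    for \<delta> :: "'v \<Rightarrow> nat" and v
  proof (rule ccontr)
    assume "\<delta> v \<noteq> 0"
    with that(2) have "\<exists>v\<in>verts Q. 0 < \<delta> v" by auto
    moreover have "\<forall>l\<in>verts Q. 2 * \<delta> l \<le> (\<Sum>c\<in>{c \<in> arcs (double Q). head (double Q) c = l}. \<delta> (tail (double Q) c))"
      using that(1) unfolding H_def by blast
    ultimately show False using contr by (elim notE) (intro exI[of _ \<delta>] conjI)
  qed
  define adj where "adj u v \<longleftrightarrow> (\<exists>c\<in>arcs (double Q). head (double Q) c = u \<and> tail (double Q) c = v)" for u v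
  have adj_arc: "adj u v \<longleftrightarrow> (\<exists>a\<in>arcs Q. (u, v) = (head Q a, tail Q a) \<or> (u, v) = (tail Q a, head Q a))" for u v
  proof
    assume "\<exists>a\<in>arcs Q. (u, v) = (head Q a, tail Q a) \<or> (u, v) = (tail Q a, head Q a)"
    then obtain a where a: "a \<in> arcs Q" and "u = head Q a \<and> v = tail Q a \<or> u = tail Q a \<and> v = head Q a" by auto
    from this(2) obtain c where "c = Inl a \<or> c = Inr a" "head (double Q) c = u" "tail (double Q) c = v" by force
    with a show "adj u v" unfolding adj_def by auto
  qed (auto simp: adj_def)
  \<comment> \<open>A loop counts twice in the double, so weight 1 at its vertex alone would be
    admissible.\<close>
  have no_loop: "tail Q a \<noteq> head Q a" if a: "a \<in> arcs Q" for a
  proof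
    assume eq: "tail Q a = head Q a"
    have "(if head Q a = head Q a then 1 else 0 :: nat) = 0"
    proof (rule zero[of "\<lambda>v. if v = head Q a then 1 else 0"])
      fix l assume "l \<in> verts Q"
      show "2 * (if l = head Q a then 1 else 0) \<le> (\<Sum>c\<in>H l. if tail (double Q) c = head Q a then 1 else (0 :: nat))"
      proof (cases "l = head Q a")
        case True
        have "2 \<le> (\<Sum>c\<in>H l. if tail (double Q) c = head Q a then 1 else (0 :: nat))"
          by (rule sum_ge_card_mult[OF finH, of "{Inl a, Inr a}"]) (use True eq a in \<open>auto simp: H_def\<close>)
        with True show ?thesis by simp
      qed simp
    qed (use a in auto)
    then show False by simp
  qed
  \<comment> \<open>Two edges with the same ends would admit weight 1 at these ends;
    \<open>ca\<close> and \<open>cb\<close> are the arcs over \<open>a\<close> and \<open>b\<close>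
    in the double that point to \<open>l\<close>.\<close>
  have no_multi: "a = b" if ab: "a \<in> arcs Q" "b \<in> arcs Q" "{tail Q a, head Q a} = {tail Q b, head Q b}" for a b
  proof (rule ccontr)
    assume "a \<noteq> b"
    let ?u = "tail Q a" and ?v = "head Q a"
    let ?\<delta> = "\<lambda>w. if w = ?u \<or> w = ?v then 1 else (0 :: nat)"
    have "?\<delta> ?u = 0"
    proof (rule zero[of ?\<delta>])
      fix l assume "l \<in> verts Q"
      show "2 * ?\<delta> l \<le> (\<Sum>c\<in>H l. ?\<delta> (tail (double Q) c))"
      proof (cases "l = ?u \<or> l = ?v")
        case True
        define ca where "ca = (if l = ?u then Inr a else Inl a)"
        define cb where "cb = (if l = tail Q b then Inr b else Inl b)"
        have "2 \<le> (\<Sum>c\<in>H l. ?\<delta> (tail (double Q) c))"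
        proof (rule sum_ge_card_mult[OF finH, of "{ca, cb}"])
          show "{ca, cb} \<subseteq> H l" using ab True by (auto simp: H_def ca_def cb_def doubleton_eq_iff)
          show "?\<delta> (tail (double Q) c) = 1" if "c \<in> {ca, cb}" for c
            using that ab True by (auto simp: ca_def cb_def doubleton_eq_iff split: if_splits)
          show "card {ca, cb} = 2" using \<open>a \<noteq> b\<close> by (auto simp: ca_def cb_def)
        qed
        with True show ?thesis by simp
      qed simp
    qed (use ab in auto)
    then show False by simp
  qed
  interpret definite_graph "verts Q" adj
  proof
    show "finite (verts Q)" by simp
    show "verts Q \<noteq> {}" using conn by (auto simp: connected_def strongly_connected_def mk_symmetric_def)
    show "u \<in> verts Q" if "adj u v" for u v using that by (auto simp: adj_arc)
    show "adj v u" if "adj u v" for u v using that by (auto simp: adj_arc)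
    show "\<not> adj v v" for v using no_loop no_loop[symmetric] by (auto simp: adj_arc)
    show "S = verts Q" if "S \<subseteq> verts Q" "S \<noteq> {}" "\<And>u v. u \<in> S \<Longrightarrow> adj u v \<Longrightarrow> v \<in> S" for S
      by (rule connected_induct[OF conn that(1,2)]) (use that(3) in \<open>auto simp: adj_def\<close>)
    fix \<delta> :: "'v \<Rightarrow> nat" and v
    assume T: "\<And>v. v \<in> verts Q \<Longrightarrow> 0 < \<delta> v \<Longrightarrow> \<exists>T. finite T \<and> (\<forall>t\<in>T. adj v t) \<and> 2 * \<delta> v \<le> sum \<delta> T"
      and v: "v \<in> verts Q"
    show "\<delta> v = 0"
    proof (rule zero[OF _ v])
      fix l assume l: "l \<in> verts Q"
      show "2 * \<delta> l \<le> (\<Sum>c\<in>H l. \<delta> (tail (double Q) c))"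
      proof (cases "\<delta> l = 0")
        case False
        then obtain T where T: "finite T" "\<forall>t\<in>T. adj l t" "2 * \<delta> l \<le> sum \<delta> T" using T[OF l] by auto
        have "sum \<delta> T \<le> sum \<delta> (tail (double Q) ` H l)"
          using T(2) finH by (intro sum_mono2) (auto simp: adj_def H_def)
        also have "\<dots> \<le> sum (\<delta> \<circ> tail (double Q)) (H l)"
          by (rule sum_image_le[OF finH]) simp
        finally show ?thesis using T(3) by (simp add: o_def)
      qed simp
    qed
  qed
  obtain f n Es where f: "bij_betw f (verts Q) {..<n}" "edges_via f = Es"
    and Es: "1 \<le> n \<and> Es = line_edges n \<or>
     4 \<le> n \<and> Es = insert {n - 3, n - 1} (line_edges (n - 1)) \<or>
     n \<in> {6, 7, 8} \<and> Es = insert {2, n - 1} (line_edges (n - 1))"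
    using Dynkin_coordinates by blast
  have "bij_betw (\<lambda>a. {f (tail Q a), f (head Q a)}) (arcs Q) Es"
  proof (rule bij_betw_imageI)
    show "inj_on (\<lambda>a. {f (tail Q a), f (head Q a)}) (arcs Q)"
    proof (rule inj_onI)
      fix a b assume ab: "a \<in> arcs Q" "b \<in> arcs Q" "{f (tail Q a), f (head Q a)} = {f (tail Q b), f (head Q b)}"
      then have "f ` {tail Q a, head Q a} = f ` {tail Q b, head Q b}" by simp
      moreover have "inj_on f (verts Q)" using f(1) by (rule bij_betw_imp_inj_on)
      ultimately have "{tail Q a, head Q a} = {tail Q b, head Q b}"
        using ab by (subst (asm) inj_on_image_eq_iff[of f "verts Q"]) auto
      then show "a = b" using no_multi ab by blast
    qed
    show "(\<lambda>a. {f (tail Q a), f (head Q a)}) ` arcs Q = Es"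
      unfolding f(2)[symmetric] edges_via_def adj_arc by (auto simp: insert_commute)
  qed
  with f(1) have "underlying_graph_is Q n Es" unfolding underlying_graph_is_def by blast
  with Es \<open>\<not> Dynkin Q\<close> show False unfolding Dynkin_def by auto
qed

subsection \<open>Hilbert series\<close>

context preprojective_datum
begin

lemma rel_ideal_length_0:
  assumes "x \<in> rel_ideal"
  shows "Poly_Mapping.lookup x (u, [], v) = 0"
  using assms
proof (induction rule: rel_ideal_induct)
  case subspace
  show ?case by (auto simp: pm.subspace_def lookup_add)
qed (auto simp: rel_at_def lookup_sum lookup_single)

lemma lookup_path_scalar: "v \<in> verts G \<Longrightarrow> Poly_Mapping.lookup (path_scalar G c) (v, [], v) = c"
  by (simp add: path_scalar_def lookup_sum lookup_single when_def)

lemma path_scalar_add: "path_scalar G c + path_scalar G d = path_scalar G (c + d)"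
  by (simp add: path_scalar_def sum.distrib[symmetric] single_add)

lemma path_scalar_smul: "smul c (path_scalar G d) = path_scalar G (c * d)"
  by (simp add: path_scalar_def pm.scale_sum_right)

text \<open>The dimension of a component is taken over a subfield of the ring. In a nonzero quotient
  the image of this one, \<open>vscalars B\<close>, is a subfield again.\<close>

lemma subfield_path_scalar:
  assumes "verts G \<noteq> {}"
  shows "subfield (range (path_scalar G :: 'k \<Rightarrow> ('v, 'b) path \<Rightarrow>\<^sub>0 'k)) A"
proof -
  interpret A: ring A by (rule ring_path_algebra)
  obtain v where v: "v \<in> verts G" using assms by auto
  let ?s = "path_scalar G :: 'k \<Rightarrow> ('v, 'b) path \<Rightarrow>\<^sub>0 'k"
  have mult: "?s c \<cdot> ?s d = ?s (c * d)" for c d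
    by (simp add: path_scalar_mult[OF path_scalar_supported] path_scalar_smul)
  have zero: "?s 0 = 0" by (simp add: path_scalar_def)
  have inj: "?s c = ?s d \<longleftrightarrow> c = d" for c d
  proof
    assume "?s c = ?s d"
    then have "Poly_Mapping.lookup (?s c) (v, [], v) = Poly_Mapping.lookup (?s d) (v, [], v)" by simp
    then show "c = d" unfolding lookup_path_scalar[OF v] .
  qed simp
  have uminus: "\<ominus>\<^bsub>A\<^esub> ?s c = ?s (- c)" for c
    by (rule A.minus_equality) (simp_all add: path_scalar_supported path_scalar_add zero)
  show ?thesis
  proof (rule A.subfieldI[OF A.subcringI[OF A.subringI]])
    show "range ?s \<subseteq> carrier A" using path_scalar_supported by auto
    show "Units (A\<lparr>carrier := range ?s\<rparr>) = range ?s - {\<zero>\<^bsub>A\<^esub>}"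
    proof (intro equalityI subsetI)
      fix x assume "x \<in> Units (A\<lparr>carrier := range ?s\<rparr>)"
      then obtain c d where "x = ?s c" "?s d \<cdot> ?s c = ?s 1" by (auto simp: Units_def)
      then have "x = ?s c" "d * c = 1" using mult inj by auto
      then show "x \<in> range ?s - {\<zero>\<^bsub>A\<^esub>}" using inj[of c 0] zero by auto
    next
      fix x assume "x \<in> range ?s - {\<zero>\<^bsub>A\<^esub>}"
      then obtain c where c: "x = ?s c" "c \<noteq> 0" using zero by auto
      then have "?s (inverse c) \<cdot> x = ?s 1" "x \<cdot> ?s (inverse c) = ?s 1" using mult by auto
      then show "x \<in> Units (A\<lparr>carrier := range ?s\<rparr>)" using c by (auto simp: Units_def)
    qed
  qed (auto simp: uminus mult path_scalar_add mult.commute)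
qed

text \<open>\<open>ring.dimension\<close> grows by line extensions, so basis vectors are added one
  at a time. A new one stays outside the span of the others in the quotient, because the whole span
  meets the ideal only in zero.\<close>

lemma dimension_B:
  assumes "finite S" "pm.independent S" "S \<subseteq> kG" "pm.span S \<inter> rel_ideal \<subseteq> {0}"
  shows "ring.dimension B (card S) (vscalars B) (q ` pm.span S)"
  using assms
proof (induction S rule: finite_induct)
  interpret B: ring B by (rule ring_B)
  case empty
  have "q ` pm.span {} = {\<zero>\<^bsub>B\<^esub>}" by (simp add: q_simps)
  then show ?case using B.zero_dim by simp
next
  interpret B: ring B by (rule ring_B)
  case (insert b S)
  have span: "pm.span S \<subseteq> pm.span (insert b S)" by (rule pm.span_mono) auto
  have indep: "pm.independent S" "b \<notin> pm.span S"
    using insert.prems(1) insert.hyps(2) by (auto simp: pm.independent_insert)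
  have IH: "B.dimension (card S) (vscalars B) (q ` pm.span S)"
    using insert span indep(1) by (intro insert.IH) auto
  have kG: "b \<in> kG" "pm.span S \<subseteq> kG"
    using insert.prems(2) by (auto intro: pm.span_minimal[THEN subsetD])
  have notin: "q b \<notin> q ` pm.span S"
  proof
    assume "q b \<in> q ` pm.span S"
    then obtain s where s: "s \<in> pm.span S" "q b = q s" by blast
    then have "b - s \<in> rel_ideal" using q_eq_iff[of b s] kG by blast
    moreover have "b - s \<in> pm.span (insert b S)"
      using pm.span_diff[OF pm.span_base[of b] subsetD[OF span s(1)]] by simp
    ultimately have "b = s" using insert.prems(3) by auto
    with s(1) indep(2) show False by simp
  qed
  have "B.line_extension (vscalars B) (q b) (q ` pm.span S) = q ` pm.span (insert b S)"
  proof (intro equalityI subsetI)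
    fix x assume "x \<in> B.line_extension (vscalars B) (q b) (q ` pm.span S)"
    then obtain c s where s: "s \<in> pm.span S" and "x = q (path_scalar G c) \<otimes>\<^bsub>B\<^esub> q b \<oplus>\<^bsub>B\<^esub> q s"
      by (auto simp: B.line_extension_mem_iff)
    moreover have "s \<in> kG" using s kG by blast
    moreover have "q (path_scalar G c) \<otimes>\<^bsub>B\<^esub> q b = q (smul c b)"
      using q_simps(2)[OF path_scalar_supported kG(1), of c] path_scalar_mult[OF kG(1)] by simp
    ultimately have "x = q (smul c b + s)" "smul c b + s \<in> pm.span (insert b S)"
      using q_simps(3)[of "smul c b" s] kG
        pm.span_add[OF pm.span_scale[OF pm.span_base[of b]] subsetD[OF span s]] by auto
    then show "x \<in> q ` pm.span (insert b S)" by blast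
  next
    fix x assume "x \<in> q ` pm.span (insert b S)"
    then obtain y c where y: "x = q y" "y - smul c b \<in> pm.span S"
      by (auto simp: pm.span_insert)
    let ?s = "y - smul c b"
    have "?s \<in> kG" using y(2) kG(2) by blast
    then have "x = q (path_scalar G c) \<otimes>\<^bsub>B\<^esub> q b \<oplus>\<^bsub>B\<^esub> q ?s"
      using y(1) q_simps(2)[OF path_scalar_supported kG(1), of c] path_scalar_mult[OF kG(1)]
        q_simps(3)[of "smul c b" ?s] kG(1) by simp
    then show "x \<in> B.line_extension (vscalars B) (q b) (q ` pm.span S)"
      using y(2) unfolding B.line_extension_mem_iff B_simps by blast
  qed
  moreover have "B.dimension (Suc (card S)) (vscalars B) (B.line_extension (vscalars B) (q b) (q ` pm.span S))"
    by (rule B.Suc_dim[OF q_simps(1)[OF kG(1)] notin IH])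
  ultimately show ?case using insert.hyps by simp
qed

lemma path_comp_kG: "path_comp d i j \<subseteq> kG"
  unfolding path_comp_def by (rule supported_mono) auto

lemma component_B:
  assumes "i \<in> verts G" "j \<in> verts G"
  shows "component B d i j = q ` path_comp d i j"
proof (intro equalityI subsetI)
  fix x assume "x \<in> component B d i j"
  then obtain y where y: "y \<in> gr_part d" "x = q y" "q (idem i) \<otimes>\<^bsub>B\<^esub> x = x" "x \<otimes>\<^bsub>B\<^esub> q (idem j) = x"
    by (auto simp: component_def)
  have kG: "y \<in> kG" using y(1) gr_part_kG by blast
  have "q (idem i \<cdot> y) = x"
    using y(2,3) q_simps(2)[OF idem_kG[OF assms(1)] kG] by simp
  then have "x = q (idem i \<cdot> y \<cdot> idem j)"
    using y(4) q_simps(2)[OF path_alg_mult_supported[OF idem_kG[OF assms(1)] kG] idem_kG[OF assms(2)]] by simp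
  moreover have "y \<cdot> idem j \<in> hom_part d j"
    unfolding mult_idem hom_part_def
    by (rule subsetD[OF supported_mono restrict_pm_Int[OF y(1)]]) auto
  then have "idem i \<cdot> y \<cdot> idem j \<in> path_comp d i j"
    unfolding path_alg_mult_assoc by (rule idem_mult_comp)
  ultimately show "x \<in> q ` path_comp d i j" by blast
next
  fix x assume "x \<in> q ` path_comp d i j"
  then obtain y where y: "x = q y" "y \<in> path_comp d i j" by (rule imageE)
  have kG: "y \<in> kG" using y(2) path_comp_kG by blast
  have "y \<in> gr_part d"
    using y(2) unfolding path_comp_def by (rule subsetD[OF supported_mono, rotated]) auto
  moreover have "idem i \<cdot> y = y" by (rule idem_mult_id[OF y(2)])
  moreover have "y \<cdot> idem j = y"
    by (rule starting_mult_idem[OF hom_part_starting[OF comp_hom_part[OF y(2)]]])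
  ultimately show "x \<in> component B d i j"
    unfolding component_def B_simps using assms kG y(1) by (auto simp: q_simps)
qed

text \<open>A basis of a complement of the ideal in \<open>path_comp d i j\<close> maps to a basis
  of the corresponding component of the quotient.\<close>

lemma hilbert_series_B:
  assumes "i \<in> verts G" "j \<in> verts G"
  shows "fps_nth (hilbert_series B i j) d = quot_dim d i j"
proof -
  interpret B: ring B by (rule ring_B)
  interpret h: ring_hom_ring A B q by (rule q_hom)
  obtain S where S: "S \<subseteq> path_comp d i j" "pm.independent S" "finite S" "pm.span S \<inter> ideal_comp d i j = {0}"
    "\<forall>x\<in>path_comp d i j. \<exists>s\<in>ideal_comp d i j. \<exists>b\<in>pm.span S. x = s + b" "int (card S) = quot_dim d i j"
    using comp_complement[of d i j] by (elim exE conjE)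
  have span: "pm.span S \<subseteq> path_comp d i j" by (rule pm.span_minimal[OF S(1)]) simp
  have "pm.span S \<inter> rel_ideal \<subseteq> {0}" using S(4) span by (auto simp: ideal_comp_def)
  moreover have "S \<subseteq> kG" using S(1) path_comp_kG by blast
  ultimately have "B.dimension (card S) (vscalars B) (q ` pm.span S)"
    by (intro dimension_B S)
  moreover have "q ` pm.span S = component B d i j"
  proof
    show "q ` pm.span S \<subseteq> component B d i j"
      using span unfolding component_B[OF assms] by blast
    show "component B d i j \<subseteq> q ` pm.span S"
      unfolding component_B[OF assms]
    proof
      fix x assume "x \<in> q ` path_comp d i j"
      then obtain y where y: "x = q y" "y \<in> path_comp d i j" by (rule imageE)
      obtain s b where sb: "s \<in> ideal_comp d i j" "b \<in> pm.span S" "y = s + b" using S(5) y(2) by blast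
      have "b \<in> kG" "y \<in> kG" using sb(2) y(2) span path_comp_kG by blast+
      then have "x = q b" using q_eq_iff[of y b] sb(1,3) y(1) by (simp add: ideal_comp_def)
      with sb(2) show "x \<in> q ` pm.span S" by blast
    qed
  qed
  moreover have "subfield (vscalars B) B"
  proof -
    \<comment> \<open>The image of the scalars is a subfield only if the quotient is nonzero.
      Elements of the ideal involve no trivial paths, so the unit is not among them.\<close>
    have "path_scalar G (1 :: 'k) \<notin> rel_ideal"
      using rel_ideal_length_0[of "path_scalar G 1" i i] lookup_path_scalar[OF assms(1), of "1 :: 'k"] by auto
    then have "\<one>\<^bsub>B\<^esub> \<noteq> \<zero>\<^bsub>B\<^esub>"
      using q_eq_zero_iff[OF path_scalar_supported[of 1]] by (simp add: q_simps(4))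
    then show ?thesis
      using h.img_is_subfield(2)[OF subfield_path_scalar] assms by auto
  qed
  ultimately have "B.dim (vscalars B) (component B d i j) = card S"
    using B.dimI[of "vscalars B" "card S" "component B d i j"] by (simp add: over_def)
  with S(6) show ?thesis by (simp add: hilbert_series_def)
qed

lemma quot_dim_recursion:
  assumes socle_free "j \<in> verts G"
  shows "quot_dim d i j = (case d of 0 \<Rightarrow> quot_dim 0 i j
    | Suc n \<Rightarrow> (\<Sum>c\<in>{c \<in> arcs G. tail G c = j}. quot_dim n i (head G c)) -
        (case n of 0 \<Rightarrow> 0 | Suc m \<Rightarrow> if j \<in> J then 0 else quot_dim m i j))"
  using quot_dim_no_relation[of _ j i] quot_dim_relation(2)[OF assms(2) _ assms(1)]
  by (auto split: nat.split)

text \<open>The recursion removes the first arc of a path and so acts on the right index. It yields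
  a left inverse of the matrix; \<open>left_inverse_is_inverse\<close> supplies the other
  side.\<close>

lemma hilbert_series_left_inverse:
  assumes sf: socle_free and ij: "i \<in> verts G" "j \<in> verts G"
  shows "matrix_prod (verts G) (hilbert_series B) (quadratic_matrix (adjacency G) (D_matrix J)) i j = fps_const (id_matrix i j)"
proof (rule fps_ext)
  fix d
  let ?h = "\<lambda>n l. quot_dim n i l"
  have coeff: "fps_nth (hilbert_series B i l * quadratic_matrix (adjacency G) (D_matrix J) l j) d =
      ?h d l * id_matrix l j - (if d = 0 then 0 else ?h (d - 1) l * adjacency G l j) +
      (if d < 2 then 0 else ?h (d - 2) l * D_matrix J l j)" if "l \<in> verts G" for l
  proof -
    have "hilbert_series B i l * quadratic_matrix (adjacency G) (D_matrix J) l j =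
        hilbert_series B i l * fps_const (id_matrix l j) -
        (hilbert_series B i l * fps_const (adjacency G l j)) * fps_X +
        (hilbert_series B i l * fps_const (D_matrix J l j)) * fps_X ^ 2"
      by (simp add: quadratic_matrix_def algebra_simps)
    then show ?thesis
      using hilbert_series_B[OF ij(1) that] by (simp add: fps_X_power_mult_right_nth)
  qed
  have adj: "(\<Sum>l\<in>verts G. ?h n l * adjacency G l j) = (\<Sum>c\<in>{c \<in> arcs G. tail G c = j}. ?h n (head G c))" for n
  proof -
    have "(\<Sum>l\<in>verts G. ?h n l * adjacency G l j) =
        (\<Sum>l\<in>verts G. \<Sum>c\<in>{c \<in> {c \<in> arcs G. tail G c = j}. head G c = l}. ?h n (head G c))"
    proof (rule sum.cong[OF refl])
      fix l
      have "{b \<in> arcs G. head G b = l \<and> tail G b = j} = {c \<in> {c \<in> arcs G. tail G c = j}. head G c = l}" by auto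
      then show "?h n l * adjacency G l j = (\<Sum>c\<in>{c \<in> {c \<in> arcs G. tail G c = j}. head G c = l}. ?h n (head G c))"
        by (simp add: adjacency_def)
    qed
    also have "\<dots> = (\<Sum>c\<in>{c \<in> arcs G. tail G c = j}. ?h n (head G c))"
      by (rule sum.group) auto
    finally show ?thesis .
  qed
  have id: "(\<Sum>l\<in>verts G. ?h n l * id_matrix l j) = ?h n j" for n
  proof -
    have "(\<Sum>l\<in>verts G. ?h n l * id_matrix l j) = (\<Sum>l\<in>verts G. if l = j then ?h n l else 0)"
      by (intro sum.cong) (auto simp: id_matrix_def)
    then show ?thesis using ij(2) by simp
  qed
  have D: "(\<Sum>l\<in>verts G. ?h n l * D_matrix J l j) = (if j \<in> J then 0 else ?h n j)" for n
  proof -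
    have "(\<Sum>l\<in>verts G. ?h n l * D_matrix J l j) = (\<Sum>l\<in>verts G. if l = j then if j \<in> J then 0 else ?h n j else 0)"
      by (intro sum.cong) (auto simp: D_matrix_def)
    then show ?thesis using ij(2) by simp
  qed
  have "fps_nth (matrix_prod (verts G) (hilbert_series B) (quadratic_matrix (adjacency G) (D_matrix J)) i j) d =
      (\<Sum>l\<in>verts G. ?h d l * id_matrix l j) - (if d = 0 then 0 else \<Sum>l\<in>verts G. ?h (d - 1) l * adjacency G l j) +
      (if d < 2 then 0 else \<Sum>l\<in>verts G. ?h (d - 2) l * D_matrix J l j)"
    by (simp add: matrix_prod_def fps_sum_nth coeff sum.distrib sum_subtractf)
  also have "\<dots> = fps_nth (fps_const (id_matrix i j)) d"
    unfolding adj id D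
  proof (cases d)
    case 0
    then show "?h d j - (if d = 0 then 0 else \<Sum>c\<in>{c \<in> arcs G. tail G c = j}. ?h (d - 1) (head G c)) +
      (if d < 2 then 0 else if j \<in> J then 0 else ?h (d - 2) j) = fps_nth (fps_const (id_matrix i j)) d"
      using quot_dim_0[OF ij(1)] by (simp add: id_matrix_def)
  next
    case (Suc n)
    then show "?h d j - (if d = 0 then 0 else \<Sum>c\<in>{c \<in> arcs G. tail G c = j}. ?h (d - 1) (head G c)) +
      (if d < 2 then 0 else if j \<in> J then 0 else ?h (d - 2) j) = fps_nth (fps_const (id_matrix i j)) d"
      using quot_dim_recursion[OF sf ij(2), of d i] by (cases n) auto
  qed
  finally show "fps_nth (matrix_prod (verts G) (hilbert_series B) (quadratic_matrix (adjacency G) (D_matrix J)) i j) d =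
      fps_nth (fps_const (id_matrix i j)) d" .
qed

end

text \<open>The coefficients of the right inverse of \<open>1 - C t + D t\<^sup>2\<close>.\<close>

fun inverse_coeff :: "'v set \<Rightarrow> ('v \<Rightarrow> 'v \<Rightarrow> int) \<Rightarrow> ('v \<Rightarrow> 'v \<Rightarrow> int) \<Rightarrow> nat \<Rightarrow> 'v \<Rightarrow> 'v \<Rightarrow> int" where
  "inverse_coeff V C D 0 i j = id_matrix i j"
| "inverse_coeff V C D (Suc 0) i j = (\<Sum>l\<in>V. C i l * inverse_coeff V C D 0 l j)"
| "inverse_coeff V C D (Suc (Suc n)) i j =
     (\<Sum>l\<in>V. C i l * inverse_coeff V C D (Suc n) l j) - (\<Sum>l\<in>V. D i l * inverse_coeff V C D n l j)"

text \<open>The constant term of the matrix is the identity, so the coefficients of a right inverse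
  are determined one after another.\<close>

lemma right_inverse_exists:
  assumes "finite V" "i \<in> V"
  shows "matrix_prod V (quadratic_matrix C D) (\<lambda>i j. Abs_fps (\<lambda>n. inverse_coeff V C D n i j)) i j = fps_const (id_matrix i j)"
proof (rule fps_ext)
  fix d
  let ?L = "\<lambda>n l. inverse_coeff V C D n l j"
  have coeff: "fps_nth (quadratic_matrix C D i l * Abs_fps (\<lambda>n. ?L n l)) d =
      id_matrix i l * ?L d l - (if d = 0 then 0 else C i l * ?L (d - 1) l) +
      (if d < 2 then 0 else D i l * ?L (d - 2) l)" for l
  proof -
    have "quadratic_matrix C D i l * Abs_fps (\<lambda>n. ?L n l) =
        fps_const (id_matrix i l) * Abs_fps (\<lambda>n. ?L n l) -
        (fps_const (C i l) * Abs_fps (\<lambda>n. ?L n l)) * fps_X +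
        (fps_const (D i l) * Abs_fps (\<lambda>n. ?L n l)) * fps_X ^ 2"
      by (simp add: quadratic_matrix_def algebra_simps)
    then show ?thesis by (simp add: fps_X_power_mult_right_nth)
  qed
  have id: "(\<Sum>l\<in>V. id_matrix i l * ?L n l) = ?L n i" for n
  proof -
    have "(\<Sum>l\<in>V. id_matrix i l * ?L n l) = (\<Sum>l\<in>V. if l = i then ?L n l else 0)"
      by (intro sum.cong) (auto simp: id_matrix_def)
    then show ?thesis using assms by simp
  qed
  have "fps_nth (matrix_prod V (quadratic_matrix C D) (\<lambda>i j. Abs_fps (\<lambda>n. inverse_coeff V C D n i j)) i j) d =
      ?L d i - (if d = 0 then 0 else \<Sum>l\<in>V. C i l * ?L (d - 1) l) + (if d < 2 then 0 else \<Sum>l\<in>V. D i l * ?L (d - 2) l)"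
    by (simp add: matrix_prod_def fps_sum_nth coeff sum.distrib sum_subtractf id)
  also have "\<dots> = fps_nth (fps_const (id_matrix i j)) d"
  proof (cases d)
    case (Suc n)
    then show ?thesis by (cases n) auto
  qed simp
  finally show "fps_nth (matrix_prod V (quadratic_matrix C D) (\<lambda>i j. Abs_fps (\<lambda>n. inverse_coeff V C D n i j)) i j) d =
      fps_nth (fps_const (id_matrix i j)) d" .
qed

lemma matrix_prod_assoc:
  "matrix_prod V (matrix_prod V M N) P i j = matrix_prod V M (matrix_prod V N P) i j"
  unfolding matrix_prod_def sum_distrib_left sum_distrib_right
  by (subst sum.swap) (simp add: mult.assoc)

lemma matrix_prod_id:
  assumes "finite V"
  shows "i \<in> V \<Longrightarrow> matrix_prod V (\<lambda>i j. fps_const (id_matrix i j)) M i j = M i j"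
    and "j \<in> V \<Longrightarrow> matrix_prod V M (\<lambda>i j. fps_const (id_matrix i j)) i j = M i j"
proof -
  assume "i \<in> V"
  have "matrix_prod V (\<lambda>i j. fps_const (id_matrix i j)) M i j = (\<Sum>l\<in>V. if l = i then M l j else 0)"
    unfolding matrix_prod_def by (intro sum.cong) (auto simp: id_matrix_def)
  then show "matrix_prod V (\<lambda>i j. fps_const (id_matrix i j)) M i j = M i j" using assms \<open>i \<in> V\<close> by simp
next
  assume "j \<in> V"
  have "matrix_prod V M (\<lambda>i j. fps_const (id_matrix i j)) i j = (\<Sum>l\<in>V. if l = j then M i l else 0)"
    unfolding matrix_prod_def by (intro sum.cong) (auto simp: id_matrix_def)
  then show "matrix_prod V M (\<lambda>i j. fps_const (id_matrix i j)) i j = M i j" using assms \<open>j \<in> V\<close> by simp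
qed

lemma matrix_prod_cong:
  "(\<And>l. l \<in> V \<Longrightarrow> M i l = M' i l) \<Longrightarrow> (\<And>l. l \<in> V \<Longrightarrow> N l j = N' l j) \<Longrightarrow>
    matrix_prod V M N i j = matrix_prod V M' N' i j"
  unfolding matrix_prod_def by (intro sum.cong) auto

text \<open>With \<open>R\<close> a right inverse of \<open>M\<close>, associativity gives
  \<open>N = N (M R) = (N M) R = R\<close>.\<close>

lemma left_inverse_is_inverse:
  assumes V: "finite V"
    and left: "\<And>i j. i \<in> V \<Longrightarrow> j \<in> V \<Longrightarrow> matrix_prod V N (quadratic_matrix C D) i j = fps_const (id_matrix i j)"
  shows "is_inverse_matrix V (quadratic_matrix C D) N"
proof -
  define M where "M = quadratic_matrix C D"
  define R where "R = (\<lambda>i j. Abs_fps (\<lambda>n. inverse_coeff V C D n i j))"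
  have right: "matrix_prod V M R i j = fps_const (id_matrix i j)" if "i \<in> V" for i j
    using right_inverse_exists[OF V that, of C D j] by (simp add: M_def R_def)
  have "N i j = R i j" if ij: "i \<in> V" "j \<in> V" for i j
  proof -
    have "N i j = matrix_prod V N (\<lambda>i j. fps_const (id_matrix i j)) i j"
      using matrix_prod_id(2)[OF V ij(2)] by simp
    also have "\<dots> = matrix_prod V N (matrix_prod V M R) i j"
      using right by (intro matrix_prod_cong) auto
    also have "\<dots> = matrix_prod V (matrix_prod V N M) R i j"
      by (rule matrix_prod_assoc[symmetric])
    also have "\<dots> = matrix_prod V (\<lambda>i j. fps_const (id_matrix i j)) R i j"
      using left ij by (intro matrix_prod_cong) (auto simp: M_def)
    also have "\<dots> = R i j" by (rule matrix_prod_id(1)[OF V ij(1)])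
    finally show ?thesis .
  qed
  then have "matrix_prod V M N i j = fps_const (id_matrix i j)" if "i \<in> V" "j \<in> V" for i j
    using right[OF that(1), of j] matrix_prod_cong[of V M i M N j R] that by simp
  with left show ?thesis unfolding is_inverse_matrix_def M_def by blast
qed

context preprojective_datum
begin

theorem hilbert_series_and_koszul:
  assumes sf: socle_free
  shows "is_inverse_matrix (verts G) (quadratic_matrix (adjacency G) (D_matrix J)) (hilbert_series B)"
    and "koszul_presentation G {relation_sum}"
proof -
  show "is_inverse_matrix (verts G) (quadratic_matrix (adjacency G) (D_matrix J)) (hilbert_series B)"
    by (rule left_inverse_is_inverse[OF finite_verts hilbert_series_left_inverse[OF sf]])
  have "relation_sum \<in> gr_part 2"
    unfolding relation_sum_def rel_at_def
    by (intro supported_closed) (auto simp: awalk_Cons_iff awalk_Nil_iff)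
  then show "koszul_presentation G {relation_sum}"
    unfolding koszul_presentation_def
    using koszul_complex.koszul[OF koszul_complex_B[OF sf]] by simp
qed

end

text \<open>The minus sign of the second sum in the relation goes into \<open>\<eta>\<close> at the
  reversed arcs.\<close>

lemma preprojective_datum_double:
  fixes Q :: "('v, 'e) pre_digraph" and \<gamma> :: "'e + 'e \<Rightarrow> 'k::field"
  assumes "fin_digraph Q"
    and "\<forall>b\<in>arcs (double Q). head (double Q) b \<in> verts Q - J \<or> tail (double Q) b \<in> verts Q - J \<longrightarrow> \<gamma> b \<noteq> 0"
  shows "preprojective_datum (double Q) (case_sum Inr Inl)
    (case_sum (\<lambda>a. \<gamma> (Inl a)) (\<lambda>a. - \<gamma> (Inr a))) J"
proof -
  interpret fin_digraph "double Q" by (rule fin_digraph_double[OF assms(1)])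
  have nz: "\<gamma> c \<noteq> 0" if "c \<in> arcs (double Q)" "head (double Q) c \<notin> J" for c
    using assms(2) that head_in_verts[OF that(1)] by auto
  have "\<gamma> (Inl a) \<noteq> 0" if "a \<in> arcs Q" "head Q a \<notin> J" for a
    using nz[of "Inl a"] that by auto
  moreover have "\<gamma> (Inr a) \<noteq> 0" if "a \<in> arcs Q" "tail Q a \<notin> J" for a
    using nz[of "Inr a"] that by auto
  ultimately show ?thesis
    by unfold_locales (auto split: sum.splits)
qed

text \<open>Grouping the arcs of the double by their heads merges the two sums of the relation:
  \<open>Inl a\<close> ends at the head of \<open>a\<close>, and \<open>Inr a\<close> at its
  tail.\<close>

lemma preproj_relation_eq:
  fixes Q :: "('v, 'e) pre_digraph" and \<gamma> :: "'e + 'e \<Rightarrow> 'k::field"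
  assumes datum: "preprojective_datum (double Q) (case_sum Inr Inl)
    (case_sum (\<lambda>a. \<gamma> (Inl a)) (\<lambda>a. - \<gamma> (Inr a))) J"
  shows "preproj_relation Q J \<gamma> = preprojective_datum.relation_sum (double Q) (case_sum Inr Inl)
    (case_sum (\<lambda>a. \<gamma> (Inl a)) (\<lambda>a. - \<gamma> (Inr a))) J"
proof -
  interpret preprojective_datum "double Q" "case_sum Inr Inl" "case_sum (\<lambda>a. \<gamma> (Inl a)) (\<lambda>a. - \<gamma> (Inr a))" J
    by (rule datum)
  let ?star = "case_sum Inr Inl :: 'e + 'e \<Rightarrow> 'e + 'e"
  let ?\<eta> = "case_sum (\<lambda>a. \<gamma> (Inl a)) (\<lambda>a. - \<gamma> (Inr a))"
  let ?F = "\<lambda>c. Poly_Mapping.single (head (double Q) c, [?star c, c], head (double Q) c) (?\<eta> c)"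
  let ?V = "verts Q - J"
  have fin: "finite (arcs Q)" using finite_arcs by (auto simp: finite_Plus_iff)
  have "relation_sum = (\<Sum>j\<in>?V. \<Sum>c\<in>{c \<in> {c \<in> arcs (double Q). head (double Q) c \<in> ?V}. head (double Q) c = j}. ?F c)"
    unfolding relation_sum_def rel_at_def double_simps(1) by (intro sum.cong) auto
  also have "\<dots> = (\<Sum>c\<in>{c \<in> arcs (double Q). head (double Q) c \<in> ?V}. ?F c)"
  proof (rule sum.group)
    show "finite {c \<in> arcs (double Q). head (double Q) c \<in> ?V}"
      by (rule finite_subset[OF _ finite_arcs]) blast
  qed (use finite_verts in auto)
  also have "{c \<in> arcs (double Q). head (double Q) c \<in> ?V} =
      Inl ` {a \<in> arcs Q. head Q a \<in> ?V} \<union> Inr ` {a \<in> arcs Q. tail Q a \<in> ?V}" by auto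
  also have "(\<Sum>c\<in>Inl ` {a \<in> arcs Q. head Q a \<in> ?V} \<union> Inr ` {a \<in> arcs Q. tail Q a \<in> ?V}. ?F c) =
      (\<Sum>c\<in>Inl ` {a \<in> arcs Q. head Q a \<in> ?V}. ?F c) + (\<Sum>c\<in>Inr ` {a \<in> arcs Q. tail Q a \<in> ?V}. ?F c)"
    using fin by (intro sum.union_disjoint) auto
  also have "\<dots> = preproj_relation Q J \<gamma>"
    unfolding preproj_relation_def
    by (simp add: sum.reindex single_uminus sum_negf)
  finally show ?thesis by simp
qed

theorem theorem3p5p1:
  fixes Q :: "('v, 'e) pre_digraph"
  assumes "fin_digraph Q" and "Digraph_Component.connected Q"
  shows "(\<forall>J (\<gamma> :: 'e + 'e \<Rightarrow> 'k::field).
            J \<subseteq> verts Q \<and> J \<noteq> {} \<and>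
            (\<forall>b\<in>arcs (double Q).
               head (double Q) b \<in> verts Q - J \<or> tail (double Q) b \<in> verts Q - J \<longrightarrow> \<gamma> b \<noteq> 0) \<longrightarrow>
            is_inverse_matrix (verts Q)
              (quadratic_matrix (adjacency (double Q)) (D_matrix J))
              (hilbert_series (partial_preproj Q J \<gamma>)) \<and>
            koszul_presentation (double Q) {preproj_relation Q J \<gamma>}) \<and>
         (\<not> Dynkin Q \<longrightarrow>
          (\<forall>\<gamma> :: 'e + 'e \<Rightarrow> 'k.
            (\<forall>b\<in>arcs (double Q). \<gamma> b \<noteq> 0) \<longrightarrow>
            is_inverse_matrix (verts Q)
              (quadratic_matrix (adjacency (double Q)) id_matrix)
              (hilbert_series (partial_preproj Q {} \<gamma>)) \<and>
            koszul_presentation (double Q) {preproj_relation Q {} \<gamma>}))"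
proof -
  \<comment> \<open>Both claims are instances of this statement: for empty \<open>J\<close> the
    matrix \<open>D_matrix J\<close> is the identity, and the non-Dynkin condition takes the place
    of a nonempty \<open>J\<close>.\<close>
  have main: "is_inverse_matrix (verts Q) (quadratic_matrix (adjacency (double Q)) (D_matrix J))
        (hilbert_series (partial_preproj Q J \<gamma>)) \<and>
      koszul_presentation (double Q) {preproj_relation Q J \<gamma>}"
    if J: "J \<subseteq> verts Q" and \<gamma>: "\<forall>b\<in>arcs (double Q).
        head (double Q) b \<in> verts Q - J \<or> tail (double Q) b \<in> verts Q - J \<longrightarrow> \<gamma> b \<noteq> 0"
      and J_or: "J \<noteq> {} \<or> \<not> Dynkin Q" for J and \<gamma> :: "'e + 'e \<Rightarrow> 'k"
  proof -
    have datum: "preprojective_datum (double Q) (case_sum Inr Inl)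
        (case_sum (\<lambda>a. \<gamma> (Inl a)) (\<lambda>a. - \<gamma> (Inr a))) J"
      by (rule preprojective_datum_double[OF assms(1) \<gamma>])
    then interpret preprojective_datum "double Q" "case_sum Inr Inl" "case_sum (\<lambda>a. \<gamma> (Inl a)) (\<lambda>a. - \<gamma> (Inr a))" J .
    have conn: "S = verts (double Q)" if "S \<subseteq> verts (double Q)" "S \<noteq> {}"
      "\<And>c. c \<in> arcs (double Q) \<Longrightarrow> head (double Q) c \<in> S \<Longrightarrow> tail (double Q) c \<in> S" for S
      using connected_induct[OF assms(2) _ that(2,3)] that(1) unfolding double_simps(1) by blast
    have socle_free
    proof (cases "J = {}")
      case False
      show ?thesis
        by (rule socle_free_nonempty[OF conn _ False]) (use J in simp_all)
    next
      case True
      with J_or obtain \<delta> :: "'v \<Rightarrow> nat" and i where i: "i \<in> verts Q" "0 < \<delta> i"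
        and \<delta>: "\<forall>l\<in>verts Q. 2 * \<delta> l \<le> (\<Sum>c\<in>{c \<in> arcs (double Q). head (double Q) c = l}. \<delta> (tail (double Q) c))"
        using non_Dynkin_weight[OF assms] by blast
      show ?thesis
      proof (rule socle_free_empty[OF True, of i \<delta>])
        show "S = verts (double Q)" if "S \<subseteq> verts (double Q)" "S \<noteq> {}"
          "\<And>c. c \<in> arcs (double Q) \<Longrightarrow> head (double Q) c \<in> S \<Longrightarrow> tail (double Q) c \<in> S" for S
          by (rule conn[OF that])
      qed (use i \<delta> in auto)
    qed
    from hilbert_series_and_koszul[OF this] show ?thesis
      unfolding partial_preproj_def preproj_relation_eq[OF datum] double_simps(1) by (rule conjI)
  qed
  have "D_matrix {} = (id_matrix :: 'v \<Rightarrow> 'v \<Rightarrow> int)"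
    by (intro ext) (simp add: D_matrix_def id_matrix_def)
  with main[of "{}"] main show ?thesis by auto
qed

end
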